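(* Let $V\subset\mathbb{R}^3$ be a finite set with $\#V=n\ge 4$ and $\operatorname{diam}V=1$. The following three statements are equivalent: (i) $V$ is extremal for the Vázsonyi problem, i.e., $e(V)=e(3,n)$; (ii) $e(V)=2n-2$; (iii) $V$ is tight and $V=\operatorname{vert}\mathcal{B}(V)$.
   Context: For a finite set $V\subset\mathbb{R}^3$ with at least two points, $\operatorname{diam}V$ is the maximum Euclidean distance between points of $V$, $e(V)$ is the number of (unordered) pairs $\{x,y\}\subset V$ with $\|x-y\|=\operatorname{diam}V$, and $e(3,n)$ is the maximum of $e(V)$ over all sets $V$ of $n$ points in $\mathbb{R}^3$. The circumradius $\operatorname{cr}(V)$ is the radius of the smallest closed ball containing $V$. The Ball set of $V$ is $\mathcal{B}(V)=\{y\in\mathbb{R}^3:\|x-y\|\le 1\text{ for all }x\in V\}$ (with $\mathcal{B}(\emptyset)=\mathbb{R}^3$). A point $v\in V$ is essential if $\mathcal{B}(V)\subsetneq\mathcal{B}(V\setminus\{v\})$. A finite set $V$ is tight if $\operatorname{cr}(V)<1$ and every point of $V$ is essential. $\operatorname{vert}\mathcal{B}(V)$, the set of vertices of $\mathcal{B}(V)$, consists of the points $z\in\mathcal{B}(V)$ such that either $\|z-p\|=1$ for at least three points $p\in V$ (principal vertices), or $z\in V$ and $\|z-p\|=1$ for exactly two points $p\in V$ (dangling vertices). *)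

theory Defs
  imports "HOL-Analysis.Analysis"
begin

text \<open>The diameter of a set is the library's \<open>diameter\<close>, a supremum, which is attained on a
  finite nonempty set.\<close>

definition diameter_pairs :: "(real^3) set \<Rightarrow> (real^3) set set" where
  "diameter_pairs V = {{x, y} | x y. x \<in> V \<and> y \<in> V \<and> x \<noteq> y \<and> dist x y = diameter V}"

definition num_diameters :: "(real^3) set \<Rightarrow> nat" where
  "num_diameters V = card (diameter_pairs V)"

definition max_num_diameters :: "nat \<Rightarrow> nat" where
  "max_num_diameters n = Max {num_diameters V | V. finite V \<and> card V = n}"

definition extremal_Vazsonyi :: "(real^3) set \<Rightarrow> bool" where
  "extremal_Vazsonyi V \<longleftrightarrow> num_diameters V = max_num_diameters (card V)"

text \<open>The condition \<open>0 \<le> r\<close> is there because \<open>cball c r\<close> is empty for negative \<open>r\<close>.\<close>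

definition circumradius :: "(real^3) set \<Rightarrow> real" where
  "circumradius V = (LEAST r. 0 \<le> r \<and> (\<exists>c. V \<subseteq> cball c r))"

definition ball_set :: "(real^3) set \<Rightarrow> (real^3) set" where
  "ball_set V = {y. \<forall>x\<in>V. dist x y \<le> 1}"

definition essential :: "(real^3) set \<Rightarrow> real^3 \<Rightarrow> bool" where
  "essential V v \<longleftrightarrow> v \<in> V \<and> ball_set V \<subset> ball_set (V - {v})"

definition tight :: "(real^3) set \<Rightarrow> bool" where
  "tight V \<longleftrightarrow> finite V \<and> circumradius V < 1 \<and> (\<forall>v\<in>V. essential V v)"

text \<open>The cardinalities below are meaningful only for finite \<open>V\<close>.\<close>

definition principal_vertices :: "(real^3) set \<Rightarrow> (real^3) set" where
  "principal_vertices V = {z \<in> ball_set V. card {p \<in> V. dist z p = 1} \<ge> 3}"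

definition dangling_vertices :: "(real^3) set \<Rightarrow> (real^3) set" where
  "dangling_vertices V = {z \<in> ball_set V. z \<in> V \<and> card {p \<in> V. dist z p = 1} = 2}"

definition ball_set_vertices :: "(real^3) set \<Rightarrow> (real^3) set" where
  "ball_set_vertices V = principal_vertices V \<union> dangling_vertices V"

text \<open>The maximum and the least radius above are well defined.\<close>

lemma num_diameters_le:
  assumes "finite V"
  shows "num_diameters V \<le> 2 ^ card V"
proof -
  have "diameter_pairs V \<subseteq> Pow V"
    unfolding diameter_pairs_def by auto
  then show ?thesis
    using card_mono[of "Pow V" "diameter_pairs V"] assms
    by (simp add: num_diameters_def card_Pow)
qed

lemma max_num_diameters_wf:
  "finite {num_diameters V | V. finite V \<and> card V = n}"
  "{num_diameters V | V. finite V \<and> card V = n} \<noteq> {}"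
proof -
  show "finite {num_diameters V | V. finite V \<and> card V = n}"
    by (rule finite_subset[of _ "{..2 ^ n}"]) (auto intro: num_diameters_le)
  have "infinite (UNIV :: (real^3) set)"
    using finite_imp_bounded[of "UNIV :: (real^3) set"] not_bounded_UNIV by auto
  then obtain V :: "(real^3) set" where "finite V" "card V = n"
    using infinite_arbitrarily_large by blast
  then show "{num_diameters V | V. finite V \<and> card V = n} \<noteq> {}"
    by blast
qed

lemma circumradius_exists:
  fixes V :: "(real^3) set"
  assumes "bounded V"
  shows "\<exists>r. 0 \<le> r \<and> (\<exists>c. V \<subseteq> cball c r) \<and>
    (\<forall>r'. 0 \<le> r' \<and> (\<exists>c. V \<subseteq> cball c r') \<longrightarrow> r \<le> (r'::real))"
proof (cases "V = {}")
  case True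
  then show ?thesis by (intro exI[of _ 0]) simp
next
  case False
  then obtain x where x: "x \<in> V" by blast
  obtain R where R: "V \<subseteq> cball x R"
    using assms bounded_any_center[of V x] by (auto simp: subset_iff)
  have R0: "0 \<le> R" using R x by auto
  define T where "T = (cball x R \<times> {0..R}) \<inter> (\<Inter>v\<in>V. {p. dist (fst p) v \<le> snd p})"
  have "compact T"
    unfolding T_def
    by (intro compact_Int_closed compact_Times compact_cball compact_Icc closed_INT ballI
        closed_Collect_le continuous_on_dist continuous_on_fst continuous_on_snd
        continuous_on_id continuous_on_const)
  moreover have "(x, R) \<in> T" using R R0 by (auto simp: T_def)
  moreover have "continuous_on T snd" by (intro continuous_intros)
  ultimately obtain p where p: "p \<in> T" "\<And>q. q \<in> T \<Longrightarrow> snd p \<le> snd q"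
    using continuous_attains_inf[of T snd] by blast
  have "snd p \<le> r'" if "0 \<le> r'" "V \<subseteq> cball c r'" for r' c
  proof (cases "r' \<le> R")
    case True
    have "dist x c \<le> r'" using that x by (auto simp: dist_commute)
    then have "(c, r') \<in> T" using True that by (auto simp: T_def)
    then show ?thesis using p(2)[of "(c, r')"] by simp
  next
    case False
    then show ?thesis using p(1) by (auto simp: T_def)
  qed
  moreover have "0 \<le> snd p" "V \<subseteq> cball (fst p) (snd p)"
    using p(1) by (auto simp: T_def subset_iff)
  ultimately show ?thesis by (intro exI[of _ "snd p"]) auto
qed

lemma circumradius:
  assumes "bounded V"
  shows "0 \<le> circumradius V" "\<exists>c. V \<subseteq> cball c (circumradius V)"
    "\<And>r c. 0 \<le> r \<Longrightarrow> V \<subseteq> cball c r \<Longrightarrow> circumradius V \<le> r"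
proof -
  obtain r where r: "0 \<le> r \<and> (\<exists>c. V \<subseteq> cball c r)"
    "\<And>r'. 0 \<le> r' \<and> (\<exists>c. V \<subseteq> cball c r') \<Longrightarrow> r \<le> r'"
    using circumradius_exists[OF assms] by blast
  have "circumradius V = r"
    unfolding circumradius_def using r by (intro Least_equality) blast+
  then show "0 \<le> circumradius V" "\<exists>c. V \<subseteq> cball c (circumradius V)"
    "\<And>r c. 0 \<le> r \<Longrightarrow> V \<subseteq> cball c r \<Longrightarrow> circumradius V \<le> r"
    using r by blast+
qed

end

theory Submission
  imports Defs
begin

text \<open>
  Let \<open>V\<close> have diameter at most 1, let every point of \<open>V\<close> have at least two others at distance 1, and
  let \<open>W\<close> be the vertex set of the ball set of \<open>V\<close>, so \<open>V \<subseteq> W\<close>. Write \<open>d w\<close> for the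
  number of points of \<open>V\<close> at distance 1 from \<open>w\<close>. Everything rests on the identity

  \<open>(\<Sum>w\<in>W. d w) + 4 = 2 * card W + 2 * card V\<close>     (\<open>incidence_count\<close>),

  valid as soon as some point of \<open>V\<close> has three others at distance 1. The sum over \<open>V\<close> alone is twice
  the number of unit distances, and the points of \<open>W - V\<close> have \<open>d w \<ge> 3\<close>. So there are at most
  \<open>2 n - 2\<close> unit distances, with equality exactly if \<open>W = V\<close> (\<open>excess_count\<close>). Points with at most
  two neighbours can be removed by induction, which gives the bound in general
  (\<open>card_unit_pairs_le\<close>); a regular tetrahedron with further points on one edge arc of
  its Reuleaux tetrahedron attains it
  (\<open>many_diameters_exist\<close>). Hence extremal means \<open>2 n - 2\<close> diameters. In an extremal set every
  point has degree at least 2, since otherwise its removal would violate the bound for \<open>n - 1\<close>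
  points, and some degree is at least 3 because \<open>2 n - 2 > n\<close>; so the identity gives \<open>W = V\<close>, and all points are
  essential (\<open>all_essential\<close>). Conversely \<open>W = V\<close> makes all degrees at least 2, and following an edge
  of the ball set produces a vertex of degree at least 3 (\<open>principal_vertex_exists\<close>), so the identity applies.

  The identity is Euler's formula for the boundary of the ball set, but its proof involves no planar
  topology. Outward normals send the boundary to the unit sphere, and suggest three kinds of convex
  spherical polygons: for a vertex \<open>w\<close> the one with corners \<open>w - x\<close>, where \<open>x\<close> runs through the
  points at distance 1 from \<open>w\<close>; for a point \<open>x\<close> of \<open>V\<close> the one with corners \<open>w - x\<close>, where \<open>w\<close>
  runs through the vertices at distance 1 from \<open>x\<close>; and for an edge from \<open>w\<close> to \<open>w'\<close> between the
  faces of \<open>x\<close> and \<open>y\<close> the rectangle with corners \<open>w - x, w - y, w' - x, w' - y\<close>. Four tiles meet at each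
  corner \<open>w - x\<close>. Fix generic poles \<open>\<plusminus>u\<close>. A convex polygon containing no pole has exactly two corners
  at which the meridian stays outside (\<open>card_supports\<close>), and one containing a pole has none
  (\<open>no_supports\<close>). At each corner, on the other hand, the meridian stays outside exactly two
  of the four tiles (\<open>corner_count\<close>). It remains to know how many tiles contain a pole. If \<open>u\<close> is chosen
  among the normals at a point \<open>x0\<close> of \<open>V\<close>, then \<open>- u\<close> is a direction from \<open>x0\<close> into its own face, and
  all other tiles are excluded: a linear functional has only one maximizer on the ball set
  (\<open>normal_meets_face\<close>, \<open>normals_disjoint\<close>), different faces have no direction in common
  (\<open>faces_disjoint\<close>), and all vertices of a face lie inside the chords of its edges
  (\<open>edge_face_side\<close>).
\<close>

unbundle cross3_syntax

section \<open>Spherical polygons and meridians\<close>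

lemma triple_rotate: "a \<bullet> (b \<times> c) = b \<bullet> (c \<times> a)" for a b c :: "real^3"
  by (simp add: cross3_simps)

lemma triple_swap: "a \<bullet> (b \<times> c) = - (a \<bullet> (c \<times> b))" for a b c :: "real^3"
  by (simp add: cross3_simps)

text \<open>Modulo \<open>p\<close>, the functionals \<open>k \<bullet> _\<close> and \<open>(p \<times> k) \<bullet> _\<close> are orthogonal coordinates on
  the plane normal to \<open>p\<close>. So the triple product with \<open>p\<close> is, up to a positive factor, the planar
  determinant in these coordinates, and orders the directions around \<open>p\<close> by angle.\<close>

lemma planar_coordinates_triple:
  fixes k p a b :: "real^3"
  assumes "k \<bullet> p = 0"
  shows "(k \<bullet> a) * ((p \<times> k) \<bullet> b) - (k \<bullet> b) * ((p \<times> k) \<bullet> a) = (k \<bullet> k) * (p \<bullet> (a \<times> b))"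
proof -
  have "(k \<bullet> a) * ((p \<times> k) \<bullet> b) - (k \<bullet> b) * ((p \<times> k) \<bullet> a)
      = (k \<bullet> k) * (p \<bullet> (a \<times> b)) - (k \<bullet> p) * (k \<bullet> (a \<times> b))"
    by (simp add: cross3_simps)
  then show ?thesis using assms by simp
qed

lemma orthogonal_coordinates:
  fixes a b c v :: "real^3"
  assumes "a \<bullet> b = 0" "a \<bullet> c = 0" "b \<bullet> c = 0" "a \<noteq> 0" "b \<noteq> 0" "c \<noteq> 0"
  obtains \<alpha> \<beta> \<gamma> where "v = \<alpha> *\<^sub>R a + \<beta> *\<^sub>R b + \<gamma> *\<^sub>R c"
proof -
  have dist: "a \<noteq> b" "a \<noteq> c" "b \<noteq> c" using assms by auto
  have "pairwise orthogonal {a, b, c}"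
    using assms by (auto simp: pairwise_insert orthogonal_def inner_commute)
  then have "independent {a, b, c}"
    using assms by (intro pairwise_orthogonal_independent) auto
  moreover have "card {a, b, c} = 3" using dist by simp
  ultimately have "span {a, b, c} = (UNIV :: (real^3) set)"
    using card_ge_dim_independent[of "{a, b, c}" "UNIV :: (real^3) set"]
    by (auto simp: dim_UNIV)
  then have "v \<in> span {a, b, c}" by simp
  then show thesis
    by (auto simp: span_insert span_singleton algebra_simps intro: that)
qed

text \<open>For unit vectors, \<open>u \<bullet> (p \<times> q)\<close> tells on which side of the meridian through \<open>p\<close> the point \<open>q\<close>
  lies, where the poles are \<open>\<plusminus>u\<close>. So \<open>p\<close> is a corner at which the meridian does not enter the
  spherical polygon spanned by \<open>C\<close>.\<close>

definition supports :: "real^3 \<Rightarrow> (real^3) set \<Rightarrow> real^3 \<Rightarrow> bool" where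
  "supports u C p \<longleftrightarrow> (\<forall>q\<in>C - {p}. 0 < u \<bullet> (p \<times> q)) \<or> (\<forall>q\<in>C - {p}. u \<bullet> (p \<times> q) < 0)"

text \<open>If the polygon contains no pole, its shadow on the plane normal to \<open>u\<close> lies in an open half-plane.
  There the corners are linearly ordered by longitude, and exactly the leftmost and the rightmost
  one are supported by their meridians.\<close>

lemma card_supports:
  fixes C :: "(real^3) set"
  assumes fin: "finite C" and two: "2 \<le> card C"
    and gen: "\<And>p q. p \<in> C \<Longrightarrow> q \<in> C \<Longrightarrow> p \<noteq> q \<Longrightarrow> u \<bullet> (p \<times> q) \<noteq> 0"
    and nopole: "\<And>t. t *\<^sub>R u \<notin> convex hull C"
  shows "card {p \<in> C. supports u C p} = 2"
proof -
  obtain p0 q0 where pq0: "p0 \<in> C" "q0 \<in> C" "p0 \<noteq> q0"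
    using two by (metis card_le_Suc0_iff_eq fin not_less_eq_eq numeral_2_eq_2)
  have u0: "u \<noteq> 0" using gen[OF pq0] by auto
  \<comment> \<open>projection along the axis; by assumption 0 is not in the shadow, so a plane separates them\<close>
  define \<pi> where "\<pi> q = q - (q \<bullet> u / (u \<bullet> u)) *\<^sub>R u" for q
  have lin: "linear \<pi>"
    unfolding \<pi>_def by (rule linearI) (auto simp: algebra_simps inner_simps add_divide_distrib)
  have "convex (\<pi> ` (convex hull C))" by (simp add: convex_linear_image lin)
  moreover have "compact (\<pi> ` (convex hull C))"
    using lin fin by (intro compact_continuous_image linear_continuous_on)
      (auto simp: linear_linear finite_imp_compact_convex_hull)
  moreover have "0 \<notin> \<pi> ` (convex hull C)"
  proof
    assume "0 \<in> \<pi> ` (convex hull C)"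
    then obtain x where "x \<in> convex hull C" "x = (x \<bullet> u / (u \<bullet> u)) *\<^sub>R u"
      by (auto simp: \<pi>_def)
    then show False using nopole by metis
  qed
  ultimately obtain a b where ab: "0 < b" "\<And>x. x \<in> \<pi> ` (convex hull C) \<Longrightarrow> a \<bullet> x > b"
    using separating_hyperplane_closed_0[of "\<pi> ` (convex hull C)"] compact_imp_closed by metis
  define k where "k = \<pi> a"
  have ku: "k \<bullet> u = 0" using u0 by (simp add: k_def \<pi>_def inner_diff_left)
  have kpos: "0 < k \<bullet> q" if "q \<in> C" for q
  proof -
    have "k \<bullet> q = a \<bullet> \<pi> q" by (simp add: k_def \<pi>_def inner_simps inner_commute)
    moreover have "b < a \<bullet> \<pi> q" by (rule ab(2)) (simp add: that hull_inc)
    ultimately show ?thesis using ab(1) by linarith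
  qed
  have kk: "0 < k \<bullet> k" using kpos[OF pq0(1)] by (cases "k = 0") auto
  define f where "f q = ((u \<times> k) \<bullet> q) / (k \<bullet> q)" for q
  have less: "f p < f q \<longleftrightarrow> 0 < u \<bullet> (p \<times> q)" if "p \<in> C" "q \<in> C" for p q
  proof -
    have "f p < f q \<longleftrightarrow> 0 < (k \<bullet> p) * ((u \<times> k) \<bullet> q) - (k \<bullet> q) * ((u \<times> k) \<bullet> p)"
      using kpos[OF that(1)] kpos[OF that(2)] by (simp add: f_def field_simps)
    then show ?thesis
      using planar_coordinates_triple[OF ku, of p q] kk by (simp add: zero_less_mult_iff)
  qed
  have inj: "f p \<noteq> f q" if "p \<in> C" "q \<in> C" "p \<noteq> q" for p q
    using less[OF that(1,2)] less[OF that(2,1)] gen[OF that] triple_swap[of u p q] by linarith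
  have sup: "supports u C p \<longleftrightarrow> (\<forall>q\<in>C. f p \<le> f q) \<or> (\<forall>q\<in>C. f q \<le> f p)" if p: "p \<in> C" for p
  proof -
    have "(\<forall>q\<in>C - {p}. 0 < u \<bullet> (p \<times> q)) \<longleftrightarrow> (\<forall>q\<in>C. f p \<le> f q)"
      using less[OF p] inj[OF p] by (metis Diff_iff insert_iff less_eq_real_def singletonD)
    moreover have "(\<forall>q\<in>C - {p}. u \<bullet> (p \<times> q) < 0) \<longleftrightarrow> (\<forall>q\<in>C. f q \<le> f p)"
    proof -
      have "u \<bullet> (p \<times> q) < 0 \<longleftrightarrow> f q < f p" if "q \<in> C" for q
        using less[OF that p] triple_swap[of u p q] by simp
      then show ?thesis
        using inj[OF p] by (metis Diff_iff insert_iff less_eq_real_def singletonD)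
    qed
    ultimately show ?thesis unfolding supports_def by simp
  qed
  obtain lo where lo: "lo \<in> C" "\<And>q. q \<in> C \<Longrightarrow> f lo \<le> f q"
    using fin pq0 arg_min_if_finite(1,2)[of C f] by (metis empty_iff leI)
  obtain hi where hi: "hi \<in> C" "\<And>q. q \<in> C \<Longrightarrow> f q \<le> f hi"
    using fin pq0 arg_min_if_finite(1,2)[of C "\<lambda>q. - f q"] by (metis empty_iff leI neg_less_iff_less)
  have "lo \<noteq> hi"
    using inj[OF pq0] lo hi pq0 by (metis order_antisym)
  moreover have "{p \<in> C. supports u C p} = {lo, hi}"
    using sup lo hi inj by auto (metis order_antisym)+
  ultimately show ?thesis by simp
qed

text \<open>A meridian supporting the polygon at a corner leaves everything else strictly on one side, while
  it passes through the pole: so the pole cannot be a convex combination of the corners.\<close>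

lemma no_supports:
  fixes C :: "(real^3) set"
  assumes fin: "finite C" and two: "2 \<le> card C"
    and gen: "\<And>p q. p \<in> C \<Longrightarrow> q \<in> C \<Longrightarrow> p \<noteq> q \<Longrightarrow> u \<bullet> (p \<times> q) \<noteq> 0"
    and pole: "t *\<^sub>R u \<in> convex hull C"
  shows "{p \<in> C. supports u C p} = {}"
proof -
  have False if p: "p \<in> C" and s: "supports u C p" for p
  proof -
    obtain c where c: "\<And>x. x \<in> C \<Longrightarrow> 0 \<le> c x" "sum c C = 1" "(\<Sum>x\<in>C. c x *\<^sub>R x) = t *\<^sub>R u"
      using pole fin by (auto simp: convex_hull_finite)
    obtain \<sigma> :: real where \<sigma>: "\<And>q. q \<in> C - {p} \<Longrightarrow> 0 < \<sigma> * (u \<bullet> (p \<times> q))"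
    proof -
      from s consider "\<forall>q\<in>C - {p}. 0 < u \<bullet> (p \<times> q)" | "\<forall>q\<in>C - {p}. u \<bullet> (p \<times> q) < 0"
        unfolding supports_def by blast
      then show thesis
      proof cases
        case 1
        then show thesis using that[of 1] by simp
      next
        case 2
        then show thesis using that[of "-1"] by simp
      qed
    qed
    have "0 = \<sigma> * ((u \<times> p) \<bullet> (t *\<^sub>R u))" by (simp add: dot_cross_self)
    also have "\<dots> = (\<Sum>q\<in>C. c q * (\<sigma> * (u \<bullet> (p \<times> q))))"
    proof -
      have "(u \<times> p) \<bullet> q = u \<bullet> (p \<times> q)" for q by (simp add: cross3_simps)
      then show ?thesis
        by (simp add: c(3)[symmetric] inner_sum_right sum_distrib_left mult_ac)
    qed
    finally have z: "(\<Sum>q\<in>C. c q * (\<sigma> * (u \<bullet> (p \<times> q)))) = 0" by simp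
    have "c q * (\<sigma> * (u \<bullet> (p \<times> q))) \<ge> 0" if "q \<in> C" for q
      using \<sigma>[of q] c(1)[OF that] that by (cases "q = p") (auto simp: less_imp_le)
    then have "\<forall>q\<in>C. c q * (\<sigma> * (u \<bullet> (p \<times> q))) = 0"
      using z fin by (subst (asm) sum_nonneg_eq_0_iff) auto
    then have c0: "c q = 0" if "q \<in> C" "q \<noteq> p" for q using that \<sigma>[of q] by fastforce
    then have "(\<Sum>x\<in>C. c x *\<^sub>R x) = c p *\<^sub>R p"
      by (subst sum.remove[OF fin p]) (simp add: sum.neutral)
    moreover have "sum c C = c p"
      using c0 by (subst sum.remove[OF fin p]) (simp add: sum.neutral)
    ultimately have "p = t *\<^sub>R u" using c by simp
    moreover obtain q where "q \<in> C" "q \<noteq> p"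
      using two by (metis card_le_Suc0_iff_eq fin not_less_eq_eq numeral_2_eq_2)
    ultimately show False using gen[OF p, of q] by (simp add: cross_mult_left dot_cross_self)
  qed
  then show ?thesis by blast
qed

text \<open>In an open half-plane the slope orders the directions by angle.\<close>

lemma planar_order_extremes:
  fixes A :: "(real^3) set"
  assumes "finite A" "A \<noteq> {}" and kp: "k \<bullet> p = 0" and kpos: "\<And>a. a \<in> A \<Longrightarrow> 0 < k \<bullet> a"
  obtains a where "a \<in> A" "\<And>b. b \<in> A \<Longrightarrow> 0 \<le> p \<bullet> (a \<times> b)"
proof -
  define f where "f q = ((p \<times> k) \<bullet> q) / (k \<bullet> q)" for q
  obtain a where a: "a \<in> A" "\<And>q. q \<in> A \<Longrightarrow> f a \<le> f q"
    using assms arg_min_if_finite(1,2)[of A f] by (metis leI)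
  show thesis
  proof (rule that[OF a(1)])
    fix b assume b: "b \<in> A"
    have pos: "0 < k \<bullet> a" "0 < k \<bullet> b" using kpos a b by auto
    have "0 \<le> (k \<bullet> a) * ((p \<times> k) \<bullet> b) - (k \<bullet> b) * ((p \<times> k) \<bullet> a)"
      using a(2)[OF b] pos by (simp add: f_def field_simps)
    then have "0 \<le> (k \<bullet> k) * (p \<bullet> (a \<times> b))" by (simp add: planar_coordinates_triple[OF kp])
    moreover have "0 < k \<bullet> k" using pos by (cases "k = 0") auto
    ultimately show "0 \<le> p \<bullet> (a \<times> b)" by (simp add: zero_le_mult_iff)
  qed
qed

text \<open>Four rays in the plane, in cyclic order and with consecutive angles below \<open>\<pi>\<close> (the angles between
  \<open>A1, A2\<close> and between \<open>B2, B1\<close> may vanish), turn once around the origin. A generic line through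
  the origin therefore separates exactly two of the four consecutive pairs. In terms of slopes:
  if none or all four pairs were separated, the slopes would increase, respectively decrease,
  all around the cycle.\<close>

lemma four_ray_signs:
  fixes A1 A2 B1 B2 :: "real \<times> real"
  defines "cr \<equiv> \<lambda>s t :: real \<times> real. fst s * snd t - fst t * snd s"
  assumes "A1 = A2 \<or> 0 < cr A1 A2" "0 < cr A2 B2" "B2 = B1 \<or> 0 < cr B2 B1" "0 < cr B1 A1"
    and nz: "fst A1 \<noteq> 0" "fst A2 \<noteq> 0" "fst B1 \<noteq> 0" "fst B2 \<noteq> 0"
  shows "of_bool (0 < fst A1 * fst A2) + of_bool (0 < fst B1 * fst B2)
    + of_bool (0 < fst A1 * fst B1) + of_bool (0 < fst A2 * fst B2) = (2::nat)"
proof -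
  define m where "m s = snd s / fst s" for s :: "real \<times> real"
  have pos: "m s < m t" if "0 < cr s t" "0 < fst s * fst t" for s t
    using that by (auto simp: cr_def m_def field_simps zero_less_mult_iff)
  have neg: "m t < m s" if "0 < cr s t" "fst s * fst t < 0" for s t
    using that by (auto simp: cr_def m_def field_simps mult_less_0_iff)
  define P where "P s \<longleftrightarrow> 0 < fst s" for s :: "real \<times> real"
  have same: "0 < fst s * fst t \<longleftrightarrow> P s = P t" if "fst s \<noteq> 0" "fst t \<noteq> 0" for s t
    using that by (auto simp: P_def zero_less_mult_iff)
  have step: "if P s = P t then m s < m t else m t < m s"
    if "0 < cr s t" "fst s \<noteq> 0" "fst t \<noteq> 0" for s t
    using pos[OF that(1)] neg[OF that(1)] same[OF that(2,3)] that(2,3)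
    by (metis linorder_neqE_linordered_idom mult_eq_0_iff)
  have e1: "A1 = A2 \<or> (if P A1 = P A2 then m A1 < m A2 else m A2 < m A1)"
    using assms(2) step[of A1 A2] nz by blast
  have e2: "if P A2 = P B2 then m A2 < m B2 else m B2 < m A2"
    using assms(3) step[of A2 B2] nz by blast
  have e3: "B2 = B1 \<or> (if P B2 = P B1 then m B2 < m B1 else m B1 < m B2)"
    using assms(4) step[of B2 B1] nz by blast
  have e4: "if P B1 = P A1 then m B1 < m A1 else m A1 < m B1"
    using assms(5) step[of B1 A1] nz by blast
  show ?thesis
    unfolding same[OF nz(1,2)] same[OF nz(3,4)] same[OF nz(1,3)] same[OF nz(2,4)]
    using e1 e2 e3 e4
    by (cases "P A1"; cases "P A2"; cases "P B1"; cases "P B2") auto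
qed

section \<open>Configurations of diameter one and their ball sets\<close>

definition touching :: "(real^3) set \<Rightarrow> real^3 \<Rightarrow> (real^3) set" where
  "touching V z = {p \<in> V. dist z p = 1}"

text \<open>Membership of a unit ball, seen from a point of its sphere, becomes a condition linear in the unit
  vector \<open>q\<close>. This linearity lets all distance conditions pass to convex combinations.\<close>

lemma unit_chord_le:
  fixes q d :: "real^3"
  assumes "norm q = 1"
  shows "norm (q - d) \<le> 1 \<longleftrightarrow> d \<bullet> d \<le> 2 * (q \<bullet> d)"
    and "norm (q - d) = 1 \<longleftrightarrow> d \<bullet> d = 2 * (q \<bullet> d)"
proof -
  have q: "q \<bullet> q = 1" using assms by (simp add: norm_eq_1)
  have "(norm (q - d))\<^sup>2 = 1 - 2 * (q \<bullet> d) + d \<bullet> d"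
    by (simp add: power2_norm_eq_inner inner_simps q inner_commute)
  moreover have "norm (q - d) \<le> 1 \<longleftrightarrow> (norm (q - d))\<^sup>2 \<le> 1"
    by (simp add: abs_square_le_1)
  moreover have "norm (q - d) = 1 \<longleftrightarrow> (norm (q - d))\<^sup>2 = 1"
    by (simp add: power2_eq_1_iff) (metis norm_ge_zero not_one_le_zero le_minus_one_simps(3))
  ultimately show "norm (q - d) \<le> 1 \<longleftrightarrow> d \<bullet> d \<le> 2 * (q \<bullet> d)"
    and "norm (q - d) = 1 \<longleftrightarrow> d \<bullet> d = 2 * (q \<bullet> d)" by auto
qed

lemma unit_inner_less_1:
  fixes p q :: "real^3"
  assumes "norm p = 1" "norm q = 1" "p \<noteq> q"
  shows "p \<bullet> q < 1"
proof -
  have "0 < (p - q) \<bullet> (p - q)" using assms by simp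
  moreover have "p \<bullet> p = 1" "q \<bullet> q = 1" using assms by (simp_all add: norm_eq_1)
  ultimately show ?thesis by (simp add: inner_simps inner_commute)
qed

text \<open>Two common points differ by a vector orthogonal to the plane of the centres, which are not collinear
  because a line meets a sphere at most twice; on a fixed normal line the sphere equation is quadratic.\<close>

lemma finite_three_sphere_points:
  fixes x y v :: "real^3"
  assumes "x \<noteq> y" "x \<noteq> v" "y \<noteq> v"
  shows "finite {z. dist z x = 1 \<and> dist z y = 1 \<and> dist z v = 1}" (is "finite ?S")
proof (cases "?S = {}")
  case False
  then obtain w where w: "w \<in> ?S" by blast
  define n where "n = (y - x) \<times> (v - x)"
  have eqs: "(z - w) \<bullet> (b - x) = 0" if "z \<in> ?S" "dist z b = 1" "dist w b = 1" for z b
  proof -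
    have "(b - x) \<bullet> (b - x) = 2 * ((z - x) \<bullet> (b - x))" "(b - x) \<bullet> (b - x) = 2 * ((w - x) \<bullet> (b - x))"
      using unit_chord_le(2)[of "z - x" "b - x"] unit_chord_le(2)[of "w - x" "b - x"] that w
      by (auto simp: dist_norm algebra_simps)
    then show ?thesis by (simp add: inner_simps)
  qed
  have n0: "n \<noteq> 0"
  proof
    assume "n = 0"
    then have "collinear {0, y - x, v - x}" by (simp add: n_def cross_eq_0)
    then obtain t where t: "v - x = t *\<^sub>R (y - x)"
      using assms by (auto simp: collinear_lemma)
    have 1: "(y - x) \<bullet> (y - x) = 2 * ((w - x) \<bullet> (y - x))" "(v - x) \<bullet> (v - x) = 2 * ((w - x) \<bullet> (v - x))"
      using unit_chord_le(2)[of "w - x" "y - x"] unit_chord_le(2)[of "w - x" "v - x"] w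
      by (auto simp: dist_norm algebra_simps)
    then have "t * t * ((y - x) \<bullet> (y - x)) = t * ((y - x) \<bullet> (y - x))"
      by (auto simp: t)
    then have "t = 0 \<or> t = 1" using assms by auto
    then show False using t assms by auto
  qed
  have "?S \<subseteq> {w, w + (- 2 * (n \<bullet> (w - x)) / (n \<bullet> n)) *\<^sub>R n}"
  proof
    fix z assume z: "z \<in> ?S"
    have "(z - w) \<bullet> (y - x) = 0" "(z - w) \<bullet> (v - x) = 0" using eqs[OF z] z w by auto
    then have "(z - w) \<times> n = 0" unfolding n_def by (simp add: Lagrange)
    then obtain t where t: "z - w = t *\<^sub>R n"
      using n0 by (auto simp: cross_eq_0 collinear_lemma insert_commute)
    have "(z - x) \<bullet> (z - x) = 1" "(w - x) \<bullet> (w - x) = 1"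
      using z w by (auto simp: dist_norm norm_eq_1)
    moreover have "z - x = (w - x) + t *\<^sub>R n" using t by (simp add: algebra_simps)
    ultimately have "2 * t * (n \<bullet> (w - x)) + t * t * (n \<bullet> n) = 0"
      by (simp add: inner_add_left inner_add_right inner_commute)
    then have "t = 0 \<or> 2 * (n \<bullet> (w - x)) + t * (n \<bullet> n) = 0" by algebra
    then have "t = 0 \<or> t = - 2 * (n \<bullet> (w - x)) / (n \<bullet> n)"
      using n0 by (auto simp: field_simps add_eq_0_iff)
    then show "z \<in> {w, w + (- 2 * (n \<bullet> (w - x)) / (n \<bullet> n)) *\<^sub>R n}"
      using t by (auto simp: algebra_simps)
  qed
  then show ?thesis by (rule finite_subset) simp
next
  case True
  then show ?thesis by (metis finite.emptyI)
qed

lemma another_element: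
  assumes "finite S" "2 \<le> card S"
  obtains t where "t \<in> S" "t \<noteq> s"
  using assms by (metis card_le_Suc0_iff_eq not_less_eq_eq numeral_2_eq_2)

lemma convex_inner_ge: "convex {q :: real^3. c \<le> 2 * (q \<bullet> d)}"
proof -
  have "{q :: real^3. c \<le> 2 * (q \<bullet> d)} = {q. (2 *\<^sub>R d) \<bullet> q \<ge> c}"
    by (auto simp: inner_commute)
  then show ?thesis using convex_halfspace_ge by metis
qed

lemma convex_hull_inner_ge:
  fixes S :: "(real^3) set"
  assumes "q \<in> convex hull S" "\<And>p. p \<in> S \<Longrightarrow> c \<le> 2 * (p \<bullet> d)"
  shows "c \<le> 2 * (q \<bullet> d)"
proof -
  have "convex hull S \<subseteq> {q. c \<le> 2 * (q \<bullet> d)}"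
    by (rule hull_minimal) (use assms(2) convex_inner_ge in auto)
  then show ?thesis using assms(1) by blast
qed

text \<open>The configurations for which the boundary complex of the ball set is well behaved. Two
  neighbours at distance 1 make a point of \<open>V\<close> essential and a vertex of the ball set.\<close>

locale unit_configuration =
  fixes V :: "(real^3) set"
  assumes finite_V: "finite V"
    and dist_le_1: "\<And>x y. x \<in> V \<Longrightarrow> y \<in> V \<Longrightarrow> dist x y \<le> 1"
    and degree_ge_2: "\<And>x. x \<in> V \<Longrightarrow> 2 \<le> card (touching V x)"
begin

abbreviation "T \<equiv> touching V"
abbreviation "B \<equiv> ball_set V"
abbreviation "W \<equiv> ball_set_vertices V"

lemma finite_T [simp]: "finite (T z)"
  using finite_V by (simp add: touching_def)

lemma T_D: "p \<in> T z \<Longrightarrow> p \<in> V" "p \<in> T z \<Longrightarrow> dist z p = 1" "p \<in> T z \<Longrightarrow> norm (z - p) = 1"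
  by (auto simp: touching_def dist_norm)

lemma T_I: "p \<in> V \<Longrightarrow> dist z p = 1 \<Longrightarrow> p \<in> T z"
  by (auto simp: touching_def)

lemma B_D: "z \<in> B \<Longrightarrow> v \<in> V \<Longrightarrow> dist z v \<le> 1" "z \<in> B \<Longrightarrow> v \<in> V \<Longrightarrow> norm (z - v) \<le> 1"
  by (auto simp: ball_set_def dist_commute dist_norm norm_minus_commute)

lemma V_subset_B: "x \<in> V \<Longrightarrow> x \<in> B"
  using dist_le_1 by (auto simp: ball_set_def)

lemma W_D: "w \<in> W \<Longrightarrow> w \<in> B" "w \<in> W \<Longrightarrow> 2 \<le> card (T w)"
  by (auto simp: ball_set_vertices_def principal_vertices_def dangling_vertices_def touching_def)

lemma W_I: "z \<in> B \<Longrightarrow> 3 \<le> card (T z) \<Longrightarrow> z \<in> W"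
  by (auto simp: ball_set_vertices_def principal_vertices_def touching_def)

lemma V_subset_W: "V \<subseteq> W"
proof
  fix x assume x: "x \<in> V"
  then show "x \<in> W"
    using degree_ge_2[OF x] V_subset_B[OF x]
    by (cases "card (T x) = 2")
      (auto simp: ball_set_vertices_def principal_vertices_def dangling_vertices_def touching_def)
qed

lemma finite_W: "finite W"
proof -
  have "W \<subseteq> V \<union> (\<Union>x\<in>V. \<Union>y\<in>V - {x}. \<Union>v\<in>V - {x, y}. {z. dist z x = 1 \<and> dist z y = 1 \<and> dist z v = 1})"
  proof
    fix z assume z: "z \<in> W"
    show "z \<in> V \<union> (\<Union>x\<in>V. \<Union>y\<in>V - {x}. \<Union>v\<in>V - {x, y}. {z. dist z x = 1 \<and> dist z y = 1 \<and> dist z v = 1})"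
    proof (cases "z \<in> V")
      case False
      then have "3 \<le> card (T z)"
        using z by (auto simp: ball_set_vertices_def principal_vertices_def dangling_vertices_def touching_def)
      then obtain S where "S \<subseteq> T z" "card S = 3"
        by (meson obtain_subset_with_card_n)
      then obtain x y v where "x \<in> T z" "y \<in> T z" "v \<in> T z" "x \<noteq> y" "x \<noteq> v" "y \<noteq> v"
        by (auto simp: card_3_iff)
      then show ?thesis by (auto simp: touching_def)
    qed simp
  qed
  moreover have "finite (\<Union>x\<in>V. \<Union>y\<in>V - {x}. \<Union>v\<in>V - {x, y}. {z. dist z x = 1 \<and> dist z y = 1 \<and> dist z v = 1})"
    using finite_V by (intro finite_UN_I) (auto intro!: finite_three_sphere_points)
  ultimately show ?thesis using finite_V by (meson finite_UnI finite_subset)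
qed

lemma face_inequality:
  assumes "w \<in> B" "dist w x = 1" "v \<in> V"
  shows "(v - x) \<bullet> (v - x) \<le> 2 * ((w - x) \<bullet> (v - x))"
  using unit_chord_le(1)[of "w - x" "v - x"] assms B_D(2)[of w v] by (simp add: dist_norm)

lemma normal_inequality:
  assumes "x \<in> T w" "z \<in> B"
  shows "(w - z) \<bullet> (w - z) \<le> 2 * ((w - x) \<bullet> (w - z))"
  using unit_chord_le(1)[of "w - x" "w - z"] T_D[OF assms(1)] B_D(2)[OF assms(2), of x]
  by (simp add: dist_norm)

text \<open>Seen from \<open>w\<close> on the unit sphere around \<open>x\<close>, the direction towards another point \<open>w'\<close> of the face
  makes an obtuse angle with the outward direction of every other unit sphere through \<open>w\<close>: moving
  towards \<open>w'\<close> stays inside all the other balls.\<close>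

lemma obtuse:
  assumes "w \<in> B" "w' \<in> B" "w \<noteq> w'" "x \<in> V" "dist w x = 1" "dist w' x = 1" "v \<in> T w" "v \<noteq> x"
  defines "k \<equiv> ((w' - x) \<bullet> (w - x)) *\<^sub>R (w - x) - (w' - x)"
  shows "k \<bullet> (w - x) = 0" "0 < k \<bullet> (w - v)"
proof -
  define p q d where "p = w - x" and "q = w' - x" and "d = v - x"
  have pq: "norm p = 1" "norm q = 1" "q \<noteq> p" using assms by (auto simp: p_def q_def dist_norm)
  have pp: "p \<bullet> p = 1" using pq by (simp add: norm_eq_1)
  have k: "k = (q \<bullet> p) *\<^sub>R p - q" by (simp add: k_def p_def q_def)
  have kp': "k \<bullet> p = 0" by (simp add: k inner_diff_left pp)
  show kp: "k \<bullet> (w - x) = 0" by (rule kp'[unfolded p_def])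
  have d: "0 < d \<bullet> d" using assms by (simp add: d_def)
  have v: "v \<in> V" "dist w v = 1" using T_D assms by auto
  have 1: "d \<bullet> d = 2 * (p \<bullet> d)"
    using unit_chord_le(2)[OF pq(1), of d] v by (simp add: p_def d_def dist_norm)
  have 2: "d \<bullet> d \<le> 2 * (q \<bullet> d)"
    using face_inequality[of w' x v] assms v by (simp add: q_def d_def)
  have "k \<bullet> (w - v) = k \<bullet> (w - x) - k \<bullet> d" by (simp add: d_def inner_simps)
  also have "\<dots> = q \<bullet> d - (q \<bullet> p) * (p \<bullet> d)" unfolding kp by (simp add: k inner_diff_left)
  finally have 3: "k \<bullet> (w - v) = q \<bullet> d - (q \<bullet> p) * (p \<bullet> d)" .
  have "(q \<bullet> p) * (p \<bullet> d) < 1 * (p \<bullet> d)"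
    using unit_inner_less_1[of q p] pq 1 d by (intro mult_strict_right_mono) auto
  then show "0 < k \<bullet> (w - v)" using 1 2 3 by linarith
qed

text \<open>Each \<open>w - x\<close> is an extreme ray of the normal cone at \<open>w\<close>: the other normals lie strictly on one
  side of a plane through it. The second point of the face of \<open>x\<close> provides the plane.\<close>

lemma normal_half_plane:
  assumes "w \<in> W" "x \<in> T w"
  obtains k where "k \<bullet> (w - x) = 0" "\<And>v. v \<in> T w \<Longrightarrow> v \<noteq> x \<Longrightarrow> 0 < k \<bullet> (w - v)"
proof -
  have x: "x \<in> V" "dist w x = 1" using T_D assms by auto
  obtain w' where w': "w' \<in> T x" "w' \<noteq> w"
    using another_element[OF finite_T degree_ge_2[OF x(1)]] by blast
  then have "w' \<in> B" "dist w' x = 1" using T_D V_subset_B by (auto simp: dist_commute)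
  then have ob: "w \<in> B" "w' \<in> B" "w \<noteq> w'" "x \<in> V" "dist w x = 1" "dist w' x = 1"
    using assms w' x W_D(1)[OF assms(1)] by auto
  obtain v where "v \<in> T w" "v \<noteq> x"
    using another_element[OF finite_T W_D(2)[OF assms(1)]] by blast
  then show thesis
    using that[OF obtuse(1)[OF ob]] obtuse(2)[OF ob] by blast
qed

text \<open>Of three rays in a common plane, inside an open half-plane of it, the middle one would not be extreme,
  against the previous lemma.\<close>

lemma not_coplanar:
  assumes w: "w \<in> W" and x: "x \<in> T w" and y: "y \<in> T w" and v: "v \<in> T w"
    and ne: "x \<noteq> y" "x \<noteq> v" "y \<noteq> v"
  shows "(w - x) \<bullet> ((w - y) \<times> (w - v)) \<noteq> 0"
proof
  assume 0: "(w - x) \<bullet> ((w - y) \<times> (w - v)) = 0"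
  define p1 p2 p3 where "p1 = w - x" and "p2 = w - y" and "p3 = w - v"
  obtain k1 where k1: "k1 \<bullet> p1 = 0" "0 < k1 \<bullet> p2" "0 < k1 \<bullet> p3"
    using normal_half_plane[OF w x] y v ne by (metis p1_def p2_def p3_def)
  obtain k2 where k2: "k2 \<bullet> p2 = 0" "0 < k2 \<bullet> p1" "0 < k2 \<bullet> p3"
    using normal_half_plane[OF w y] x v ne by (metis p1_def p2_def p3_def)
  obtain k3 where k3: "k3 \<bullet> p3 = 0" "0 < k3 \<bullet> p1" "0 < k3 \<bullet> p2"
    using normal_half_plane[OF w v] x y ne by (metis p1_def p2_def p3_def)
  \<comment> \<open>chosen orthogonal to \<open>k1\<close>; coplanarity then makes it a multiple of \<open>p1\<close>, whose sign is contradictory\<close>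
  define g where "g = (k1 \<bullet> p2) *\<^sub>R p3 - (k1 \<bullet> p3) *\<^sub>R p2"
  have p1: "norm p1 = 1" using T_D x by (simp add: p1_def)
  have nz: "p1 \<noteq> 0" "k1 \<noteq> 0" using p1 k1 by auto
  have "(norm (p1 \<times> k1))\<^sup>2 = (norm p1 * norm k1)\<^sup>2"
    using norm_cross_dot[of p1 k1] k1(1) by (simp add: inner_commute)
  then have c0: "p1 \<times> k1 \<noteq> 0" using nz by auto
  obtain \<alpha> \<beta> \<gamma> where g: "g = \<alpha> *\<^sub>R p1 + \<beta> *\<^sub>R k1 + \<gamma> *\<^sub>R (p1 \<times> k1)"
    using orthogonal_coordinates[of p1 k1 "p1 \<times> k1" g] nz c0 k1(1)
    by (auto simp: inner_commute dot_cross_self)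
  have "k1 \<bullet> g = 0" by (simp add: g_def inner_diff_right mult.commute)
  then have "\<beta> = 0" using nz k1(1) by (simp add: g inner_add_right dot_cross_self)
  have "(p1 \<times> k1) \<bullet> g = (k1 \<bullet> k1) * (p1 \<bullet> (p2 \<times> p3))"
    using planar_coordinates_triple[OF k1(1), of p2 p3] by (simp add: g_def inner_diff_right)
  then have "(p1 \<times> k1) \<bullet> g = 0" using 0 by (simp add: p1_def p2_def p3_def)
  then have "\<gamma> = 0" using c0 \<open>\<beta> = 0\<close> by (simp add: g inner_add_right dot_cross_self)
  have "k2 \<bullet> g = (k1 \<bullet> p2) * (k2 \<bullet> p3)" using k2(1) by (simp add: g_def inner_diff_right)
  then have "0 < \<alpha> * (k2 \<bullet> p1)"
    using k1 k2 \<open>\<beta> = 0\<close> \<open>\<gamma> = 0\<close> by (simp add: g)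
  moreover have "k3 \<bullet> g = - (k1 \<bullet> p3) * (k3 \<bullet> p2)" using k3(1) by (simp add: g_def inner_diff_right)
  then have "\<alpha> * (k3 \<bullet> p1) < 0"
    using k1 k3 \<open>\<beta> = 0\<close> \<open>\<gamma> = 0\<close> by (simp add: g)
  ultimately show False using k2 k3 by (simp add: zero_less_mult_iff mult_less_0_iff)
qed

text \<open>The normals at \<open>w\<close> are cyclically ordered; this is the successor of \<open>w - x\<close>.\<close>

lemma next_normal:
  assumes "w \<in> W" "x \<in> T w"
  obtains y where "y \<in> T w" "y \<noteq> x" "\<And>v. v \<in> T w \<Longrightarrow> 0 \<le> (w - x) \<bullet> ((w - y) \<times> (w - v))"
proof -
  obtain k where k: "k \<bullet> (w - x) = 0" "\<And>v. v \<in> T w \<Longrightarrow> v \<noteq> x \<Longrightarrow> 0 < k \<bullet> (w - v)"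
    using normal_half_plane W_D assms by metis
  obtain y where "y \<in> T w" "y \<noteq> x"
    using another_element[OF finite_T W_D(2)[OF assms(1)]] by blast
  then obtain a where a: "a \<in> (\<lambda>v. w - v) ` (T w - {x})"
    "\<And>b. b \<in> (\<lambda>v. w - v) ` (T w - {x}) \<Longrightarrow> 0 \<le> (w - x) \<bullet> (a \<times> b)"
    using planar_order_extremes[of "(\<lambda>v. w - v) ` (T w - {x})" k "w - x"] k by auto
  then obtain y where y: "y \<in> T w" "y \<noteq> x" "a = w - y" by auto
  show thesis
  proof (rule that[OF y(1,2)])
    fix v assume "v \<in> T w"
    then show "0 \<le> (w - x) \<bullet> ((w - y) \<times> (w - v))"
      using a(2)[of "w - v"] y by (cases "v = x") (auto simp: dot_cross_self)
  qed
qed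

text \<open>If two antipodal points of the circle where the unit spheres around \<open>x\<close> and \<open>y\<close> meet were in the
  ball set, the parallelogram law would put all of \<open>V\<close> into the ball with diameter \<open>[x, y]\<close>. There
  a point has at most one point at distance 1, its antipode. Hence all edges are shorter than
  semicircles.\<close>

lemma no_antipodes:
  assumes "x \<in> V" "y \<in> V" "dist z x = 1" "dist z y = 1" "z \<in> B" "x + y - z \<in> B"
  shows False
proof -
  define c where "c = (1/2) *\<^sub>R (x + y)"
  have c: "x + y = 2 *\<^sub>R c" by (simp add: c_def)
  have close: "(v - c) \<bullet> (v - c) \<le> 1/4" if v: "v \<in> V" for v
  proof -
    have "norm (z - v) \<le> 1" "norm (x + y - z - v) \<le> 1" using B_D(2) assms v by auto
    then have "(z - v) \<bullet> (z - v) \<le> 1" "(x + y - z - v) \<bullet> (x + y - z - v) \<le> 1"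
      by (simp_all add: dot_square_norm power_le_one)
    moreover have "(z - v) \<bullet> (z - v) + (x + y - z - v) \<bullet> (x + y - z - v)
        = 2 * ((v - c) \<bullet> (v - c)) + 2 * ((z - c) \<bullet> (z - c))"
      unfolding c by (simp add: inner_simps inner_commute)
    moreover have "(z - c) \<bullet> (z - c) = 1 - (x - y) \<bullet> (x - y) / 4"
    proof -
      have "(z - x) \<bullet> (z - x) = 1" "(z - y) \<bullet> (z - y) = 1"
        using assms by (auto simp: dist_norm norm_eq_1)
      moreover have "(z - x) \<bullet> (z - x) + (z - y) \<bullet> (z - y) = 2 * ((z - c) \<bullet> (z - c)) + (x - y) \<bullet> (x - y) / 2"
        unfolding c_def by (simp add: inner_simps inner_commute field_simps)
      ultimately show ?thesis by (simp add: field_simps)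
    qed
    moreover have "(x - y) \<bullet> (x - y) \<le> 1"
      using dist_le_1[OF assms(1,2)] by (simp add: dot_square_norm dist_norm power_le_one)
    ultimately show ?thesis by linarith
  qed
  have anti: "v + u = 2 *\<^sub>R c" if "v \<in> V" "u \<in> T v" for u v
  proof -
    have "(v - u) \<bullet> (v - u) = 1" using T_D that by (auto simp: norm_eq_1)
    moreover have "(v - u) \<bullet> (v - u) + (v + u - 2 *\<^sub>R c) \<bullet> (v + u - 2 *\<^sub>R c)
      = 2 * ((v - c) \<bullet> (v - c)) + 2 * ((u - c) \<bullet> (u - c))"
      by (simp add: inner_simps inner_commute)
    moreover have "u \<in> V" using T_D that by auto
    ultimately have "(v + u - 2 *\<^sub>R c) \<bullet> (v + u - 2 *\<^sub>R c) \<le> 0"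
      using close[of u] close[of v] that by linarith
    then have "v + u - 2 *\<^sub>R c = 0" by (metis inner_eq_zero_iff inner_ge_zero order_antisym)
    then show ?thesis by simp
  qed
  obtain u where u: "u \<in> T x" "u \<noteq> x"
    using another_element[OF finite_T degree_ge_2[OF assms(1)]] by blast
  obtain u' where u': "u' \<in> T x" "u' \<noteq> u"
    using another_element[OF finite_T degree_ge_2[OF assms(1)]] by blast
  show False using anti[OF assms(1) u(1)] anti[OF assms(1) u'(1)] u'(2) by (metis add_left_cancel)
qed

end

section \<open>Edges of the boundary complex\<close>

lemma triple_cross: "p \<bullet> (q \<times> v) = (p \<times> q) \<bullet> v" for p q v :: "real^3"
  by (simp add: cross3_simps)

lemma cross_conjugate: "(a - (1/2) *\<^sub>R g) \<times> (a + (1/2) *\<^sub>R g) = a \<times> g" for a g :: "real^3"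
  by (simp add: cross_add_left cross_add_right Cross3.left_diff_distrib cross_mult_left cross_mult_right
      cross_skew[of g a] flip: scaleR_add_left)

lemma triple_frame:
  fixes e1 e2 e3 :: "real^3"
  shows "(a1 *\<^sub>R e1 + a2 *\<^sub>R e2 + a3 *\<^sub>R e3) \<bullet>
      ((b1 *\<^sub>R e1 + b2 *\<^sub>R e2 + b3 *\<^sub>R e3) \<times> (c1 *\<^sub>R e1 + c2 *\<^sub>R e2 + c3 *\<^sub>R e3))
    = (a1 * (b2 * c3 - b3 * c2) - a2 * (b1 * c3 - b3 * c1) + a3 * (b1 * c2 - b2 * c1)) * (e1 \<bullet> (e2 \<times> e3))"
  by (simp add: cross_add_left cross_add_right cross_mult_left cross_mult_right inner_add_left
      inner_add_right dot_cross_self triple_swap[of e1 e3 e2] triple_rotate[of e2 e3 e1]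
      triple_swap[of e2 e1 e3] triple_rotate[of e3 e1 e2] triple_swap[of e3 e2 e1] algebra_simps)

context unit_configuration
begin

text \<open>An edge from \<open>w\<close> to \<open>w'\<close> with the face of \<open>x\<close> on one side and that of \<open>y\<close> on the other. The triple
  product fixes the orientation; the two conditions on \<open>v\<close> say that \<open>y\<close> follows \<open>x\<close> in the
  cyclic order at \<open>w\<close>, and \<open>x\<close> follows \<open>y\<close> at \<open>w'\<close>. For \<open>\<bar>\<xi>\<bar> < \<zeta>\<close> the points
  \<open>z\<close> on both unit spheres run through the open minor arc from \<open>w\<close> to \<open>w'\<close>. With this symmetric
  form, reversing an edge is immediate.\<close>

definition edge :: "real^3 \<Rightarrow> real^3 \<Rightarrow> real^3 \<Rightarrow> real^3 \<Rightarrow> bool" where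
  "edge w x w' y \<longleftrightarrow> w \<in> W \<and> w' \<in> W \<and> x \<in> T w \<and> y \<in> T w \<and> x \<in> T w' \<and> y \<in> T w' \<and> x \<noteq> y \<and>
    0 < (w - w') \<bullet> ((y - x) \<times> (w + w' - x - y)) \<and>
    (\<forall>v\<in>T w. 0 \<le> (w - x) \<bullet> ((w - y) \<times> (w - v))) \<and>
    (\<forall>v\<in>T w'. 0 \<le> (w' - y) \<bullet> ((w' - x) \<times> (w' - v))) \<and>
    (\<forall>\<xi> \<zeta>. \<bar>\<xi>\<bar> < \<zeta> \<longrightarrow> (let z = (1/2) *\<^sub>R (x + y) + \<xi> *\<^sub>R (w - w') + \<zeta> *\<^sub>R (w + w' - x - y) in
      dist z x = 1 \<longrightarrow> dist z y = 1 \<longrightarrow> z \<in> B \<and> z \<notin> W))"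

lemma edge_sym:
  assumes "edge w x w' y"
  shows "edge w' y w x"
proof -
  have 1: "(w' - w) \<bullet> ((x - y) \<times> (w' + w - y - x)) = (w - w') \<bullet> ((y - x) \<times> (w + w' - x - y))"
    by (simp add: cross3_simps)
  have 2: "dist z y = 1 \<longrightarrow> dist z x = 1 \<longrightarrow> z \<in> B \<and> z \<notin> W"
    if "\<bar>\<xi>\<bar> < \<zeta>" "z = (1/2) *\<^sub>R (y + x) + \<xi> *\<^sub>R (w' - w) + \<zeta> *\<^sub>R (w' + w - y - x)" for \<xi> \<zeta> z
  proof -
    have "z = (1/2) *\<^sub>R (x + y) + (- \<xi>) *\<^sub>R (w - w') + \<zeta> *\<^sub>R (w + w' - x - y)" "\<bar>- \<xi>\<bar> < \<zeta>"
      using that by (simp_all add: algebra_simps)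
    then show ?thesis using assms unfolding edge_def Let_def by blast
  qed
  show ?thesis
    using assms 2 unfolding edge_def Let_def 1 by blast
qed

text \<open>The four points satisfy the symmetries of a rectangle: in an orthogonal frame the four difference
  vectors have coordinates \<open>(\<plusminus>1/2, \<plusminus>1/2, 1/2)\<close>.\<close>

lemma edge_frame:
  assumes "edge w x w' y"
  defines "e1 \<equiv> w - w'" and "e2 \<equiv> y - x" and "e3 \<equiv> w + w' - x - y"
  shows "e1 \<bullet> e2 = 0" "e1 \<bullet> e3 = 0" "e2 \<bullet> e3 = 0" "e1 \<noteq> 0" "e2 \<noteq> 0" "e3 \<noteq> 0"
    and "e1 \<bullet> e1 + e2 \<bullet> e2 + e3 \<bullet> e3 = 4" "0 < e1 \<bullet> (e2 \<times> e3)"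
    and "w - x = (1/2) *\<^sub>R e1 + (1/2) *\<^sub>R e2 + (1/2) *\<^sub>R e3"
    and "w' - x = (-1/2) *\<^sub>R e1 + (1/2) *\<^sub>R e2 + (1/2) *\<^sub>R e3"
    and "w - y = (1/2) *\<^sub>R e1 + (-1/2) *\<^sub>R e2 + (1/2) *\<^sub>R e3"
    and "w' - y = (-1/2) *\<^sub>R e1 + (-1/2) *\<^sub>R e2 + (1/2) *\<^sub>R e3"
proof -
  show tri: "0 < e1 \<bullet> (e2 \<times> e3)" using assms unfolding edge_def by simp
  then show "e1 \<noteq> 0" "e2 \<noteq> 0" "e3 \<noteq> 0" by auto
  show wx: "w - x = (1/2) *\<^sub>R e1 + (1/2) *\<^sub>R e2 + (1/2) *\<^sub>R e3"
    and wx': "w' - x = (-1/2) *\<^sub>R e1 + (1/2) *\<^sub>R e2 + (1/2) *\<^sub>R e3"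
    and wy: "w - y = (1/2) *\<^sub>R e1 + (-1/2) *\<^sub>R e2 + (1/2) *\<^sub>R e3"
    and wy': "w' - y = (-1/2) *\<^sub>R e1 + (-1/2) *\<^sub>R e2 + (1/2) *\<^sub>R e3"
    by (simp_all add: e1_def e2_def e3_def vec_eq_iff field_simps)
  have "x \<in> T w" "y \<in> T w" "x \<in> T w'" "y \<in> T w'" using assms unfolding edge_def by auto
  then have "(w - x) \<bullet> (w - x) = 1" "(w - y) \<bullet> (w - y) = 1" "(w' - x) \<bullet> (w' - x) = 1" "(w' - y) \<bullet> (w' - y) = 1"
    using T_D(3) by (auto simp: norm_eq_1)
  then show "e1 \<bullet> e2 = 0" "e1 \<bullet> e3 = 0" "e2 \<bullet> e3 = 0" "e1 \<bullet> e1 + e2 \<bullet> e2 + e3 \<bullet> e3 = 4"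
    unfolding wx wy wx' wy' by (simp_all add: inner_simps inner_commute field_simps)
qed

lemma frame_norm:
  fixes e1 e2 e3 :: "real^3"
  assumes "e1 \<bullet> e2 = 0" "e1 \<bullet> e3 = 0" "e2 \<bullet> e3 = 0"
  shows "(a *\<^sub>R e1 + b *\<^sub>R e2 + c *\<^sub>R e3) \<bullet> (a *\<^sub>R e1 + b *\<^sub>R e2 + c *\<^sub>R e3)
    = a\<^sup>2 * (e1 \<bullet> e1) + b\<^sup>2 * (e2 \<bullet> e2) + c\<^sup>2 * (e3 \<bullet> e3)"
  using assms by (simp add: inner_simps inner_commute power2_eq_square)

lemma edge_arc:
  assumes ed: "edge w x w' y"
  defines "e1 \<equiv> w - w'" and "e2 \<equiv> y - x" and "e3 \<equiv> w + w' - x - y"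
  assumes le: "\<bar>\<xi>\<bar> \<le> \<zeta>" and q: "q = \<xi> *\<^sub>R e1 + (1/2) *\<^sub>R e2 + \<zeta> *\<^sub>R e3" and q1: "q \<bullet> q = 1"
  shows "x + q \<in> B" "dist (x + q) x = 1" "dist (x + q) y = 1"
    "x + q = w \<or> x + q = w' \<or> x + q \<notin> W"
proof -
  note fr = edge_frame[OF ed, folded e1_def e2_def e3_def]
  have n: "q \<bullet> q = \<xi>\<^sup>2 * (e1 \<bullet> e1) + (1/4) * (e2 \<bullet> e2) + \<zeta>\<^sup>2 * (e3 \<bullet> e3)"
    unfolding q frame_norm[OF fr(1-3)] by (simp add: power2_eq_square)
  show dx: "dist (x + q) x = 1" using q1 by (simp add: dist_norm norm_eq_1)
  have "x + q - y = \<xi> *\<^sub>R e1 + (-1/2) *\<^sub>R e2 + \<zeta> *\<^sub>R e3"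
    by (simp add: q e2_def vec_eq_iff field_simps)
  then have "(x + q - y) \<bullet> (x + q - y) = \<xi>\<^sup>2 * (e1 \<bullet> e1) + (-1/2)\<^sup>2 * (e2 \<bullet> e2) + \<zeta>\<^sup>2 * (e3 \<bullet> e3)"
    by (simp only: frame_norm[OF fr(1-3)])
  then have "(x + q - y) \<bullet> (x + q - y) = 1" using n q1 by (simp add: power2_eq_square)
  then show dy: "dist (x + q) y = 1" by (simp add: dist_norm norm_eq_1)
  have "(x + q = w \<or> x + q = w') \<or> (x + q \<in> B \<and> x + q \<notin> W)"
  proof (cases "\<bar>\<xi>\<bar> < \<zeta>")
    case True
    have "x + q = (1/2) *\<^sub>R (x + y) + \<xi> *\<^sub>R (w - w') + \<zeta> *\<^sub>R (w + w' - x - y)"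
      unfolding q e1_def e2_def e3_def by (simp add: vec_eq_iff field_simps)
    then show ?thesis using ed True dx dy unfolding edge_def Let_def by metis
  next
    case False
    then have eq: "\<bar>\<xi>\<bar> = \<zeta>" using le by simp
    then have sq: "\<xi>\<^sup>2 = \<zeta>\<^sup>2" by (metis power2_abs)
    have "(\<zeta>\<^sup>2 - 1/4) * (e1 \<bullet> e1 + e3 \<bullet> e3) = 0"
      using n q1 fr(7) by (simp add: sq algebra_simps)
    moreover have "0 < e1 \<bullet> e1 + e3 \<bullet> e3" using fr(4) by (simp add: add_pos_nonneg)
    ultimately have "\<zeta>\<^sup>2 = (1/2)\<^sup>2" by (simp add: power2_eq_square)
    then have z: "\<zeta> = 1/2" using eq by (simp add: power2_eq_iff) linarith
    then have "\<xi> = 1/2 \<or> \<xi> = -1/2" using eq by linarith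
    then show ?thesis
      using fr(9,10) z q by (metis add.commute diff_add_cancel)
  qed
  moreover have "w \<in> B" "w' \<in> B" using ed W_D unfolding edge_def by auto
  ultimately show "x + q \<in> B" "x + q = w \<or> x + q = w' \<or> x + q \<notin> W" by auto
qed

text \<open>The region of the unit sphere around \<open>x\<close> between an edge and its chord (the great circle arc from
  \<open>w - x\<close> to \<open>w' - x\<close>) belongs to the face of \<open>x\<close>: a point of it is a nonnegative
  combination of two mirror-image points of the arc, with coefficient sum \<open>\<mu> \<ge> 1\<close>. Unless
  \<open>\<mu> = 1\<close>, that is, on the arc itself, all other ball constraints are slack, so no vertex
  lies there.\<close>

lemma edge_arc_hull:
  assumes ed: "edge w x w' y"
  defines "e1 \<equiv> w - w'" and "e2 \<equiv> y - x" and "e3 \<equiv> w + w' - x - y"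
  assumes q: "q = q1 *\<^sub>R e1 + q2 *\<^sub>R e2 + q3 *\<^sub>R e3" and unit: "q \<bullet> q = 1"
    and q2: "1/2 \<le> q2" and q3: "q2 \<le> q3"
  shows "\<And>v. v \<in> V \<Longrightarrow> (v - x) \<bullet> (v - x) \<le> 2 * (q \<bullet> (v - x))"
    and "x + q \<in> W \<Longrightarrow> x + q = w \<or> x + q = w'"
proof -
  note fr = edge_frame[OF ed, folded e1_def e2_def e3_def]
  define \<mu> where "\<mu> = 2 * q2"
  have \<mu>: "1 \<le> \<mu>" using q2 by (simp add: \<mu>_def)
  define \<zeta> where "\<zeta> = q3 / \<mu>"
  have \<zeta>: "1/2 \<le> \<zeta>" using q2 q3 by (simp add: \<zeta>_def \<mu>_def field_simps)
  have pos: "0 < e1 \<bullet> e1" "0 \<le> e3 \<bullet> e3" using fr(4) by auto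
  have n: "q1\<^sup>2 * (e1 \<bullet> e1) + q2\<^sup>2 * (e2 \<bullet> e2) + q3\<^sup>2 * (e3 \<bullet> e3) = 1"
    using unit unfolding q frame_norm[OF fr(1-3)] by simp
  have "(q1 / \<mu>)\<^sup>2 * (e1 \<bullet> e1) + (1/4) * (e2 \<bullet> e2) + \<zeta>\<^sup>2 * (e3 \<bullet> e3)
      = (q1\<^sup>2 * (e1 \<bullet> e1) + q2\<^sup>2 * (e2 \<bullet> e2) + q3\<^sup>2 * (e3 \<bullet> e3)) / \<mu>\<^sup>2"
    using q2 unfolding \<zeta>_def \<mu>_def by (simp add: field_simps power2_eq_square)
  also have "\<dots> \<le> 1" unfolding n using \<mu> by (simp add: divide_le_eq_1 one_le_power)
  finally have n': "(q1 / \<mu>)\<^sup>2 * (e1 \<bullet> e1) \<le> 1 - (e2 \<bullet> e2) / 4 - \<zeta>\<^sup>2 * (e3 \<bullet> e3)" by simp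
  define \<xi> where "\<xi> = sqrt ((1 - (e2 \<bullet> e2) / 4 - \<zeta>\<^sup>2 * (e3 \<bullet> e3)) / (e1 \<bullet> e1))"
  have q1sq: "(q1 / \<mu>)\<^sup>2 \<le> (1 - (e2 \<bullet> e2) / 4 - \<zeta>\<^sup>2 * (e3 \<bullet> e3)) / (e1 \<bullet> e1)"
    using n' pos by (simp add: field_simps)
  then have q1le: "\<bar>q1 / \<mu>\<bar> \<le> \<xi>" unfolding \<xi>_def by (intro real_le_rsqrt) (simp only: power2_abs)
  have \<xi>0: "0 \<le> \<xi>" using q1le by linarith
  have \<xi>2: "\<xi>\<^sup>2 * (e1 \<bullet> e1) = 1 - (e2 \<bullet> e2) / 4 - \<zeta>\<^sup>2 * (e3 \<bullet> e3)"
  proof -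
    have "0 \<le> (1 - (e2 \<bullet> e2) / 4 - \<zeta>\<^sup>2 * (e3 \<bullet> e3)) / (e1 \<bullet> e1)"
      using q1sq zero_le_power2[of "q1 / \<mu>"] by linarith
    then show ?thesis unfolding \<xi>_def using pos by simp
  qed
  have "\<xi> \<le> 1/2"
  proof (rule ccontr)
    assume "\<not> \<xi> \<le> 1/2"
    then have "(1/2)\<^sup>2 < \<xi>\<^sup>2" by (intro power_strict_mono) auto
    then have "1/4 * (e1 \<bullet> e1) < \<xi>\<^sup>2 * (e1 \<bullet> e1)"
      using pos by (intro mult_strict_right_mono) (auto simp: power2_eq_square)
    moreover have "(1/2)\<^sup>2 \<le> \<zeta>\<^sup>2" using \<zeta> by (intro power_mono) auto
    then have "1/4 * (e3 \<bullet> e3) \<le> \<zeta>\<^sup>2 * (e3 \<bullet> e3)"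
      using pos by (intro mult_right_mono) (auto simp: power2_eq_square)
    ultimately show False using \<xi>2 fr(7) by linarith
  qed
  then have \<xi>\<zeta>: "\<bar>\<xi>\<bar> \<le> \<zeta>" "\<bar>- \<xi>\<bar> \<le> \<zeta>" using \<xi>0 \<zeta> by auto
  define p1 p2 where "p1 = \<xi> *\<^sub>R e1 + (1/2) *\<^sub>R e2 + \<zeta> *\<^sub>R e3"
    and "p2 = (- \<xi>) *\<^sub>R e1 + (1/2) *\<^sub>R e2 + \<zeta> *\<^sub>R e3"
  have pp: "p1 \<bullet> p1 = 1" "p2 \<bullet> p2 = 1"
    unfolding p1_def p2_def frame_norm[OF fr(1-3)] using \<xi>2 by (simp_all add: power2_eq_square)
  note arc1 = edge_arc[OF ed, folded e1_def e2_def e3_def, OF \<xi>\<zeta>(1) p1_def pp(1)]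
  note arc2 = edge_arc[OF ed, folded e1_def e2_def e3_def, OF \<xi>\<zeta>(2) p2_def pp(2)]
  obtain \<alpha> \<beta> where ab: "0 \<le> \<alpha>" "0 \<le> \<beta>" "\<alpha> + \<beta> = \<mu>" "(\<alpha> - \<beta>) * \<xi> = q1"
  proof (cases "\<xi> = 0")
    case True
    then have "q1 / \<mu> = 0" using q1le by simp
    then show thesis using True \<mu> that[of "\<mu>/2" "\<mu>/2"] by auto
  next
    case False
    then have "\<bar>q1 / \<xi>\<bar> \<le> \<mu>" using q1le \<mu> \<xi>0 by (simp add: field_simps)
    then have "q1 / \<xi> \<le> \<mu>" "- (q1 / \<xi>) \<le> \<mu>" unfolding abs_le_iff by blast+
    then have "0 \<le> (\<mu> + q1 / \<xi>) / 2" "0 \<le> (\<mu> - q1 / \<xi>) / 2" by simp_all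
    then show thesis
      using False by (intro that[of "(\<mu> + q1 / \<xi>) / 2" "(\<mu> - q1 / \<xi>) / 2"]) (auto simp: diff_divide_distrib add_divide_distrib)
  qed
  have qp: "q = \<alpha> *\<^sub>R p1 + \<beta> *\<^sub>R p2"
  proof -
    have "\<alpha> *\<^sub>R p1 + \<beta> *\<^sub>R p2 = ((\<alpha> - \<beta>) * \<xi>) *\<^sub>R e1 + ((\<alpha> + \<beta>) / 2) *\<^sub>R e2 + ((\<alpha> + \<beta>) * \<zeta>) *\<^sub>R e3"
      unfolding p1_def p2_def by (simp add: vec_eq_iff algebra_simps)
    then show ?thesis using q2 unfolding q ab(3,4) by (simp add: \<mu>_def \<zeta>_def)
  qed
  have strong: "\<mu> * ((v - x) \<bullet> (v - x)) \<le> 2 * (q \<bullet> (v - x))" if "v \<in> V" for v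
  proof -
    have "(v - x) \<bullet> (v - x) \<le> 2 * (p1 \<bullet> (v - x))" "(v - x) \<bullet> (v - x) \<le> 2 * (p2 \<bullet> (v - x))"
      using face_inequality[OF arc1(1,2) that] face_inequality[OF arc2(1,2) that] by simp_all
    then have "\<alpha> * ((v - x) \<bullet> (v - x)) + \<beta> * ((v - x) \<bullet> (v - x))
        \<le> \<alpha> * (2 * (p1 \<bullet> (v - x))) + \<beta> * (2 * (p2 \<bullet> (v - x)))"
      using ab by (intro add_mono mult_left_mono) auto
    then show ?thesis
      unfolding qp ab(3)[symmetric] by (simp add: inner_add_left algebra_simps)
  qed
  show "(v - x) \<bullet> (v - x) \<le> 2 * (q \<bullet> (v - x))" if "v \<in> V" for v
  proof -
    have "1 * ((v - x) \<bullet> (v - x)) \<le> \<mu> * ((v - x) \<bullet> (v - x))" using \<mu> by (intro mult_right_mono) auto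
    then show ?thesis using strong[OF that] by simp
  qed
  show "x + q = w \<or> x + q = w'" if inW: "x + q \<in> W"
  proof (cases "\<mu> = 1")
    case True
    then have "q2 = 1/2" "\<zeta> = q3" "\<bar>q1\<bar> \<le> q3" using q1le \<xi>\<zeta> by (auto simp: \<mu>_def \<zeta>_def)
    then show ?thesis
      using edge_arc(4)[OF ed, folded e1_def e2_def e3_def, of q1 q3 q] q unit inW by auto
  next
    case False
    have nq: "norm q = 1" using unit by (simp add: norm_eq_1)
    have "v = x" if "v \<in> T (x + q)" for v
    proof -
      have "norm (q - (v - x)) = 1" using T_D(3)[OF that] by (simp add: algebra_simps)
      then have "(v - x) \<bullet> (v - x) = 2 * (q \<bullet> (v - x))" using unit_chord_le(2)[OF nq] by blast
      then have "(\<mu> - 1) * ((v - x) \<bullet> (v - x)) \<le> 0"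
        using strong[of v] T_D(1)[OF that] by (simp add: algebra_simps)
      then have "(v - x) \<bullet> (v - x) \<le> 0" using False \<mu> by (simp add: mult_le_0_iff)
      then show ?thesis by (metis inner_eq_zero_iff inner_ge_zero order_antisym right_minus_eq)
    qed
    then have "T (x + q) \<subseteq> {x}" by blast
    then have "card (T (x + q)) \<le> 1" using card_mono[of "{x}"] by fastforce
    then show ?thesis using W_D(2)[OF inW] by simp
  qed
qed

text \<open>All other vertices of the face of \<open>x\<close> lie strictly inside the chord of each of its edges: beyond the
  chord, \<open>edge_arc_hull\<close> leaves no room for vertices.\<close>

lemma edge_face_side:
  assumes ed: "edge w x w' y" and v: "v \<in> W" "dist v x = 1" "v \<noteq> w" "v \<noteq> w'"
  shows "0 < (w - x) \<bullet> ((v - x) \<times> (w' - x))"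
proof (rule ccontr)
  assume not: "\<not> ?thesis"
  define e1 e2 e3 where "e1 = w - w'" and "e2 = y - x" and "e3 = w + w' - x - y"
  note fr = edge_frame[OF ed, folded e1_def e2_def e3_def]
  obtain q1 q2 q3 where q: "v - x = q1 *\<^sub>R e1 + q2 *\<^sub>R e2 + q3 *\<^sub>R e3"
    using orthogonal_coordinates[OF fr(1-6)] by blast
  have "y \<in> V" using ed T_D unfolding edge_def by blast
  then have "e2 \<bullet> e2 \<le> 2 * ((v - x) \<bullet> e2)"
    using face_inequality[OF W_D(1)[OF v(1)] v(2)] by (simp add: e2_def)
  also have "(v - x) \<bullet> e2 = q2 * (e2 \<bullet> e2)"
    using fr(1-3) by (simp add: q inner_simps inner_commute)
  finally have q2: "1/2 \<le> q2" using fr(5) by (simp add: mult.assoc[symmetric])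
  have "(w - x) \<bullet> ((v - x) \<times> (w' - x)) = (q2 - q3) / 2 * (e1 \<bullet> (e2 \<times> e3))"
    unfolding q fr(9,10) triple_frame by (simp add: field_simps)
  then have "\<not> 0 < (q2 - q3) / 2 * (e1 \<bullet> (e2 \<times> e3))" using not by simp
  then have "q2 \<le> q3" using fr(8) mult_pos_pos[of "(q2 - q3) / 2"] by fastforce
  moreover have "(v - x) \<bullet> (v - x) = 1" using v by (simp add: dist_norm norm_eq_1)
  ultimately have "x + (v - x) = w \<or> x + (v - x) = w'"
    using edge_arc_hull(2)[OF ed, folded e1_def e2_def e3_def, OF q _ q2] v by simp
  then show False using v by simp
qed

lemma edge_unique:
  assumes "edge w x w1 y1" "edge w x w2 y2"
  shows "w1 = w2" "y1 = y2"
proof -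
  show "y1 = y2"
  proof (rule ccontr)
    assume ne: "y1 \<noteq> y2"
    have "0 \<le> (w - x) \<bullet> ((w - y1) \<times> (w - y2))" "0 \<le> (w - x) \<bullet> ((w - y2) \<times> (w - y1))"
      using assms unfolding edge_def by auto
    then have "(w - x) \<bullet> ((w - y1) \<times> (w - y2)) = 0"
      using triple_swap[of "w - x" "w - y1" "w - y2"] by linarith
    then show False using not_coplanar[of w x y1 y2] assms ne unfolding edge_def by blast
  qed
  show "w1 = w2"
  proof (rule ccontr)
    assume ne: "w1 \<noteq> w2"
    have "w1 \<in> W" "w2 \<in> W" "dist w1 x = 1" "dist w2 x = 1" "w1 \<noteq> w" "w2 \<noteq> w"
      using assms T_D unfolding edge_def by auto
    then have "0 < (w - x) \<bullet> ((w2 - x) \<times> (w1 - x))" "0 < (w - x) \<bullet> ((w1 - x) \<times> (w2 - x))"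
      using edge_face_side assms ne by metis+
    then show False using triple_swap[of "w - x" "w1 - x" "w2 - x"] by linarith
  qed
qed

lemma edge_predecessor_unique:
  assumes "edge w x1 w1 y" "edge w x2 w2 y"
  shows "x1 = x2"
proof (rule ccontr)
  assume ne: "x1 \<noteq> x2"
  have "0 \<le> (w - x1) \<bullet> ((w - y) \<times> (w - x2))" "0 \<le> (w - x2) \<bullet> ((w - y) \<times> (w - x1))"
    using assms unfolding edge_def by auto
  moreover have "(w - x2) \<bullet> ((w - y) \<times> (w - x1)) = - ((w - x1) \<bullet> ((w - y) \<times> (w - x2)))"
    by (simp add: cross3_simps)
  ultimately have "(w - x1) \<bullet> ((w - y) \<times> (w - x2)) = 0" by linarith
  then show False using not_coplanar[of w x1 y x2] assms ne unfolding edge_def by blast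
qed

end

lemma dist_circle_point:
  fixes c e f v :: "real^3"
  assumes "f \<bullet> e = 0" "f \<bullet> f = e \<bullet> e"
  shows "(dist (c + cos s *\<^sub>R e + sin s *\<^sub>R f) v)\<^sup>2
    = (c - v) \<bullet> (c - v) + e \<bullet> e + 2 * cos s * ((c - v) \<bullet> e) + 2 * sin s * ((c - v) \<bullet> f)"
proof -
  define r where "r = cos s *\<^sub>R e + sin s *\<^sub>R f"
  have "r \<bullet> r = (cos s * cos s + sin s * sin s) * (e \<bullet> e)"
    using assms by (simp add: r_def inner_simps inner_commute algebra_simps del: sin_cos_squared_add3)
  then have rr: "r \<bullet> r = e \<bullet> e" by simp
  have "c + cos s *\<^sub>R e + sin s *\<^sub>R f - v = (c - v) + r" by (simp add: r_def)
  then have "(dist (c + cos s *\<^sub>R e + sin s *\<^sub>R f) v)\<^sup>2 = ((c - v) + r) \<bullet> ((c - v) + r)"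
    by (simp only: dist_norm power2_norm_eq_inner)
  also have "\<dots> = (c - v) \<bullet> (c - v) + r \<bullet> r + 2 * ((c - v) \<bullet> r)"
    unfolding inner_add_left inner_add_right inner_commute[of r "c - v"] by simp
  also have "(c - v) \<bullet> r = cos s * ((c - v) \<bullet> e) + sin s * ((c - v) \<bullet> f)"
    by (simp add: r_def inner_add_right)
  finally show ?thesis unfolding rr by (simp add: algebra_simps)
qed

context unit_configuration
begin

text \<open>Start at \<open>w\<close> and follow the circle common to the unit spheres around \<open>x\<close> and \<open>y\<close> into the ball set.
  By \<open>no_antipodes\<close> some other constraint is violated after half a turn, so there is a first
  parameter at which a third sphere is met.\<close>

lemma arc_to_principal_vertex:
  assumes w: "w \<in> W" and xy: "x \<in> T w" "y \<in> T w" "x \<noteq> y"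
    and side: "\<And>v. v \<in> T w \<Longrightarrow> v \<noteq> x \<Longrightarrow> v \<noteq> y \<Longrightarrow> 0 < (w - x) \<bullet> ((w - y) \<times> (w - v))"
  defines "c \<equiv> (1/2) *\<^sub>R (x + y)"
  defines "f \<equiv> (1 / norm (y - x)) *\<^sub>R ((w - c) \<times> (y - x))"
  defines "z \<equiv> \<lambda>s. c + cos s *\<^sub>R (w - c) + sin s *\<^sub>R f"
  obtains t where "0 < t" "t < pi" "z t \<in> B" "3 \<le> card (T (z t))"
    "\<And>s v. 0 < s \<Longrightarrow> s < t \<Longrightarrow> v \<in> V \<Longrightarrow> v \<noteq> x \<Longrightarrow> v \<noteq> y \<Longrightarrow> dist (z s) v < 1"
    "\<And>s. dist (z s) x = 1" "\<And>s. dist (z s) y = 1"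
proof -
  define e g where "e = w - c" and "g = y - x"
  have V: "x \<in> V" "y \<in> V" using T_D xy by auto
  have g0: "0 < norm g" using xy by (simp add: g_def)
  have f: "f = (1 / norm g) *\<^sub>R (e \<times> g)" by (simp add: f_def e_def g_def)
  have z: "z s = c + cos s *\<^sub>R e + sin s *\<^sub>R f" for s by (simp add: z_def e_def)
  have wx: "w - x = e + (1/2) *\<^sub>R g" and wy: "w - y = e - (1/2) *\<^sub>R g"
    by (simp_all add: e_def g_def c_def vec_eq_iff field_simps)
  have unit: "(w - x) \<bullet> (w - x) = 1" "(w - y) \<bullet> (w - y) = 1"
    using T_D(3) xy by (auto simp: norm_eq_1)
  then have eg: "e \<bullet> g = 0" and ee: "e \<bullet> e + (g \<bullet> g) / 4 = 1"
    unfolding wx wy by (simp_all add: inner_simps inner_commute)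
  have orth: "f \<bullet> e = 0" "f \<bullet> g = 0" by (simp_all add: f dot_cross_self)
  have ff: "f \<bullet> f = e \<bullet> e"
  proof -
    have "(norm (e \<times> g))\<^sup>2 = (norm e * norm g)\<^sup>2" using norm_cross_dot[of e g] eg by simp
    then have "(e \<times> g) \<bullet> (e \<times> g) = (e \<bullet> e) * (norm g)\<^sup>2"
      by (simp add: power2_norm_eq_inner power_mult_distrib)
    then show ?thesis using g0 by (simp add: f power2_eq_square)
  qed
  have circ: "(cos s *\<^sub>R e + sin s *\<^sub>R f) \<bullet> (cos s *\<^sub>R e + sin s *\<^sub>R f) = e \<bullet> e" for s
  proof -
    have "(cos s *\<^sub>R e + sin s *\<^sub>R f) \<bullet> (cos s *\<^sub>R e + sin s *\<^sub>R f) = (cos s * cos s + sin s * sin s) * (e \<bullet> e)"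
      using orth ff by (simp add: inner_simps inner_commute algebra_simps del: sin_cos_squared_add3)
    then show ?thesis by simp
  qed
  have dx: "dist (z s) x = 1" and dy: "dist (z s) y = 1" for s
  proof -
    define r where "r = cos s *\<^sub>R e + sin s *\<^sub>R f"
    have r: "r \<bullet> r = e \<bullet> e" "r \<bullet> g = 0" using circ[of s] eg orth by (auto simp: r_def inner_simps)
    have "z s - x = r + (1/2) *\<^sub>R g" "z s - y = r - (1/2) *\<^sub>R g"
      by (simp_all add: z r_def g_def c_def vec_eq_iff field_simps)
    then have "(z s - x) \<bullet> (z s - x) = 1" "(z s - y) \<bullet> (z s - y) = 1"
      using r ee by (simp_all add: inner_simps inner_commute)
    then show "dist (z s) x = 1" "dist (z s) y = 1" by (simp_all add: dist_norm norm_eq_1)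
  qed
  \<comment> \<open>the squared distance to \<open>v\<close> along the circle\<close>
  define \<phi> where "\<phi> v s = (c - v) \<bullet> (c - v) + e \<bullet> e + 2 * cos s * ((c - v) \<bullet> e) + 2 * sin s * ((c - v) \<bullet> f)" for v s
  have \<phi>: "(dist (z s) v)\<^sup>2 = \<phi> v s" for v s
    unfolding z \<phi>_def by (rule dist_circle_point[OF orth(1) ff])
  have lt: "dist (z s) v < 1 \<longleftrightarrow> \<phi> v s < 1" and le: "dist (z s) v \<le> 1 \<longleftrightarrow> \<phi> v s \<le> 1" for v s
    unfolding \<phi>[symmetric] by (simp_all add: abs_square_less_1 abs_square_le_1)
  have der: "DERIV (\<phi> v) s :> 2 * cos s * ((c - v) \<bullet> f) - 2 * sin s * ((c - v) \<bullet> e)" for v s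
    unfolding \<phi>_def by (auto intro!: derivative_eq_intros)
  have cont: "continuous_on A (\<phi> v)" for v A
    unfolding \<phi>_def by (intro continuous_intros)
  have z0: "z 0 = w" by (simp add: z e_def)
  define V' where "V' = V - {x, y}"
  have finV': "finite V'" using finite_V by (simp add: V'_def)
  have start: "eventually (\<lambda>s. \<phi> v s < 1) (at_right 0)" if v: "v \<in> V'" for v
  proof (cases "v \<in> T w")
    case True
    have "(w - x) \<bullet> ((w - y) \<times> (w - v)) = - norm g * (f \<bullet> (w - v))"
    proof -
      have "(w - x) \<times> (w - y) = - (e \<times> g)"
        unfolding wx wy using cross_conjugate cross_skew by metis
      then have "(w - x) \<bullet> ((w - y) \<times> (w - v)) = - ((e \<times> g) \<bullet> (w - v))"
        by (simp only: triple_cross inner_minus_left)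
      then show ?thesis using g0 by (simp add: f)
    qed
    then have "f \<bullet> (w - v) < 0"
      using side[OF True] v g0 by (auto simp: V'_def mult_less_0_iff)
    moreover have "f \<bullet> (w - v) = (c - v) \<bullet> f"
      using orth by (simp add: e_def inner_simps inner_commute)
    ultimately obtain d where d: "0 < d" "\<And>h. 0 < h \<Longrightarrow> h < d \<Longrightarrow> \<phi> v (0 + h) < \<phi> v 0"
      using DERIV_neg_dec_right[OF der[of v 0]] by auto
    have "\<phi> v 0 = 1" using \<phi>[of 0 v] z0 T_D[OF True] by simp
    then show ?thesis using d unfolding eventually_at_right_field by (intro exI[of _ d]) auto
  next
    case False
    have "dist w v \<le> 1" "dist w v \<noteq> 1"
      using B_D(1)[OF W_D(1)[OF w]] T_I False v by (auto simp: V'_def)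
    then have "\<phi> v 0 < 1" using lt[of 0 v] z0 by simp
    moreover have "(\<phi> v \<longlongrightarrow> \<phi> v 0) (at_right 0)"
      using DERIV_isCont[OF der[of v 0]] by (auto simp: isCont_def filterlim_at_split)
    ultimately show ?thesis by (rule order_tendstoD(2)[rotated])
  qed
  then have "eventually (\<lambda>s. \<forall>v\<in>V'. \<phi> v s < 1) (at_right 0)"
    using finV' by (simp add: eventually_ball_finite)
  then obtain d where d: "0 < d" "\<And>s v. 0 < s \<Longrightarrow> s < d \<Longrightarrow> v \<in> V' \<Longrightarrow> \<phi> v s < 1"
    unfolding eventually_at_right_field by blast
  \<comment> \<open>the compact set of parameters, away from the start, where a third constraint is not slack\<close>
  define K where "K = (\<Union>v\<in>V'. {s \<in> {d/2..pi}. 1 \<le> \<phi> v s})"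
  have comp: "compact K"
    unfolding K_def using finV' cont
    by (intro compact_UN ballI compact_Int_closed[of "{_..pi}" "{s. 1 \<le> _ s}", unfolded Int_def mem_Collect_eq]
        compact_Icc closed_Collect_le continuous_intros) auto
  obtain v\<^sub>0 where v0: "v\<^sub>0 \<in> V'" "1 < \<phi> v\<^sub>0 pi"
  proof -
    have "z pi = x + y - w" by (simp add: z e_def c_def vec_eq_iff)
    then have "z pi \<notin> B"
      using no_antipodes[OF V, of w] T_D(2) xy W_D(1)[OF w] by metis
    then obtain v where "v \<in> V" "\<not> dist (z pi) v \<le> 1" by (auto simp: ball_set_def dist_commute)
    moreover have "v \<noteq> x" "v \<noteq> y" using dx[of pi] dy[of pi] \<open>\<not> dist (z pi) v \<le> 1\<close> by auto
    ultimately show thesis using that[of v] le[of pi v] by (auto simp: V'_def)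
  qed
  have "d/2 \<le> pi" using d(2)[of pi v\<^sub>0] v0 d(1) by (cases "pi < d") auto
  then have "pi \<in> K" using v0 by (force simp: K_def)
  then obtain t where t: "t \<in> K" "\<And>s. s \<in> K \<Longrightarrow> t \<le> s"
    using continuous_attains_inf[OF comp, of "\<lambda>s. s"] by (metis continuous_on_id empty_iff)
  have t0: "0 < t" "t \<le> pi" using t(1) d(1) by (auto simp: K_def)
  have before: "\<phi> v s < 1" if "0 < s" "s < t" "v \<in> V'" for s v
  proof (cases "s < d")
    case False
    then have "s \<notin> K" using t(2) that by fastforce
    then show ?thesis using that False t0 d(1) by (auto simp: K_def not_le)
  qed (use d that in auto)
  have at_t: "\<phi> v t \<le> 1" if v: "v \<in> V'" for v
  proof -
    have "(\<phi> v \<longlongrightarrow> \<phi> v t) (at_left t)"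
      using DERIV_isCont[OF der[of v t]] by (auto simp: isCont_def filterlim_at_split)
    moreover have "eventually (\<lambda>s. \<phi> v s \<le> 1) (at_left t)"
      unfolding eventually_at_left_field using before[OF _ _ v] t0 by (intro exI[of _ 0]) (auto intro: less_imp_le)
    ultimately show ?thesis by (rule tendsto_upperbound) simp
  qed
  have "t \<noteq> pi" using at_t[OF v0(1)] v0 by auto
  obtain v where v: "v \<in> V'" "1 \<le> \<phi> v t" using t(1) by (auto simp: K_def)
  have zB: "z t \<in> B"
    unfolding ball_set_def
  proof (clarsimp simp: dist_commute)
    fix v assume "v \<in> V"
    then show "dist v (z t) \<le> 1"
      using at_t[of v] le[of t v] dx[of t] dy[of t] by (cases "v \<in> {x, y}") (auto simp: V'_def dist_commute)
  qed
  have "dist (z t) v = 1"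
    using v at_t[OF v(1)] \<phi>[of t v] by (simp add: power2_eq_1_iff) (metis zero_le_dist neg_0_le_iff_le not_one_le_zero)
  then have "{x, y, v} \<subseteq> T (z t)" using dx dy v V by (auto simp: V'_def intro: T_I)
  moreover have "card {x, y, v} = 3" using v xy by (auto simp: V'_def)
  ultimately have "3 \<le> card (T (z t))" by (metis card_mono finite_T)
  then show thesis
    using that[of t] t0 \<open>t \<noteq> pi\<close> zB before dx dy lt by (auto simp: V'_def)
qed

text \<open>With \<open>y\<close> the successor of \<open>x\<close> in the cyclic order at \<open>w\<close>, follow the arc until the first vertex.
  Since the constraints are slack before, their derivatives at the end point have the signs
  that make \<open>x\<close> the successor of \<open>y\<close> there.\<close>

lemma edge_exists:
  assumes w: "w \<in> W" and x: "x \<in> T w"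
  obtains w' y where "edge w x w' y"
proof -
  obtain y where y: "y \<in> T w" "y \<noteq> x" "\<And>v. v \<in> T w \<Longrightarrow> 0 \<le> (w - x) \<bullet> ((w - y) \<times> (w - v))"
    using next_normal[OF w x] by blast
  define c where "c = (1/2) *\<^sub>R (x + y)"
  define f where "f = (1 / norm (y - x)) *\<^sub>R ((w - c) \<times> (y - x))"
  define z where "z s = c + cos s *\<^sub>R (w - c) + sin s *\<^sub>R f" for s
  have "0 < (w - x) \<bullet> ((w - y) \<times> (w - v))" if "v \<in> T w" "v \<noteq> x" "v \<noteq> y" for v
    using y(3)[OF that(1)] not_coplanar[OF w x y(1) that(1)] y(2) that by fastforce
  then obtain t where t: "0 < t" "t < pi" "z t \<in> B" "3 \<le> card (T (z t))"
    "\<And>s v. 0 < s \<Longrightarrow> s < t \<Longrightarrow> v \<in> V \<Longrightarrow> v \<noteq> x \<Longrightarrow> v \<noteq> y \<Longrightarrow> dist (z s) v < 1"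
    "\<And>s. dist (z s) x = 1" "\<And>s. dist (z s) y = 1"
    using arc_to_principal_vertex[OF w x y(1), folded c_def, folded f_def, folded z_def] y(2) by metis
  define e g where "e = w - c" and "g = y - x"
  have V: "x \<in> V" "y \<in> V" using T_D x y by auto
  have g0: "0 < norm g" using y by (simp add: g_def)
  have f: "norm g *\<^sub>R f = e \<times> g" using g0 by (simp add: f_def e_def g_def)
  have z: "z s = c + cos s *\<^sub>R e + sin s *\<^sub>R f" for s by (simp add: z_def e_def)
  have wx: "w - x = e + (1/2) *\<^sub>R g" and wy: "w - y = e - (1/2) *\<^sub>R g"
    by (simp_all add: e_def g_def c_def vec_eq_iff field_simps)
  have unit: "(w - x) \<bullet> (w - x) = 1" "(w - y) \<bullet> (w - y) = 1"
    using T_D(3) x y by (auto simp: norm_eq_1)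
  then have eg: "e \<bullet> g = 0" and ee: "e \<bullet> e + (g \<bullet> g) / 4 = 1"
    unfolding wx wy by (simp_all add: inner_simps inner_commute)
  have gg: "g \<bullet> g \<le> 1" using dist_le_1[OF V] by (simp add: g_def dist_norm norm_minus_commute dot_square_norm power_le_one)
  then have e0: "0 < e \<bullet> e" using ee by linarith
  have fe: "f \<bullet> e = 0" "f \<bullet> g = 0" using g0 f by (simp_all add: f_def e_def g_def dot_cross_self)
  have ff: "f \<bullet> f = e \<bullet> e"
  proof -
    have "(norm (e \<times> g))\<^sup>2 = (norm e * norm g)\<^sup>2" using norm_cross_dot[of e g] eg by simp
    then have "(norm g * norm f)\<^sup>2 = (norm e * norm g)\<^sup>2" using g0 by (simp flip: f)
    then show ?thesis using g0 by (simp add: power2_norm_eq_inner power_mult_distrib)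
  qed
  have fg: "f \<times> g = - norm g *\<^sub>R e"
  proof -
    have "norm g *\<^sub>R (f \<times> g) = (e \<times> g) \<times> g" by (simp flip: f add: cross_mult_left)
    also have "\<dots> = (e \<bullet> g) *\<^sub>R g - (g \<bullet> g) *\<^sub>R e" by (simp add: cross3_simps forall_3)
    also have "\<dots> = norm g *\<^sub>R (- norm g *\<^sub>R e)" by (simp add: eg dot_square_norm power2_eq_square)
    finally show ?thesis using g0 by (metis scaleR_cancel_left less_irrefl)
  qed
  \<comment> \<open>the parameters at which vertices are met; the first of them ends the edge\<close>
  define S where "S = {s. 0 < s \<and> s \<le> t \<and> z s \<in> W}"
  have "inj_on z S"
  proof (rule inj_onI)
    fix s s' assume s: "s \<in> S" "s' \<in> S" "z s = z s'"
    have "(z s - c) \<bullet> e = cos s * (e \<bullet> e)" for s using fe by (simp add: z inner_simps)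
    then have "cos s = cos s'" using s(3) e0 by (metis mult_cancel_right less_irrefl)
    then show "s = s'" using s t(2) by (auto simp: S_def intro: cos_inj_pi)
  qed
  moreover have "z ` S \<subseteq> W" by (auto simp: S_def)
  ultimately have finS: "finite S" using finite_W finite_subset finite_image_iff by metis
  have "t \<in> S" using t W_I by (auto simp: S_def)
  then have SMin: "Min S \<in> S" using finS Min_in by blast
  define t1 where "t1 = Min S"
  have t1: "0 < t1" "t1 \<le> t" "t1 < pi" "z t1 \<in> W" using SMin t(2) by (auto simp: S_def t1_def)
  have notW: "z s \<notin> W" if "0 < s" "s < t1" for s
  proof
    assume "z s \<in> W"
    then have "s \<in> S" using that t1 by (auto simp: S_def)
    then have "t1 \<le> s" using finS by (simp add: t1_def)
    then show False using that by simp
  qed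
  have inB: "z s \<in> B" if "0 < s" "s < t1" for s
    unfolding ball_set_def
  proof (clarsimp simp: dist_commute)
    fix v assume "v \<in> V"
    then show "dist v (z s) \<le> 1"
      using t(5)[of s v] t(6,7)[of s] that t1 by (cases "v \<in> {x, y}") (auto simp: dist_commute less_imp_le)
  qed
  define w' where "w' = z t1"
  define C D where "C = cos t1" and "D = sin t1"
  have D0: "0 < D" using t1 by (simp add: D_def sin_gt_zero)
  have CD: "C * C + D * D = 1" using sin_cos_squared_add3[of t1] by (simp add: C_def D_def)
  have w': "w' = c + C *\<^sub>R e + D *\<^sub>R f" by (simp add: w'_def z C_def D_def)
  define f' where "f' = C *\<^sub>R f - D *\<^sub>R e"
  have tri': "(w' - y) \<bullet> ((w' - x) \<times> (w' - v)) = norm g * (f' \<bullet> (w' - v))" for v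
  proof -
    define e' where "e' = C *\<^sub>R e + D *\<^sub>R f"
    have "w' - x = e' + (1/2) *\<^sub>R g" "w' - y = e' - (1/2) *\<^sub>R g"
      by (simp_all add: w' e'_def g_def c_def vec_eq_iff field_simps)
    then have "(w' - y) \<bullet> ((w' - x) \<times> (w' - v)) = (e' \<times> g) \<bullet> (w' - v)"
      by (simp only: triple_cross cross_conjugate)
    also have "e' \<times> g = norm g *\<^sub>R f'"
    proof -
      have "e' \<times> g = C *\<^sub>R (e \<times> g) + D *\<^sub>R (f \<times> g)"
        by (simp add: e'_def cross_add_left cross_mult_left)
      then show ?thesis unfolding fg f[symmetric] f'_def by (simp add: algebra_simps)
    qed
    finally show ?thesis by simp
  qed
  have orient': "0 \<le> (w' - y) \<bullet> ((w' - x) \<times> (w' - v))" if v: "v \<in> T w'" for v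
  proof (cases "v = x \<or> v = y")
    case True
    then show ?thesis by (auto simp: dot_cross_self)
  next
    case False
    define \<phi> where "\<phi> s = (c - v) \<bullet> (c - v) + e \<bullet> e + 2 * cos s * ((c - v) \<bullet> e) + 2 * sin s * ((c - v) \<bullet> f)" for s
    have \<phi>: "(dist (z s) v)\<^sup>2 = \<phi> s" for s
      unfolding z \<phi>_def by (rule dist_circle_point[OF fe(1) ff])
    have der: "DERIV \<phi> t1 :> 2 * C * ((c - v) \<bullet> f) - 2 * D * ((c - v) \<bullet> e)"
      unfolding \<phi>_def C_def D_def by (auto intro!: derivative_eq_intros)
    have "\<not> 2 * C * ((c - v) \<bullet> f) - 2 * D * ((c - v) \<bullet> e) < 0"
    proof
      assume "2 * C * ((c - v) \<bullet> f) - 2 * D * ((c - v) \<bullet> e) < 0"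
      then obtain d where d: "0 < d" "\<And>h. 0 < h \<Longrightarrow> h < d \<Longrightarrow> \<phi> t1 < \<phi> (t1 - h)"
        using DERIV_neg_dec_left[OF der] by auto
      define h where "h = min d t1 / 2"
      have h: "0 < h" "h < d" "0 < t1 - h" "t1 - h < t1" using d t1 by (auto simp: h_def)
      have "\<phi> t1 = 1" using \<phi>[of t1] T_D(2)[OF v] by (simp add: w'_def)
      moreover have "dist (z (t1 - h)) v < 1"
        using t(5)[of "t1 - h" v] h t1 False T_D(1)[OF v] by auto
      then have "\<phi> (t1 - h) < 1" unfolding \<phi>[symmetric] by (simp add: abs_square_less_1)
      ultimately show False using d(2)[OF h(1,2)] by simp
    qed
    moreover have "2 * C * ((c - v) \<bullet> f) - 2 * D * ((c - v) \<bullet> e) = 2 * (f' \<bullet> (w' - v))"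
      using fe ff unfolding w' f'_def by (simp add: inner_simps inner_commute algebra_simps)
    ultimately show ?thesis unfolding tri' using g0 by simp
  qed
  have E1: "w - w' = (1 - C) *\<^sub>R e - D *\<^sub>R f" and E3: "w + w' - x - y = (1 + C) *\<^sub>R e + D *\<^sub>R f"
    by (simp_all add: w' e_def c_def vec_eq_iff field_simps)
  have pos: "0 < (w - w') \<bullet> ((y - x) \<times> (w + w' - x - y))"
  proof -
    have "(y - x) \<times> (w + w' - x - y) = - (((1 + C) *\<^sub>R e + D *\<^sub>R f) \<times> g)"
      unfolding E3 g_def[symmetric] using cross_skew by blast
    also have "\<dots> = norm g *\<^sub>R (D *\<^sub>R e - (1 + C) *\<^sub>R f)"
      unfolding cross_add_left cross_mult_left fg f[symmetric] by (simp add: algebra_simps)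
    finally have cr: "(y - x) \<times> (w + w' - x - y) = norm g *\<^sub>R (D *\<^sub>R e - (1 + C) *\<^sub>R f)" .
    have "((1 - C) *\<^sub>R e - D *\<^sub>R f) \<bullet> (D *\<^sub>R e - (1 + C) *\<^sub>R f) = ((1 - C) * D + D * (1 + C)) * (e \<bullet> e)"
      using fe ff by (simp add: inner_simps inner_commute algebra_simps)
    then have "(w - w') \<bullet> ((y - x) \<times> (w + w' - x - y))
        = norm g * (((1 - C) * D + D * (1 + C)) * (e \<bullet> e))"
      unfolding E1 cr by (simp only: inner_scaleR_right)
    also have "(1 - C) * D + D * (1 + C) = 2 * D" by (simp add: algebra_simps)
    finally show ?thesis using g0 D0 e0 by simp
  qed
  have arc: "z' \<in> B \<and> z' \<notin> W" if "\<bar>\<xi>\<bar> < \<zeta>"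
    and z': "z' = (1/2) *\<^sub>R (x + y) + \<xi> *\<^sub>R (w - w') + \<zeta> *\<^sub>R (w + w' - x - y)"
    and d: "dist z' x = 1" for \<xi> \<zeta> z'
  proof -
    \<comment> \<open>the coordinates \<open>\<xi>, \<zeta>\<close> of an arc point are translated into the angle \<open>s = arccos X < t1\<close>\<close>
    define X Y where "X = \<xi> * (1 - C) + \<zeta> * (1 + C)" and "Y = (\<zeta> - \<xi>) * D"
    have z'': "z' = c + X *\<^sub>R e + Y *\<^sub>R f"
      unfolding z' E1 E3 X_def Y_def c_def by (simp add: algebra_simps)
    have "z' - x = (X *\<^sub>R e + Y *\<^sub>R f) + (1/2) *\<^sub>R g"
      by (simp add: z'' g_def c_def vec_eq_iff field_simps)
    moreover have "(z' - x) \<bullet> (z' - x) = 1" using d by (simp add: dist_norm norm_eq_1)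
    ultimately have "(X * X + Y * Y) * (e \<bullet> e) + (g \<bullet> g) / 4 = 1"
      using fe ff eg by (simp add: inner_simps inner_commute algebra_simps)
    then have "(X * X + Y * Y) * (e \<bullet> e) = 1 * (e \<bullet> e)" using ee by linarith
    then have XY: "X * X + Y * Y = 1" using e0 by (metis mult_cancel_right less_irrefl)
    have Y0: "0 < Y" using that(1) D0 by (simp add: Y_def)
    then have "X\<^sup>2 < 1" using XY by (simp add: power2_eq_square) (smt (verit) mult_pos_pos)
    then have X1: "-1 < X" "X < 1" by (auto simp: abs_square_less_1 abs_less_iff)
    define s where "s = arccos X"
    have s: "0 < s" "s < pi" using arccos_lt_bounded X1 by (auto simp: s_def)
    have cs: "cos s = X" using X1 by (simp add: s_def)
    have "sin s = sqrt (1 - X\<^sup>2)" using X1 by (simp add: s_def sin_arccos)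
    also have "1 - X\<^sup>2 = Y\<^sup>2" using XY by (simp add: power2_eq_square)
    finally have sn: "sin s = Y" using Y0 by simp
    have "sin (t1 - s) = D * (\<xi> + \<zeta>)"
      unfolding sin_diff cs sn C_def[symmetric] D_def[symmetric] X_def Y_def by (simp add: algebra_simps)
    then have sp: "0 < sin (t1 - s)" using that(1) D0 by (simp add: abs_less_iff)
    have "s < t1"
    proof (rule ccontr)
      assume "\<not> s < t1"
      then have "0 \<le> sin (s - t1)" using s t1 by (intro sin_ge_zero) auto
      then show False using sp sin_minus[of "s - t1"] by simp
    qed
    moreover have "z' = z s" by (simp add: z'' z cs sn)
    ultimately show ?thesis using inB notW s by simp
  qed
  have "x \<in> T w'" "y \<in> T w'" using t(6,7)[of t1] V by (auto simp: w'_def intro: T_I)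
  then have "edge w x w' y"
    unfolding edge_def Let_def using w t1(4) x y pos orient' arc by (auto simp: w'_def)
  then show thesis by (rule that)
qed

end

section \<open>The four tiles around a corner\<close>

text \<open>If all directions at the corner \<open>p\<close> lie in the angle between \<open>r1\<close> and \<open>r2\<close>, the two bounding
  directions decide on which side of the meridian everything lies (Cramer's rule).\<close>

lemma supports_iff_extremes:
  assumes r: "r1 \<in> C - {p}" "r2 \<in> C - {p}"
    and between: "\<And>q. q \<in> C - {p} \<Longrightarrow> q \<noteq> r1 \<Longrightarrow> q \<noteq> r2 \<Longrightarrow>
      0 < p \<bullet> (r1 \<times> q) \<and> 0 < p \<bullet> (q \<times> r2) \<and> 0 < p \<bullet> (r1 \<times> r2)"
  shows "supports u C p \<longleftrightarrow> 0 < (u \<bullet> (p \<times> r1)) * (u \<bullet> (p \<times> r2))"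
proof
  assume "supports u C p"
  then show "0 < (u \<bullet> (p \<times> r1)) * (u \<bullet> (p \<times> r2))"
    using r unfolding supports_def by (auto simp: zero_less_mult_iff)
next
  assume "0 < (u \<bullet> (p \<times> r1)) * (u \<bullet> (p \<times> r2))"
  then obtain \<sigma> :: real where \<sigma>: "\<sigma> = 1 \<or> \<sigma> = -1" "0 < \<sigma> * (u \<bullet> (p \<times> r1))" "0 < \<sigma> * (u \<bullet> (p \<times> r2))"
    by (auto simp: zero_less_mult_iff)
  have pos: "0 < \<sigma> * (u \<bullet> (p \<times> q))" if q: "q \<in> C - {p}" for q
  proof (cases "q = r1 \<or> q = r2")
    case False
    then have b: "0 < p \<bullet> (r1 \<times> q)" "0 < p \<bullet> (q \<times> r2)" "0 < p \<bullet> (r1 \<times> r2)"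
      using between[OF q] by auto
    have cramer: "(u \<bullet> (p \<times> q)) * (p \<bullet> (r1 \<times> r2))
        = (u \<bullet> (p \<times> r1)) * (p \<bullet> (q \<times> r2)) + (u \<bullet> (p \<times> r2)) * (p \<bullet> (r1 \<times> q))"
      by (simp add: cross3_simps)
    have "\<sigma> * (u \<bullet> (p \<times> q)) * (p \<bullet> (r1 \<times> r2))
        = \<sigma> * (u \<bullet> (p \<times> r1)) * (p \<bullet> (q \<times> r2)) + \<sigma> * (u \<bullet> (p \<times> r2)) * (p \<bullet> (r1 \<times> q))"
      unfolding mult.assoc cramer by (simp add: distrib_left)
    moreover have "0 < \<sigma> * (u \<bullet> (p \<times> r1)) * (p \<bullet> (q \<times> r2)) + \<sigma> * (u \<bullet> (p \<times> r2)) * (p \<bullet> (r1 \<times> q))"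
      by (rule add_pos_pos[OF mult_pos_pos[OF \<sigma>(2) b(2)] mult_pos_pos[OF \<sigma>(3) b(1)]])
    ultimately show ?thesis using b(3) by (metis zero_less_mult_pos2)
  qed (use \<sigma> in auto)
  then show "supports u C p" using \<sigma>(1) unfolding supports_def by fastforce
qed

lemma supports_parallelogram:
  assumes "C = {p, a, b, a + b - p}" "a \<noteq> p" "b \<noteq> p"
  shows "supports u C p \<longleftrightarrow> 0 < (u \<bullet> (p \<times> a)) * (u \<bullet> (p \<times> b))"
proof -
  have L: "u \<bullet> (p \<times> (a + b - p)) = u \<bullet> (p \<times> a) + u \<bullet> (p \<times> b)"
    by (simp add: cross_add_right Cross3.right_diff_distrib inner_add_right)
  show ?thesis
  proof
    assume "supports u C p"
    then show "0 < (u \<bullet> (p \<times> a)) * (u \<bullet> (p \<times> b))"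
      using assms unfolding supports_def by (auto simp: zero_less_mult_iff)
  next
    assume "0 < (u \<bullet> (p \<times> a)) * (u \<bullet> (p \<times> b))"
    then show "supports u C p"
      unfolding supports_def assms(1) by (auto simp: zero_less_mult_iff L)
  qed
qed

lemma parallel_unit_vectors:
  fixes p q :: "real^3"
  assumes "norm p = 1" "norm q = 1" "p \<times> q = 0" "p \<noteq> q"
  shows "q = - p"
proof -
  obtain t where t: "q = t *\<^sub>R p"
    using assms by (auto simp: cross_eq_0 collinear_lemma)
  then have "\<bar>t\<bar> = 1" using assms by simp
  then show ?thesis using t assms by (auto simp: abs_if split: if_splits)
qed

context unit_configuration
begin

definition face_vertices :: "real^3 \<Rightarrow> (real^3) set" where
  "face_vertices x = {w \<in> W. dist w x = 1}"

definition vertex_tile :: "real^3 \<Rightarrow> (real^3) set" where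
  "vertex_tile w = (\<lambda>x. w - x) ` T w"

definition face_tile :: "real^3 \<Rightarrow> (real^3) set" where
  "face_tile x = (\<lambda>w. w - x) ` face_vertices x"

definition edge_tile :: "real^3 \<Rightarrow> real^3 \<Rightarrow> real^3 \<Rightarrow> real^3 \<Rightarrow> (real^3) set" where
  "edge_tile w x w' y = {w - x, w - y, w' - x, w' - y}"

text \<open>No pole lies on a plane spanned by two differences of a vertex and a centre; in particular meridians
  through a corner of a tile meet no other corner of it.\<close>

definition generic :: "real^3 \<Rightarrow> bool" where
  "generic u \<longleftrightarrow> (\<forall>w\<in>W. \<forall>w'\<in>W. \<forall>x\<in>V. \<forall>x'\<in>V.
    (w - x) \<times> (w' - x') \<noteq> 0 \<longrightarrow> u \<bullet> ((w - x) \<times> (w' - x')) \<noteq> 0)"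

lemma genericD:
  assumes "generic u" "w \<in> W" "w' \<in> W" "x \<in> V" "x' \<in> V" "(w - x) \<times> (w' - x') \<noteq> 0"
  shows "u \<bullet> ((w - x) \<times> (w' - x')) \<noteq> 0"
  using assms unfolding generic_def by blast

lemma face_vertices_D:
  "w \<in> face_vertices x \<Longrightarrow> w \<in> W" "w \<in> face_vertices x \<Longrightarrow> w \<in> B"
  "w \<in> face_vertices x \<Longrightarrow> dist w x = 1" "w \<in> face_vertices x \<Longrightarrow> norm (w - x) = 1"
  using W_D by (auto simp: face_vertices_def dist_norm)

lemma T_subset_face_vertices: "x \<in> V \<Longrightarrow> T x \<subseteq> face_vertices x"
  using T_D V_subset_W by (auto simp: face_vertices_def dist_commute)

lemma finite_face_vertices [simp]: "finite (face_vertices x)"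
  using finite_W by (simp add: face_vertices_def)

lemma vertex_tile_cross:
  assumes "x \<in> T w" "y \<in> T w" "x \<noteq> y"
  shows "(w - x) \<times> (w - y) \<noteq> 0"
proof
  assume "(w - x) \<times> (w - y) = 0"
  then have "w - y = - (w - x)"
    by (intro parallel_unit_vectors) (use T_D(3) assms in auto)
  then have "x - y = 2 *\<^sub>R (x - w)" by (simp add: scaleR_2 algebra_simps)
  then have "dist x y = 2" using T_D(3)[OF assms(1)] by (simp add: dist_norm norm_minus_commute)
  then show False using dist_le_1 T_D(1) assms by fastforce
qed

lemma face_tile_cross:
  assumes "x \<in> V" "w \<in> face_vertices x" "w' \<in> face_vertices x" "w \<noteq> w'"
  shows "(w - x) \<times> (w' - x) \<noteq> 0"
proof
  assume "(w - x) \<times> (w' - x) = 0"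
  then have op: "w' - x = - (w - x)"
    by (intro parallel_unit_vectors) (use face_vertices_D(4) assms in auto)
  obtain v where v: "v \<in> T x" "v \<noteq> x"
    using another_element[OF finite_T degree_ge_2[OF assms(1)]] by blast
  then have "0 < (v - x) \<bullet> (v - x)" "v \<in> V" using T_D by auto
  moreover have "(v - x) \<bullet> (v - x) \<le> 2 * ((w - x) \<bullet> (v - x))" "(v - x) \<bullet> (v - x) \<le> 2 * ((w' - x) \<bullet> (v - x))"
    using face_inequality face_vertices_D assms \<open>v \<in> V\<close> by auto
  moreover have "(w' - x) \<bullet> (v - x) = - ((w - x) \<bullet> (v - x))" unfolding op by (rule inner_minus_left)
  ultimately show False by linarith
qed

lemma vertex_tile_generic:
  assumes "generic u" "w \<in> W" "p \<in> vertex_tile w" "q \<in> vertex_tile w" "p \<noteq> q"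
  shows "u \<bullet> (p \<times> q) \<noteq> 0"
proof -
  obtain x y where "x \<in> T w" "y \<in> T w" "x \<noteq> y" "p = w - x" "q = w - y"
    using assms(3-5) by (auto simp: vertex_tile_def)
  then show ?thesis using genericD[OF assms(1,2,2)] vertex_tile_cross T_D(1) by metis
qed

lemma face_tile_generic:
  assumes "generic u" "x \<in> V" "p \<in> face_tile x" "q \<in> face_tile x" "p \<noteq> q"
  shows "u \<bullet> (p \<times> q) \<noteq> 0"
proof -
  obtain w w' where "w \<in> face_vertices x" "w' \<in> face_vertices x" "w \<noteq> w'" "p = w - x" "q = w' - x"
    using assms(3-5) by (auto simp: face_tile_def)
  then show ?thesis using genericD[OF assms(1) _ _ assms(2,2)] face_tile_cross[OF assms(2)] face_vertices_D(1) by metis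
qed

lemma edge_face_vertices:
  assumes "edge w x w' y"
  shows "w \<in> face_vertices x" "w' \<in> face_vertices x" "w \<in> face_vertices y" "w' \<in> face_vertices y"
  using assms T_D unfolding edge_def face_vertices_def by auto

lemma edge_D:
  assumes "edge w x w' y"
  shows "w \<in> W" "w' \<in> W" "x \<in> V" "y \<in> V" "x \<in> T w" "y \<in> T w" "x \<in> T w'" "y \<in> T w'" "x \<noteq> y" "w \<noteq> w'"
  using assms T_D unfolding edge_def by auto

lemma edge_tile_diagonal:
  assumes "edge w x w' y"
  shows "(w - x) \<times> (w' - y) \<noteq> 0" "(w' - x) \<times> (w - y) \<noteq> 0"
proof -
  define e1 e2 e3 where "e1 = w - w'" and "e2 = y - x" and "e3 = w + w' - x - y"
  note fr = edge_frame[OF assms, folded e1_def e2_def e3_def]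
  have nz: "p \<times> q \<noteq> 0"
    if "norm p = 1" "norm q = 1" "p \<bullet> e1 \<noteq> q \<bullet> e1" "p \<bullet> e3 = (e3 \<bullet> e3) / 2" "q \<bullet> e3 = (e3 \<bullet> e3) / 2" for p q
  proof
    assume "p \<times> q = 0"
    then have "q = - p" using that by (intro parallel_unit_vectors) auto
    then show False using that(4,5) fr(6) by (simp add: inner_minus_left)
  qed
  have i: "(w - x) \<bullet> e1 = (e1 \<bullet> e1) / 2" "(w - x) \<bullet> e3 = (e3 \<bullet> e3) / 2"
    "(w' - y) \<bullet> e1 = - (e1 \<bullet> e1) / 2" "(w' - y) \<bullet> e3 = (e3 \<bullet> e3) / 2"
    "(w' - x) \<bullet> e1 = - (e1 \<bullet> e1) / 2" "(w' - x) \<bullet> e3 = (e3 \<bullet> e3) / 2"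
    "(w - y) \<bullet> e1 = (e1 \<bullet> e1) / 2" "(w - y) \<bullet> e3 = (e3 \<bullet> e3) / 2"
    unfolding fr(9-12) using fr(1-3) by (simp_all add: inner_simps inner_commute)
  have n: "norm (w - x) = 1" "norm (w' - y) = 1" "norm (w' - x) = 1" "norm (w - y) = 1"
    using edge_face_vertices[OF assms] face_vertices_D(4) by auto
  have "0 < e1 \<bullet> e1" using fr(4) by simp
  then have "(w - x) \<bullet> e1 \<noteq> (w' - y) \<bullet> e1" "(w' - x) \<bullet> e1 \<noteq> (w - y) \<bullet> e1"
    unfolding i by simp_all
  then show "(w - x) \<times> (w' - y) \<noteq> 0" "(w' - x) \<times> (w - y) \<noteq> 0"
    using nz n i by blast+
qed

lemma edge_tile_generic:
  assumes g: "generic u" and ed: "edge w x w' y"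
    and "p \<in> edge_tile w x w' y" "q \<in> edge_tile w x w' y" "p \<noteq> q"
  shows "u \<bullet> (p \<times> q) \<noteq> 0"
proof -
  note e = edge_D[OF ed] and f = edge_face_vertices[OF ed]
  have "(w - x) \<times> (w - y) \<noteq> 0" "(w' - x) \<times> (w' - y) \<noteq> 0" "(w - x) \<times> (w' - x) \<noteq> 0" "(w - y) \<times> (w' - y) \<noteq> 0"
    "(w - x) \<times> (w' - y) \<noteq> 0" "(w' - x) \<times> (w - y) \<noteq> 0"
    using vertex_tile_cross face_tile_cross e f edge_tile_diagonal[OF ed] by auto
  then have ne: "u \<bullet> ((w - x) \<times> (w - y)) \<noteq> 0" "u \<bullet> ((w' - x) \<times> (w' - y)) \<noteq> 0"
    "u \<bullet> ((w - x) \<times> (w' - x)) \<noteq> 0" "u \<bullet> ((w - y) \<times> (w' - y)) \<noteq> 0"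
    "u \<bullet> ((w - x) \<times> (w' - y)) \<noteq> 0" "u \<bullet> ((w' - x) \<times> (w - y)) \<noteq> 0"
    using genericD[OF g] e by metis+
  have "u \<bullet> (a \<times> b) \<noteq> 0 \<Longrightarrow> u \<bullet> (b \<times> a) \<noteq> 0" for a b
    using triple_swap[of u a b] by simp
  then show ?thesis using assms(3-5) ne unfolding edge_tile_def by auto
qed

lemma edge_corners_distinct:
  assumes "edge w x w' y"
  shows "distinct [w - x, w - y, w' - x, w' - y]"
proof -
  have "w - x \<noteq> w' - y" "w' - x \<noteq> w - y"
    using edge_tile_diagonal[OF assms] by auto
  then show ?thesis using edge_D[OF assms] by auto
qed

text \<open>Around the corner \<open>w - x\<close> there are, in cyclic order, the vertex tile (between \<open>w - y1\<close> and
  \<open>w - y2\<close>), the tile of the edge between the faces of \<open>y2\<close> and \<open>x\<close>, the face tile (between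
  \<open>w2 - x\<close> and \<open>w1 - x\<close>) and the tile of the edge between the faces of \<open>x\<close> and \<open>y1\<close>. By \<open>four_ray_signs\<close> the meridian supports exactly two of
  these four polygons.\<close>

lemma corner_count:
  fixes u :: "real^3"
  assumes g: "generic u" and out: "edge w x w1 y1" and into: "edge w y2 w2 x"
  defines "L \<equiv> \<lambda>q. u \<bullet> ((w - x) \<times> q)"
  shows "of_bool (supports u (vertex_tile w) (w - x)) + of_bool (supports u (face_tile x) (w - x))
    + of_bool (0 < L (w - y1) * L (w1 - x)) + of_bool (0 < L (w - y2) * L (w2 - x)) = (2::nat)"
proof -
  note o = edge_D[OF out] and i = edge_D[OF into]
  note fo = edge_face_vertices[OF out] and fi = edge_face_vertices[OF into]
  define p n where "p = w - x" and "n = u \<times> p"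
  have np: "n \<bullet> p = 0" by (simp add: n_def dot_cross_self)
  have nL: "n \<bullet> q = L q" for q by (simp add: n_def L_def p_def cross3_simps)
  define M where "M q = (p \<times> n) \<bullet> q" for q
  have cr: "(n \<bullet> n) * (p \<bullet> (a \<times> b)) = L a * M b - L b * M a" for a b
    using planar_coordinates_triple[OF np, of a b] by (simp add: nL M_def)
  have L0: "L (w - y1) \<noteq> 0" "L (w - y2) \<noteq> 0" "L (w1 - x) \<noteq> 0" "L (w2 - x) \<noteq> 0"
    unfolding L_def using genericD[OF g] o i vertex_tile_cross face_tile_cross fo fi by metis+
  have "n \<noteq> 0" using L0(1) nL by (metis inner_zero_left)
  then have nn: "0 < n \<bullet> n" by simp
  have crpos: "0 < p \<bullet> (a \<times> b) \<Longrightarrow> 0 < L a * M b - L b * M a" for a b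
    using cr[of a b] nn by (metis mult_pos_pos)
  have a12: "0 < p \<bullet> ((w - y1) \<times> (w - y2))" if "y1 \<noteq> y2"
  proof -
    have "0 \<le> p \<bullet> ((w - y1) \<times> (w - y2))" using out i(5) unfolding edge_def p_def by blast
    moreover have "p \<bullet> ((w - y1) \<times> (w - y2)) \<noteq> 0"
      unfolding p_def using not_coplanar[of w x y1 y2] o i that by auto
    ultimately show ?thesis by simp
  qed
  have ab2: "0 < p \<bullet> ((w - y2) \<times> (w2 - x))"
    using edge_frame(8)[OF into] unfolding p_def edge_frame(9,11,12)[OF into] triple_frame by simp
  have ba1: "0 < p \<bullet> ((w1 - x) \<times> (w - y1))"
    using edge_frame(8)[OF out] unfolding p_def edge_frame(9,10,11)[OF out] triple_frame by simp
  have b21: "0 < p \<bullet> ((w2 - x) \<times> (w1 - x))" if "w1 \<noteq> w2"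
    using edge_face_side[OF out, of w2] that fi face_vertices_D i o unfolding p_def by auto
  have d: "(L (w - y1), M (w - y1)) = (L (w - y2), M (w - y2)) \<or>
      0 < L (w - y1) * M (w - y2) - L (w - y2) * M (w - y1)"
    "(L (w2 - x), M (w2 - x)) = (L (w1 - x), M (w1 - x)) \<or>
      0 < L (w2 - x) * M (w1 - x) - L (w1 - x) * M (w2 - x)"
    using crpos[OF a12] crpos[OF b21] by blast+
  have signs: "of_bool (0 < L (w - y1) * L (w - y2)) + of_bool (0 < L (w1 - x) * L (w2 - x))
    + of_bool (0 < L (w - y1) * L (w1 - x)) + of_bool (0 < L (w - y2) * L (w2 - x)) = (2::nat)"
    using four_ray_signs[of "(L (w - y1), M (w - y1))" "(L (w - y2), M (w - y2))"
        "(L (w2 - x), M (w2 - x))" "(L (w1 - x), M (w1 - x))"]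
      crpos[OF ab2] crpos[OF ba1] L0 d
    unfolding fst_conv snd_conv by blast
  have vt: "supports u (vertex_tile w) p \<longleftrightarrow> 0 < L (w - y1) * L (w - y2)"
    unfolding L_def p_def[symmetric]
  proof (rule supports_iff_extremes)
    show "w - y1 \<in> vertex_tile w - {p}" "w - y2 \<in> vertex_tile w - {p}"
      using o i by (auto simp: vertex_tile_def p_def)
    fix q assume q: "q \<in> vertex_tile w - {p}" "q \<noteq> w - y1" "q \<noteq> w - y2"
    then obtain v where v: "v \<in> T w" "q = w - v" "v \<noteq> x" "v \<noteq> y1" "v \<noteq> y2"
      by (auto simp: vertex_tile_def p_def)
    have "0 \<le> p \<bullet> ((w - y1) \<times> (w - v))" "0 \<le> (w - y2) \<bullet> (p \<times> (w - v))"
      using out into v(1) unfolding edge_def p_def by blast+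
    moreover have "(w - y2) \<bullet> (p \<times> (w - v)) = p \<bullet> ((w - v) \<times> (w - y2))" by (rule triple_rotate)
    moreover have "p \<bullet> ((w - y1) \<times> (w - v)) \<noteq> 0" "p \<bullet> ((w - v) \<times> (w - y2)) \<noteq> 0"
      unfolding p_def using not_coplanar[of w x y1 v] not_coplanar[of w x v y2] o i v by auto
    ultimately have 1: "0 < p \<bullet> ((w - y1) \<times> q)" "0 < p \<bullet> (q \<times> (w - y2))" by (auto simp: v(2))
    moreover have "y1 \<noteq> y2" using 1 triple_swap[of p "w - y1" q] by auto
    ultimately show "0 < p \<bullet> ((w - y1) \<times> q) \<and> 0 < p \<bullet> (q \<times> (w - y2)) \<and> 0 < p \<bullet> ((w - y1) \<times> (w - y2))"
      using a12 by blast
  qed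
  have ft: "supports u (face_tile x) p \<longleftrightarrow> 0 < L (w2 - x) * L (w1 - x)"
    unfolding L_def p_def[symmetric]
  proof (rule supports_iff_extremes)
    show "w2 - x \<in> face_tile x - {p}" "w1 - x \<in> face_tile x - {p}"
      using o i fo fi by (auto simp: face_tile_def p_def)
    fix q assume q: "q \<in> face_tile x - {p}" "q \<noteq> w2 - x" "q \<noteq> w1 - x"
    then obtain v where v: "v \<in> face_vertices x" "q = v - x" "v \<noteq> w" "v \<noteq> w1" "v \<noteq> w2"
      by (auto simp: face_tile_def p_def)
    have "0 < p \<bullet> (q \<times> (w1 - x))"
      using edge_face_side[OF out, of v] v face_vertices_D by (auto simp: p_def)
    moreover have "0 < (w2 - x) \<bullet> (q \<times> (w - x))"
      using edge_face_side[OF edge_sym[OF into], of v] v face_vertices_D by auto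
    then have "0 < p \<bullet> ((w2 - x) \<times> q)" unfolding p_def by (simp add: triple_rotate[of "w - x"])
    moreover have "w1 \<noteq> w2" using calculation triple_swap[of p "w2 - x" q] by auto
    ultimately show "0 < p \<bullet> ((w2 - x) \<times> q) \<and> 0 < p \<bullet> (q \<times> (w1 - x)) \<and> 0 < p \<bullet> ((w2 - x) \<times> (w1 - x))"
      using b21 by blast
  qed
  show ?thesis
    using signs vt ft unfolding p_def by (simp add: mult.commute)
qed

lemma card_edge_tile_supports:
  fixes u :: "real^3"
  assumes ed: "edge w x w' y"
  defines "I \<equiv> \<lambda>p a b. of_bool (0 < (u \<bullet> (p \<times> a)) * (u \<bullet> (p \<times> b))) :: nat"
  shows "card {p \<in> edge_tile w x w' y. supports u (edge_tile w x w' y) p}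
    = I (w - x) (w - y) (w' - x) + I (w - y) (w - x) (w' - y)
      + I (w' - y) (w' - x) (w - y) + I (w' - x) (w' - y) (w - x)"
proof -
  let ?Q = "edge_tile w x w' y"
  have d: "distinct [w - x, w - y, w' - x, w' - y]" by (rule edge_corners_distinct[OF ed])
  have s: "supports u ?Q (w - x) \<longleftrightarrow> 0 < (u \<bullet> ((w - x) \<times> (w - y))) * (u \<bullet> ((w - x) \<times> (w' - x)))"
      "supports u ?Q (w - y) \<longleftrightarrow> 0 < (u \<bullet> ((w - y) \<times> (w - x))) * (u \<bullet> ((w - y) \<times> (w' - y)))"
      "supports u ?Q (w' - y) \<longleftrightarrow> 0 < (u \<bullet> ((w' - y) \<times> (w' - x))) * (u \<bullet> ((w' - y) \<times> (w - y)))"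
      "supports u ?Q (w' - x) \<longleftrightarrow> 0 < (u \<bullet> ((w' - x) \<times> (w' - y))) * (u \<bullet> ((w' - x) \<times> (w - x)))"
    using d by (intro supports_parallelogram; auto simp: edge_tile_def)+
  have "card {p \<in> ?Q. supports u ?Q p} = (\<Sum>p\<in>?Q. of_bool (supports u ?Q p))"
    by (simp add: edge_tile_def Int_def)
  also have "\<dots> = of_bool (supports u ?Q (w - x)) + of_bool (supports u ?Q (w - y))
      + of_bool (supports u ?Q (w' - x)) + of_bool (supports u ?Q (w' - y))"
    unfolding edge_tile_def using d by simp
  finally show ?thesis unfolding s I_def by simp
qed

section \<open>Poles in the tiles\<close>

lemma face_hull:
  assumes "x \<in> V" "q \<in> convex hull (face_tile x)" "v \<in> V"
  shows "(v - x) \<bullet> (v - x) \<le> 2 * (q \<bullet> (v - x))"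
  using assms(2) by (rule convex_hull_inner_ge)
    (use face_inequality[OF _ _ assms(3)] face_vertices_D in \<open>auto simp: face_tile_def\<close>)

lemma vertex_hull:
  assumes "q \<in> convex hull (vertex_tile w)" "z \<in> B"
  shows "(w - z) \<bullet> (w - z) \<le> 2 * (q \<bullet> (w - z))"
  using assms(1) by (rule convex_hull_inner_ge)
    (use normal_inequality[OF _ assms(2)] in \<open>auto simp: vertex_tile_def\<close>)

lemma face_hull_norm:
  assumes "q \<in> convex hull (face_tile x)"
  shows "norm q \<le> 1"
proof -
  have "face_tile x \<subseteq> cball 0 1" using face_vertices_D by (auto simp: face_tile_def)
  then have "convex hull (face_tile x) \<subseteq> cball 0 1" by (intro hull_minimal convex_cball)
  then show ?thesis using assms by fastforce
qed

text \<open>The face inequality survives lengthening of \<open>q\<close>, so a convex combination of directions into a face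
  can be normalized to such a direction.\<close>

lemma face_direction:
  assumes "norm q \<le> 1" "q \<noteq> 0" and le: "\<And>v. v \<in> V \<Longrightarrow> (v - x) \<bullet> (v - x) \<le> 2 * (q \<bullet> (v - x))"
  shows "x + sgn q \<in> B"
  unfolding ball_set_def
proof clarify
  fix v assume v: "v \<in> V"
  have "(v - x) \<bullet> (v - x) * norm q \<le> (v - x) \<bullet> (v - x) * 1"
    using assms(1) by (intro mult_left_mono) auto
  also have "\<dots> \<le> 2 * (q \<bullet> (v - x))" using le[OF v] by simp
  finally have "(v - x) \<bullet> (v - x) \<le> 2 * (sgn q \<bullet> (v - x))"
    using assms(2) by (simp add: sgn_div_norm field_simps)
  then have "norm (sgn q - (v - x)) \<le> 1"
    using unit_chord_le(1)[of "sgn q" "v - x"] assms(2) by (simp add: norm_sgn)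
  then show "dist v (x + sgn q) \<le> 1" by (simp add: dist_norm norm_minus_commute algebra_simps)
qed

text \<open>If \<open>q\<close> is a normal direction at \<open>w\<close>, then \<open>w\<close> is the only maximizer of \<open>q \<bullet> _\<close> on the ball set; but
  \<open>x + q\<close> maximizes \<open>q \<bullet> _\<close> already on the larger unit ball around \<open>x\<close>.\<close>

lemma normal_meets_face:
  assumes "0 < a" "norm q = 1" and N: "\<And>z. z \<in> B \<Longrightarrow> (w - z) \<bullet> (w - z) \<le> 2 * ((a *\<^sub>R q) \<bullet> (w - z))"
    and w: "w \<in> B" and x: "x \<in> V" "x + q \<in> B"
  shows "w = x + q"
proof -
  have qq: "q \<bullet> q = 1" using assms by (simp add: norm_eq_1)
  have "q \<bullet> (w - x) \<le> norm q * norm (w - x)" by (rule norm_cauchy_schwarz)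
  also have "\<dots> \<le> 1" using B_D(2)[OF w x(1)] assms(2) by simp
  finally have "q \<bullet> (w - (x + q)) \<le> 0" using qq by (simp add: inner_simps)
  then have "a * (q \<bullet> (w - (x + q))) \<le> 0" using assms(1) by (simp add: mult_le_0_iff)
  then have "(w - (x + q)) \<bullet> (w - (x + q)) \<le> 0"
    using N[OF x(2)] by (simp only: inner_scaleR_left)
  then show ?thesis by (metis inner_eq_zero_iff inner_ge_zero order_antisym right_minus_eq)
qed

text \<open>Otherwise \<open>x, x', x' + q, x + q\<close> would be a parallelogram with two sides of length 1 and both
  diagonals of length at most 1, against the parallelogram law.\<close>

lemma faces_disjoint:
  assumes "norm q = 1" "x + q \<in> B" "x' + q \<in> B" "x \<in> V" "x' \<in> V"
  shows "x = x'"
proof -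
  define d where "d = x' - x"
  have "norm (q - d) \<le> 1" "norm (q - (- d)) \<le> 1"
    using B_D(2)[OF assms(2) assms(5)] B_D(2)[OF assms(3) assms(4)] by (simp_all add: d_def algebra_simps)
  then have "d \<bullet> d \<le> 2 * (q \<bullet> d)" "(- d) \<bullet> (- d) \<le> 2 * (q \<bullet> (- d))"
    using unit_chord_le(1)[OF assms(1)] by blast+
  then have "d \<bullet> d \<le> 0" by simp
  then have "d = 0" by (metis inner_eq_zero_iff inner_ge_zero order_antisym)
  then show ?thesis by (simp add: d_def)
qed

lemma normals_disjoint:
  assumes "0 < a" "0 < b" "w \<in> B" "w' \<in> B"
    and "\<And>z. z \<in> B \<Longrightarrow> (w - z) \<bullet> (w - z) \<le> 2 * ((a *\<^sub>R q) \<bullet> (w - z))"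
    and "\<And>z. z \<in> B \<Longrightarrow> (w' - z) \<bullet> (w' - z) \<le> 2 * ((b *\<^sub>R q) \<bullet> (w' - z))"
  shows "w = w'"
proof -
  define d where "d = w - w'"
  have "d \<bullet> d \<le> 2 * ((a *\<^sub>R q) \<bullet> d)" "(- d) \<bullet> (- d) \<le> 2 * ((b *\<^sub>R q) \<bullet> (- d))"
    using assms(5)[OF assms(4)] assms(6)[OF assms(3)] by (simp_all add: d_def)
  then have 1: "d \<bullet> d \<le> 2 * a * (q \<bullet> d)" "d \<bullet> d \<le> - 2 * b * (q \<bullet> d)" by simp_all
  have "d \<bullet> d \<le> 0"
  proof (cases "0 \<le> q \<bullet> d")
    case True
    then have "0 \<le> b * (q \<bullet> d)" using assms(2) by simp
    then show ?thesis using 1(2) by linarith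
  next
    case False
    then have "a * (q \<bullet> d) \<le> 0" using assms(1) by (simp add: mult_le_0_iff)
    then show ?thesis using 1(1) by linarith
  qed
  then have "d = 0" by (metis inner_eq_zero_iff inner_ge_zero order_antisym)
  then show ?thesis by (simp add: d_def)
qed

lemma edge_hull_coordinates:
  assumes ed: "edge w x w' y" and q: "q \<in> convex hull (edge_tile w x w' y)"
  defines "e1 \<equiv> w - w'" and "e2 \<equiv> y - x" and "e3 \<equiv> w + w' - x - y"
  obtains q1 q2 where "q = q1 *\<^sub>R e1 + q2 *\<^sub>R e2 + (1/2) *\<^sub>R e3" "\<bar>q1\<bar> \<le> 1/2" "\<bar>q2\<bar> \<le> 1/2"
proof -
  note fr = edge_frame[OF ed, folded e1_def e2_def e3_def]
  define S where "S = {q. - (e1 \<bullet> e1) \<le> 2 * (q \<bullet> e1)} \<inter> {q. - (e1 \<bullet> e1) \<le> 2 * (q \<bullet> (- e1))}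
    \<inter> ({q. - (e2 \<bullet> e2) \<le> 2 * (q \<bullet> e2)} \<inter> {q. - (e2 \<bullet> e2) \<le> 2 * (q \<bullet> (- e2))})
    \<inter> ({q. e3 \<bullet> e3 \<le> 2 * (q \<bullet> e3)} \<inter> {q. - (e3 \<bullet> e3) \<le> 2 * (q \<bullet> (- e3))})"
  have "convex S" unfolding S_def by (intro convex_Int convex_inner_ge)
  moreover have "edge_tile w x w' y \<subseteq> S"
    unfolding edge_tile_def fr(9-12) using fr(1-3)
    by (auto simp: S_def inner_simps inner_commute)
  ultimately have "convex hull (edge_tile w x w' y) \<subseteq> S" by (intro hull_minimal)
  then have "q \<in> S" using q by blast
  then have S: "\<bar>q \<bullet> e1\<bar> \<le> (e1 \<bullet> e1) / 2" "\<bar>q \<bullet> e2\<bar> \<le> (e2 \<bullet> e2) / 2" "q \<bullet> e3 = (e3 \<bullet> e3) / 2"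
    by (auto simp: S_def)
  obtain q1 q2 q3 where c: "q = q1 *\<^sub>R e1 + q2 *\<^sub>R e2 + q3 *\<^sub>R e3"
    using orthogonal_coordinates[OF fr(1-6)] by blast
  have "q \<bullet> e1 = q1 * (e1 \<bullet> e1)" "q \<bullet> e2 = q2 * (e2 \<bullet> e2)" "q \<bullet> e3 = q3 * (e3 \<bullet> e3)"
    using fr(1-3) by (simp_all add: c inner_simps inner_commute)
  then have "\<bar>q1\<bar> * (e1 \<bullet> e1) \<le> (e1 \<bullet> e1) / 2" "\<bar>q2\<bar> * (e2 \<bullet> e2) \<le> (e2 \<bullet> e2) / 2" "q3 * (e3 \<bullet> e3) = (e3 \<bullet> e3) / 2"
    using S by (simp_all add: abs_mult)
  moreover have "0 < e1 \<bullet> e1" "0 < e2 \<bullet> e2" "0 < e3 \<bullet> e3" using fr(4-6) by auto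
  ultimately have "\<bar>q1\<bar> \<le> 1/2" "\<bar>q2\<bar> \<le> 1/2" "q3 = 1/2"
    by (simp_all add: field_simps)
  then show thesis using that c by blast
qed

lemma edge_direction_beyond_chord:
  assumes ed: "edge w x w' y"
    and p: "p = p1 *\<^sub>R (w - w') + p2 *\<^sub>R (y - x) + p3 *\<^sub>R (w + w' - x - y)" "p \<bullet> p = 1"
    and le: "1/2 \<le> p2" "p2 \<le> p3"
  shows "x + p \<in> B" "(w - x) \<bullet> (p \<times> (w' - x)) \<le> 0"
proof -
  have np: "norm p = 1" using p by (simp add: norm_eq_1)
  have "x + sgn p \<in> B"
    using edge_arc_hull(1)[OF ed p le] np by (intro face_direction) auto
  then show "x + p \<in> B" using np by (simp add: sgn_div_norm)
  have "(w - x) \<bullet> (p \<times> (w' - x)) = (p2 - p3) / 2 * ((w - w') \<bullet> ((y - x) \<times> (w + w' - x - y)))"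
    unfolding edge_frame(9,10)[OF ed] p(1) triple_frame by (simp add: field_simps)
  moreover have "(p2 - p3) / 2 * ((w - w') \<bullet> ((y - x) \<times> (w + w' - x - y))) \<le> 0"
    using le(2) edge_frame(8)[OF ed] by (intro mult_nonpos_nonneg) auto
  ultimately show "(w - x) \<bullet> (p \<times> (w' - x)) \<le> 0" by simp
qed

text \<open>A direction in the tile of an edge is a direction into one of the two faces beyond the chord, or, in
  the strip between the two copies of the arc, a combination of the two normals at a point \<open>z\<close>
  of the edge.\<close>

lemma edge_direction_cases:
  assumes ed: "edge w x w' y"
    and p: "p = p1 *\<^sub>R (w - w') + p2 *\<^sub>R (y - x) + p3 *\<^sub>R (w + w' - x - y)" "p \<bullet> p = 1"
    and le: "\<bar>p1\<bar> \<le> p3" "\<bar>p2\<bar> \<le> p3"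
  obtains (face1) "x + p \<in> B" "(w - x) \<bullet> (p \<times> (w' - x)) \<le> 0"
  | (face2) "y + p \<in> B" "(w' - y) \<bullet> (p \<times> (w - y)) \<le> 0"
  | (arc) z a b where "z \<in> B" "dist z x = 1" "dist z y = 1" "z = w \<or> z = w' \<or> z \<notin> W"
    "(w - x) \<bullet> ((z - x) \<times> (w' - x)) \<le> 0" "(w' - y) \<bullet> ((z - y) \<times> (w - y)) \<le> 0"
    "0 \<le> a" "0 \<le> b" "1 \<le> a + b" "p = a *\<^sub>R (z - x) + b *\<^sub>R (z - y)"
proof -
  define e1 e2 e3 where "e1 = w - w'" and "e2 = y - x" and "e3 = w + w' - x - y"
  note fr = edge_frame[OF ed, folded e1_def e2_def e3_def]
  have sym: "p = (- p1) *\<^sub>R (w' - w) + (- p2) *\<^sub>R (x - y) + p3 *\<^sub>R (w' + w - y - x)"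
    unfolding p by (simp add: algebra_simps)
  consider "1/2 \<le> p2" | "1/2 \<le> - p2" | "\<bar>p2\<bar> \<le> 1/2" by linarith
  then show thesis
  proof cases
    case 1
    then show thesis using face1 edge_direction_beyond_chord[OF ed p 1] le(2) by auto
  next
    case 2
    then show thesis
      using face2 edge_direction_beyond_chord[OF edge_sym[OF ed] sym p(2) 2] le(2) by auto
  next
    case 3
    have pos: "0 < e1 \<bullet> e1" "0 < e2 \<bullet> e2" "0 < e3 \<bullet> e3" using fr(4-6) by auto
    define K where "K = 1 - (e2 \<bullet> e2) / 4"
    have K: "4 * K = e1 \<bullet> e1 + e3 \<bullet> e3" using fr(7) by (simp add: K_def)
    then have K0: "0 < K" using add_pos_pos[OF pos(1,3)] by simp
    \<comment> \<open>the coefficient sum: the first and third coordinates of \<open>p / \<rho>\<close> will be those of an arc point\<close>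
    define \<rho> where "\<rho> = sqrt ((1 - p2\<^sup>2 * (e2 \<bullet> e2)) / K)"
    have "p2\<^sup>2 \<le> (1/2)\<^sup>2" using 3 by (simp add: abs_le_square_iff[symmetric])
    then have "p2\<^sup>2 * (e2 \<bullet> e2) \<le> 1/4 * (e2 \<bullet> e2)" using pos by (intro mult_right_mono) (auto simp: power2_eq_square)
    then have K1: "1 \<le> (1 - p2\<^sup>2 * (e2 \<bullet> e2)) / K" using K0 by (simp add: K_def field_simps)
    then have \<rho>: "1 \<le> \<rho>" "\<rho>\<^sup>2 * K = 1 - p2\<^sup>2 * (e2 \<bullet> e2)"
      using K0 by (auto simp: \<rho>_def)
    define \<xi> \<zeta> where "\<xi> = p1 / \<rho>" and "\<zeta> = p3 / \<rho>"
    have \<xi>\<zeta>: "\<bar>\<xi>\<bar> \<le> \<zeta>" using le(1) \<rho>(1) by (simp add: \<xi>_def \<zeta>_def field_simps)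
    have n: "p1\<^sup>2 * (e1 \<bullet> e1) + p2\<^sup>2 * (e2 \<bullet> e2) + p3\<^sup>2 * (e3 \<bullet> e3) = 1"
      using p(2) unfolding p(1) e1_def[symmetric] e2_def[symmetric] e3_def[symmetric] frame_norm[OF fr(1-3)] .
    have "\<rho>\<^sup>2 * (\<xi>\<^sup>2 * (e1 \<bullet> e1) + \<zeta>\<^sup>2 * (e3 \<bullet> e3)) = p1\<^sup>2 * (e1 \<bullet> e1) + p3\<^sup>2 * (e3 \<bullet> e3)"
      using \<rho>(1) by (simp add: \<xi>_def \<zeta>_def field_simps power2_eq_square)
    also have "\<dots> = \<rho>\<^sup>2 * K" using n \<rho>(2) by simp
    finally have nz: "\<xi>\<^sup>2 * (e1 \<bullet> e1) + \<zeta>\<^sup>2 * (e3 \<bullet> e3) = K" using \<rho>(1) by simp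
    have \<zeta>2: "1/2 \<le> \<zeta>"
    proof (rule ccontr)
      assume "\<not> 1/2 \<le> \<zeta>"
      then have "\<zeta>\<^sup>2 < (1/2)\<^sup>2" using \<xi>\<zeta> by (intro power_strict_mono) auto
      moreover have "\<xi>\<^sup>2 \<le> \<zeta>\<^sup>2" using \<xi>\<zeta> by (metis abs_ge_zero power2_abs power_mono)
      ultimately have "\<xi>\<^sup>2 * (e1 \<bullet> e1) < 1/4 * (e1 \<bullet> e1)" "\<zeta>\<^sup>2 * (e3 \<bullet> e3) < 1/4 * (e3 \<bullet> e3)"
        using pos by (auto intro!: mult_strict_right_mono simp: power2_eq_square)
      then show False using nz K by linarith
    qed
    define q where "q = \<xi> *\<^sub>R e1 + (1/2) *\<^sub>R e2 + \<zeta> *\<^sub>R e3"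
    have qq: "q \<bullet> q = 1"
      unfolding q_def frame_norm[OF fr(1-3)] using nz by (simp add: K_def power2_eq_square)
    define z where "z = x + q"
    note arc = edge_arc[OF ed \<xi>\<zeta>, folded e1_def e2_def e3_def, OF q_def qq, folded z_def]
    have zx: "z - x = \<xi> *\<^sub>R (w - w') + (1/2) *\<^sub>R (y - x) + \<zeta> *\<^sub>R (w + w' - x - y)"
      by (simp add: z_def q_def e1_def e2_def e3_def)
    have zy: "z - y = \<xi> *\<^sub>R (w - w') + (-1/2) *\<^sub>R (y - x) + \<zeta> *\<^sub>R (w + w' - x - y)"
      by (simp add: z_def q_def e1_def e2_def e3_def vec_eq_iff field_simps)
    have zy': "z - y = (- \<xi>) *\<^sub>R (w' - w) + (1/2) *\<^sub>R (x - y) + \<zeta> *\<^sub>R (w' + w - y - x)"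
      unfolding zy by (simp add: vec_eq_iff field_simps)
    have unit: "(z - x) \<bullet> (z - x) = 1" "(z - y) \<bullet> (z - y) = 1"
      using arc(2,3) by (simp_all add: dist_norm norm_eq_1)
    have sides: "(w - x) \<bullet> ((z - x) \<times> (w' - x)) \<le> 0" "(w' - y) \<bullet> ((z - y) \<times> (w - y)) \<le> 0"
      using edge_direction_beyond_chord(2)[OF ed zx unit(1) _ \<zeta>2]
        edge_direction_beyond_chord(2)[OF edge_sym[OF ed] zy' unit(2) _ \<zeta>2] by auto
    have "p = (\<rho>/2 + p2) *\<^sub>R (z - x) + (\<rho>/2 - p2) *\<^sub>R (z - y)"
    proof -
      have "(\<rho>/2 + p2) *\<^sub>R (z - x) + (\<rho>/2 - p2) *\<^sub>R (z - y)
          = (\<rho> * \<xi>) *\<^sub>R (w - w') + p2 *\<^sub>R (y - x) + (\<rho> * \<zeta>) *\<^sub>R (w + w' - x - y)"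
        unfolding zx zy by (simp add: vec_eq_iff algebra_simps)
      then show ?thesis using \<rho>(1) unfolding p(1) by (simp add: \<xi>_def \<zeta>_def)
    qed
    then show thesis
      using that(3)[OF arc sides, of "\<rho>/2 + p2" "\<rho>/2 - p2"] 3 \<rho>(1) by auto
  qed
qed

lemma not_parallel_to_corner:
  assumes g: "generic u" and u: "u = t *\<^sub>R (w - x)" and w: "w \<in> W" and x: "x \<in> T w"
  shows False
proof -
  obtain y where "y \<in> T w" "y \<noteq> x"
    using another_element[OF finite_T W_D(2)[OF w]] by blast
  then have "u \<bullet> ((w - x) \<times> (w - y)) \<noteq> 0"
    using genericD[OF g w w] vertex_tile_cross x T_D(1) by metis
  then show False unfolding u by (simp add: dot_cross_self)
qed

text \<open>Fixing the poles \<open>u\<close> in the vertex tile and \<open>- u\<close> in the face tile of the same point \<open>x0\<close>, one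
  finds no pole in any other tile.\<close>

context
  fixes x0 u
  assumes x0: "x0 \<in> V" and g: "generic u"
    and uN: "u \<in> convex hull (vertex_tile x0)" and uF: "- u \<in> convex hull (face_tile x0)"
begin

lemma u_nonzero: "u \<noteq> 0"
proof
  assume "u = 0"
  moreover obtain y where "y \<in> T x0" using another_element[OF finite_T degree_ge_2[OF x0]] by blast
  ultimately show False
    using not_parallel_to_corner[OF g, of 0 x0 y] V_subset_W x0 by auto
qed

lemma sgn_facts: "norm (sgn u) = 1" "u = norm u *\<^sub>R sgn u" "0 < norm u" "norm u \<le> 1"
  using u_nonzero face_hull_norm[OF uF] by (auto simp: norm_sgn sgn_div_norm)

lemma pole_normal: "z \<in> B \<Longrightarrow> (x0 - z) \<bullet> (x0 - z) \<le> 2 * ((norm u *\<^sub>R sgn u) \<bullet> (x0 - z))"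
  using vertex_hull[OF uN] sgn_facts(2) by simp

lemma antipole_face: "x0 + - sgn u \<in> B"
proof -
  have "x0 + sgn (- u) \<in> B"
    using face_hull[OF x0 uF] sgn_facts u_nonzero by (intro face_direction) auto
  then show ?thesis by (simp add: sgn_minus)
qed

lemma vertex_is_not_corner_of_pole:
  assumes "w \<in> W" "x \<in> V" "w = x + sgn u \<or> w = x + - sgn u"
  shows False
proof -
  have d: "dist w x = 1" using assms(3) sgn_facts(1) by (auto simp: dist_norm)
  have "u = norm u *\<^sub>R (w - x) \<or> u = (- norm u) *\<^sub>R (w - x)"
    using assms(3) sgn_facts(2) by auto
  then show False
    using not_parallel_to_corner[OF g _ assms(1)] T_I[OF assms(2) d] by blast
qed

lemma vertex_tile_no_pole:
  assumes w: "w \<in> W" "w \<noteq> x0"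
  shows "t *\<^sub>R u \<notin> convex hull (vertex_tile w)"
proof
  assume t: "t *\<^sub>R u \<in> convex hull (vertex_tile w)"
  have wB: "w \<in> B" using W_D w by auto
  have N: "(w - z) \<bullet> (w - z) \<le> 2 * ((t *\<^sub>R u) \<bullet> (w - z))" if "z \<in> B" for z
    using vertex_hull[OF t that] .
  have N': "(w - z) \<bullet> (w - z) \<le> 2 * (((t * norm u) *\<^sub>R sgn u) \<bullet> (w - z))" if "z \<in> B" for z
    using N[OF that] sgn_facts(2) by (metis scaleR_scaleR)
  consider "t = 0" | "0 < t" | "t < 0" by linarith
  then show False
  proof cases
    case 1
    then have "(w - x0) \<bullet> (w - x0) \<le> 0" using N[OF V_subset_B[OF x0]] by simp
    moreover have "0 < (w - x0) \<bullet> (w - x0)" using w by simp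
    ultimately show ?thesis by linarith
  next
    case 2
    then have "w = x0"
      using normals_disjoint[OF _ sgn_facts(3) wB V_subset_B[OF x0] N' pole_normal] sgn_facts(3) by simp
    then show ?thesis using w by simp
  next
    case 3
    have "w = x0 + - sgn u"
    proof (rule normal_meets_face[OF _ _ _ wB x0 antipole_face])
      show "0 < - t * norm u" using 3 sgn_facts(3) by (simp add: mult_neg_pos)
      show "norm (- sgn u) = 1" using sgn_facts(1) by simp
      show "(w - z) \<bullet> (w - z) \<le> 2 * (((- t * norm u) *\<^sub>R - sgn u) \<bullet> (w - z))" if "z \<in> B" for z
        using N'[OF that] by simp
    qed
    then show ?thesis using vertex_is_not_corner_of_pole w x0 by blast
  qed
qed

lemma face_tile_no_pole:
  assumes x: "x \<in> V" "x \<noteq> x0"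
  shows "t *\<^sub>R u \<notin> convex hull (face_tile x)"
proof
  assume t: "t *\<^sub>R u \<in> convex hull (face_tile x)"
  note F = face_hull[OF x(1) t]
  have n: "norm (t *\<^sub>R u) \<le> 1" using face_hull_norm[OF t] .
  consider "t = 0" | "0 < t" | "t < 0" by linarith
  then show False
  proof cases
    case 1
    then have "(x0 - x) \<bullet> (x0 - x) \<le> 0" using F[OF x0] by simp
    moreover have "0 < (x0 - x) \<bullet> (x0 - x)" using x by simp
    ultimately show ?thesis by linarith
  next
    case 2
    then have "x + sgn (t *\<^sub>R u) \<in> B" using F n u_nonzero by (intro face_direction) auto
    then have "x + sgn u \<in> B" using 2 by (simp add: sgn_scaleR)
    then have "x0 = x + sgn u"
      using normal_meets_face[OF sgn_facts(3,1) pole_normal V_subset_B[OF x0] x(1)] by blast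
    then show ?thesis using vertex_is_not_corner_of_pole V_subset_W x0 x by blast
  next
    case 3
    then have "x + sgn (t *\<^sub>R u) \<in> B" using F n u_nonzero by (intro face_direction) auto
    then have "x + - sgn u \<in> B" using 3 by (simp add: sgn_scaleR)
    then show ?thesis
      using faces_disjoint[of "- sgn u" x x0] antipole_face sgn_facts(1) x x0 by simp
  qed
qed

text \<open>The antipole is in the face tile of \<open>x0\<close>, hence on the inner side of the chords of that face.\<close>

lemma antipole_side:
  assumes ed: "edge w x0 w' y"
  shows "(w - x0) \<bullet> ((- u) \<times> (w' - x0)) > 0"
proof -
  define d where "d = (w' - x0) \<times> (w - x0)"
  have tri: "(w - x0) \<bullet> (q \<times> (w' - x0)) = q \<bullet> d" for q
    by (simp add: d_def triple_rotate)
  have "0 \<le> 2 * ((- u) \<bullet> d)"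
  proof (rule convex_hull_inner_ge[OF uF])
    fix p assume "p \<in> face_tile x0"
    then obtain v where v: "v \<in> face_vertices x0" "p = v - x0" by (auto simp: face_tile_def)
    show "0 \<le> 2 * (p \<bullet> d)"
    proof (cases "v = w \<or> v = w'")
      case True
      then show ?thesis using v by (auto simp: d_def dot_cross_self)
    next
      case False
      then show ?thesis
        using edge_face_side[OF ed, of v] v face_vertices_D tri[of p] by (auto simp: less_imp_le)
    qed
  qed
  moreover have "(w' - x0) \<times> (w - x0) \<noteq> 0"
    using face_tile_cross[OF x0] edge_face_vertices[OF ed] edge_D[OF ed] by auto
  then have "u \<bullet> d \<noteq> 0"
    unfolding d_def using genericD[OF g] edge_D[OF ed] x0 by metis
  ultimately show ?thesis unfolding tri by (simp add: inner_minus_left)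
qed

lemma antipole_not_beyond_chord:
  assumes ed: "edge w x w' y" and B: "x + - sgn u \<in> B"
    and side: "(w - x) \<bullet> ((- sgn u) \<times> (w' - x)) \<le> 0"
  shows False
proof -
  have "x = x0"
    using faces_disjoint[of "- sgn u" x x0] antipole_face sgn_facts(1) B edge_D[OF ed] x0 by simp
  then have pos: "0 < (w - x) \<bullet> ((- u) \<times> (w' - x))" using antipole_side ed by blast
  have "- u = norm u *\<^sub>R (- sgn u)" using sgn_facts(2) by simp
  then have "(w - x) \<bullet> ((- u) \<times> (w' - x)) = norm u * ((w - x) \<bullet> ((- sgn u) \<times> (w' - x)))"
    by (simp only: cross_mult_left inner_scaleR_right)
  also have "\<dots> \<le> 0" using side sgn_facts(3) by (simp only: mult_le_0_iff) simp
  finally show False using pos by simp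
qed

text \<open>By \<open>edge_direction_cases\<close> a pole in an edge tile points into a face or is normal at a point of the
  edge. The first contradicts uniqueness of maximizers or the side of the chord on which the
  antipole lies; in the second case the point of the edge would be a vertex, or the antipole
  would lie on the edge of the face of \<open>x0\<close>, again on the wrong side of the chord.\<close>

lemma edge_tile_no_pole:
  assumes ed: "edge w x w' y"
  shows "t *\<^sub>R u \<notin> convex hull (edge_tile w x w' y)"
proof
  assume t: "t *\<^sub>R u \<in> convex hull (edge_tile w x w' y)"
  note e = edge_D[OF ed]
  obtain q1 q2 where q: "t *\<^sub>R u = q1 *\<^sub>R (w - w') + q2 *\<^sub>R (y - x) + (1/2) *\<^sub>R (w + w' - x - y)"
    "\<bar>q1\<bar> \<le> 1/2" "\<bar>q2\<bar> \<le> 1/2"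
    using edge_hull_coordinates[OF ed t] by metis
  have "(t *\<^sub>R u) \<bullet> (w + w' - x - y) = ((w + w' - x - y) \<bullet> (w + w' - x - y)) / 2"
    unfolding q(1) inner_add_left inner_scaleR_left using edge_frame(2,3)[OF ed] by simp
  then have nz: "t *\<^sub>R u \<noteq> 0" using edge_frame(6)[OF ed] by auto
  then have r: "0 < norm (t *\<^sub>R u)" by simp
  define p s where "p = sgn (t *\<^sub>R u)" and "s = inverse (norm (t *\<^sub>R u))"
  have s: "0 < s" unfolding s_def by (rule positive_imp_inverse_positive[OF r])
  have p: "p = (s * q1) *\<^sub>R (w - w') + (s * q2) *\<^sub>R (y - x) + (s * (1/2)) *\<^sub>R (w + w' - x - y)"
    by (simp add: p_def s_def sgn_div_norm q(1) scaleR_add_right)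
  have np: "norm p = 1" using nz by (auto simp: p_def norm_sgn)
  have p1: "p \<bullet> p = 1" using np by (simp add: norm_eq_1)
  have le: "\<bar>s * q1\<bar> \<le> s * (1/2)" "\<bar>s * q2\<bar> \<le> s * (1/2)"
    using q(2,3) s unfolding abs_mult by (auto intro!: mult_mono)
  have not_corner: "p \<noteq> a *\<^sub>R (v - x) + b *\<^sub>R (v - y)" if "v = w \<or> v = w'" for v a b
  proof
    assume pv: "p = a *\<^sub>R (v - x) + b *\<^sub>R (v - y)"
    have v: "v \<in> W" "x \<in> T v" "y \<in> T v" using that e by auto
    have "u \<bullet> ((v - x) \<times> (v - y)) \<noteq> 0"
      using genericD[OF g v(1) v(1)] vertex_tile_cross[OF v(2,3)] e by auto
    moreover have "p \<bullet> ((v - x) \<times> (v - y)) = 0" unfolding pv by (simp add: inner_add_left dot_cross_self)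
    then have "(t *\<^sub>R u) \<bullet> ((v - x) \<times> (v - y)) = 0"
      using nz by (auto simp: p_def sgn_div_norm)
    ultimately show False using nz by auto
  qed
  have arc_normal: "(z - z') \<bullet> (z - z') \<le> 2 * ((1 *\<^sub>R p) \<bullet> (z - z'))"
    if "z' \<in> B" "dist z x = 1" "dist z y = 1" "0 \<le> a" "0 \<le> b" "1 \<le> a + b" "p = a *\<^sub>R (z - x) + b *\<^sub>R (z - y)" for z z' a b
  proof -
    have "x \<in> T z" "y \<in> T z" using that e T_I by auto
    then have "(z - z') \<bullet> (z - z') \<le> 2 * ((z - x) \<bullet> (z - z'))" "(z - z') \<bullet> (z - z') \<le> 2 * ((z - y) \<bullet> (z - z'))"
      using normal_inequality that(1) by auto
    then have "a * ((z - z') \<bullet> (z - z')) + b * ((z - z') \<bullet> (z - z'))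
        \<le> a * (2 * ((z - x) \<bullet> (z - z'))) + b * (2 * ((z - y) \<bullet> (z - z')))"
      using that by (intro add_mono mult_left_mono) auto
    also have "\<dots> = 2 * (p \<bullet> (z - z'))" unfolding that(7) by (simp add: inner_add_left algebra_simps)
    finally have "(a + b) * ((z - z') \<bullet> (z - z')) \<le> 2 * (p \<bullet> (z - z'))" by (simp add: algebra_simps)
    moreover have "1 * ((z - z') \<bullet> (z - z')) \<le> (a + b) * ((z - z') \<bullet> (z - z'))"
      using that by (intro mult_right_mono) auto
    ultimately show ?thesis by simp
  qed
  have "t \<noteq> 0" using r by auto
  then consider "0 < t" "p = sgn u" | "t < 0" "p = - sgn u"
    unfolding p_def by (cases "0 < t") (auto simp: sgn_scaleR)
  then show False
  proof cases
    case 1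
    have face: False if "v + p \<in> B" "v \<in> V" for v
    proof -
      have "x0 = v + sgn u"
        using normal_meets_face[OF sgn_facts(3,1) pole_normal V_subset_B[OF x0] that(2)] that(1) 1 by simp
      then show False using vertex_is_not_corner_of_pole V_subset_W x0 that by blast
    qed
    show False
    proof (cases rule: edge_direction_cases[OF ed p p1 le])
      case (3 z a b)
      have "z = x0"
        using normals_disjoint[of 1 "norm u" z x0 p] arc_normal[OF _ 3(2,3,7-10)] pole_normal
          3(1) V_subset_B[OF x0] sgn_facts(3) 1 by simp
      then show False using 3(4,10) not_corner V_subset_W x0 by blast
    qed (use face e in auto)
  next
    case 2
    show False
    proof (cases rule: edge_direction_cases[OF ed p p1 le])
      case 1
      then show False using antipole_not_beyond_chord[OF ed] 2 by auto
    next
      case 2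
      then show False using antipole_not_beyond_chord[OF edge_sym[OF ed]] \<open>p = - sgn u\<close> by auto
    next
      case (3 z a b)
      have z: "z = x0 + p"
        using normal_meets_face[of 1 p z x0] arc_normal[OF _ 3(2,3,7-10)] np 3(1) x0 antipole_face 2 by simp
      have zW: "z \<notin> W" using 3(4,10) not_corner by blast
      have "dist z x0 = 1" using z np by (simp add: dist_norm)
      then have T: "x0 \<in> T z" "x \<in> T z" "y \<in> T z" using x0 e 3(2,3) T_I by auto
      have "x0 = x \<or> x0 = y"
      proof (rule ccontr)
        assume "\<not> ?thesis"
        then have "card {x0, x, y} = 3" using e by auto
        moreover have "card {x0, x, y} \<le> card (T z)" using T by (intro card_mono) auto
        ultimately show False using W_I[OF 3(1)] zW by simp
      qed
      then show False
      proof
        assume "x0 = x"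
        then have "z - x = - sgn u" using z 2 by simp
        then show False
          using antipole_not_beyond_chord[OF ed] 3(1,5) z 2 \<open>x0 = x\<close> by simp
      next
        assume "x0 = y"
        then have "z - y = - sgn u" using z 2 by simp
        then show False
          using antipole_not_beyond_chord[OF edge_sym[OF ed]] 3(1,6) z 2 \<open>x0 = y\<close> by simp
      qed
    qed
  qed
qed

end

end

section \<open>The number of incidences\<close>

lemma finite_zeros_on_curve:
  fixes a b c n :: "real^3"
  assumes "a \<bullet> (b \<times> c) \<noteq> 0" "n \<noteq> 0"
  shows "finite {t :: real. n \<bullet> (a + t *\<^sub>R b + t\<^sup>2 *\<^sub>R c) = 0}"
proof -
  have "[:n \<bullet> a, n \<bullet> b, n \<bullet> c:] \<noteq> 0"
  proof
    assume "[:n \<bullet> a, n \<bullet> b, n \<bullet> c:] = 0"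
    then have z: "n \<bullet> a = 0" "n \<bullet> b = 0" "n \<bullet> c = 0" by simp_all
    have "(a \<bullet> (b \<times> c)) *\<^sub>R n = (n \<bullet> a) *\<^sub>R (b \<times> c) + (n \<bullet> b) *\<^sub>R (c \<times> a) + (n \<bullet> c) *\<^sub>R (a \<times> b)"
      by (simp add: cross3_simps forall_3)
    then show False using z assms by simp
  qed
  then have "finite {t. poly [:n \<bullet> a, n \<bullet> b, n \<bullet> c:] t = 0}" by (rule poly_roots_finite)
  moreover have "poly [:n \<bullet> a, n \<bullet> b, n \<bullet> c:] t = n \<bullet> (a + t *\<^sub>R b + t\<^sup>2 *\<^sub>R c)" for t
    by (simp add: inner_add_right power2_eq_square algebra_simps)
  ultimately show ?thesis by simp
qed

context unit_configuration
begin

text \<open>The moment curve through three independent normals at \<open>x0\<close> stays in their cone and meets each of the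
  finitely many forbidden planes only finitely often.\<close>

lemma generic_pole_exists:
  assumes x0: "x0 \<in> V" and deg: "3 \<le> card (T x0)"
  obtains u where "generic u" "u \<in> convex hull (vertex_tile x0)" "- u \<in> convex hull (face_tile x0)"
proof -
  obtain S where "S \<subseteq> T x0" "card S = 3" by (meson obtain_subset_with_card_n deg)
  then obtain x y v where xyv: "x \<in> T x0" "y \<in> T x0" "v \<in> T x0" "x \<noteq> y" "x \<noteq> v" "y \<noteq> v"
    by (auto simp: card_3_iff)
  define a b c where "a = x0 - x" and "b = x0 - y" and "c = x0 - v"
  have abc: "a \<bullet> (b \<times> c) \<noteq> 0"
    unfolding a_def b_def c_def using not_coplanar xyv V_subset_W x0 by blast
  define N where "N = {n. n \<noteq> 0 \<and> (\<exists>w\<in>W. \<exists>w'\<in>W. \<exists>x\<in>V. \<exists>x'\<in>V. n = (w - x) \<times> (w' - x'))}"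
  have "N \<subseteq> (\<lambda>(w, w', x, x'). (w - x) \<times> (w' - x')) ` Sigma W (\<lambda>_. Sigma W (\<lambda>_. Sigma V (\<lambda>_. V)))"
    by (force simp: N_def)
  then have "finite N" by (rule finite_subset) (intro finite_imageI finite_SigmaI finite_W finite_V)
  then have "finite (\<Union>n\<in>N. {t :: real. n \<bullet> (a + t *\<^sub>R b + t\<^sup>2 *\<^sub>R c) = 0})"
    using abc by (intro finite_UN_I finite_zeros_on_curve) (auto simp: N_def)
  then have "\<not> {0 :: real<..} \<subseteq> (\<Union>n\<in>N. {t :: real. n \<bullet> (a + t *\<^sub>R b + t\<^sup>2 *\<^sub>R c) = 0})"
    using infinite_Ioi finite_subset by blast
  then obtain t :: real where t: "0 < t" "\<And>n. n \<in> N \<Longrightarrow> n \<bullet> (a + t *\<^sub>R b + t\<^sup>2 *\<^sub>R c) \<noteq> 0" by blast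
  \<comment> \<open>normalization, so that \<open>u\<close> is a convex combination\<close>
  define s where "s = 1 / (1 + t + t\<^sup>2)"
  have pos: "0 < 1 + t + t\<^sup>2" using t by (simp add: add_pos_pos)
  then have s0: "0 < s" by (simp add: s_def)
  define u where "u = s *\<^sub>R (a + t *\<^sub>R b + t\<^sup>2 *\<^sub>R c)"
  have "u \<bullet> ((w - x) \<times> (w' - x')) \<noteq> 0"
    if "w \<in> W" "w' \<in> W" "x \<in> V" "x' \<in> V" "(w - x) \<times> (w' - x') \<noteq> 0" for w w' x x'
  proof -
    have "(w - x) \<times> (w' - x') \<in> N" using that by (auto simp: N_def)
    then have "((w - x) \<times> (w' - x')) \<bullet> (a + t *\<^sub>R b + t\<^sup>2 *\<^sub>R c) \<noteq> 0" by (rule t(2))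
    then show ?thesis using s0 by (simp add: u_def inner_commute)
  qed
  then have gen: "generic u" unfolding generic_def by blast
  have cc: "s *\<^sub>R p + (s * t) *\<^sub>R q + (s * t\<^sup>2) *\<^sub>R r \<in> convex hull S" if "p \<in> S" "q \<in> S" "r \<in> S" for S and p q r :: "real^3"
  proof -
    have "s + s * t + s * t\<^sup>2 = s * (1 + t + t\<^sup>2)" by (simp add: distrib_left)
    then have one: "s + s * t + s * t\<^sup>2 = 1" using pos by (simp add: s_def)
    have "convex hull {p, q, r} \<subseteq> convex hull S" using that by (intro hull_mono) auto
    moreover have "s *\<^sub>R p + (s * t) *\<^sub>R q + (s * t\<^sup>2) *\<^sub>R r \<in> convex hull {p, q, r}"
      unfolding convex_hull_3 using one s0 t(1)
      by (intro CollectI exI[of _ s] exI[of _ "s * t"] exI[of _ "s * t\<^sup>2"]) auto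
    ultimately show ?thesis by blast
  qed
  have u: "u = s *\<^sub>R a + (s * t) *\<^sub>R b + (s * t\<^sup>2) *\<^sub>R c" by (simp add: u_def scaleR_add_right)
  have 1: "u \<in> convex hull (vertex_tile x0)"
    unfolding u by (rule cc) (use xyv in \<open>auto simp: a_def b_def c_def vertex_tile_def\<close>)
  have mu: "- u = s *\<^sub>R (x - x0) + (s * t) *\<^sub>R (y - x0) + (s * t\<^sup>2) *\<^sub>R (v - x0)"
    by (simp add: u a_def b_def c_def algebra_simps)
  have 2: "- u \<in> convex hull (face_tile x0)"
    unfolding mu by (rule cc) (use xyv T_subset_face_vertices[OF x0] in \<open>auto simp: face_tile_def\<close>)
  show thesis using that gen 1 2 by blast
qed

text \<open>Euler's formula for the boundary of the ball set, by double counting of the supported pairs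
  of a tile and a corner. An incidence \<open>(w, x)\<close> is also the edge that starts at \<open>w\<close> with the face of
  \<open>x\<close> on its first side, so each edge is counted twice among the incidences, once per direction.
  Each of the \<open>D\<close> corners supports two of its tiles; all tiles have two supporting corners except the
  two containing the poles, so \<open>2 D = 2 (card W - 1) + 2 (card V - 1) + D\<close>.\<close>

lemma incidence_count:
  assumes x0: "x0 \<in> V" and deg: "3 \<le> card (T x0)"
  shows "(\<Sum>w\<in>W. card (T w)) + 4 = 2 * card W + 2 * card V"
proof -
  obtain u where g: "generic u" and uN: "u \<in> convex hull (vertex_tile x0)"
    and uF: "- u \<in> convex hull (face_tile x0)"
    using generic_pole_exists[OF x0 deg] by blast
  define D where "D = Sigma W T"
  have finD: "finite D" using finite_W by (simp add: D_def)
  have cardD: "card D = (\<Sum>w\<in>W. card (T w))" using finite_W by (simp add: D_def)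
  have "\<forall>d\<in>D. \<exists>e. edge (fst d) (snd d) (fst e) (snd e)"
  proof
    fix d assume "d \<in> D"
    then have "fst d \<in> W" "snd d \<in> T (fst d)" by (auto simp: D_def)
    then obtain w' y where "edge (fst d) (snd d) w' y" using edge_exists by blast
    then have "edge (fst d) (snd d) (fst (w', y)) (snd (w', y))" by simp
    then show "\<exists>e. edge (fst d) (snd d) (fst e) (snd e)" by blast
  qed
  then obtain s where s: "\<And>d. d \<in> D \<Longrightarrow> edge (fst d) (snd d) (fst (s d)) (snd (s d))" by metis
  have sD: "s d \<in> D" if "d \<in> D" for d 
    using edge_D(2,8)[OF s[OF that]] unfolding D_def by (metis SigmaI prod.collapse)
  have ss: "s (s d) = d" if "d \<in> D" for d
    using edge_unique[OF s[OF sD[OF that]] edge_sym[OF s[OF that]]] by (simp add: prod_eq_iff)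
  \<comment> \<open>\<open>s\<close> reverses an edge, \<open>\<rho>\<close> rotates to the next edge end at the same vertex\<close>
  define \<rho> where "\<rho> d = (fst d, snd (s d))" for d
  have \<rho>D: "\<rho> d \<in> D" if "d \<in> D" for d using edge_D[OF s[OF that]] by (auto simp: D_def \<rho>_def)
  have "inj_on \<rho> D"
  proof (rule inj_onI)
    fix d e assume "d \<in> D" "e \<in> D" "\<rho> d = \<rho> e"
    then show "d = e"
      using edge_predecessor_unique[of "fst d" "snd d" "fst (s d)" "snd (s d)" "snd e" "fst (s e)"] s[of d] s[of e]
      by (auto simp: \<rho>_def prod_eq_iff)
  qed
  then have bij\<rho>: "bij_betw \<rho> D D"
    using finD \<rho>D by (simp add: bij_betw_def endo_inj_surj image_subsetI)
  have bijs: "bij_betw s D D"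
    using sD ss by (intro bij_betwI[where g = s]) auto
  \<comment> \<open>the edge tile of \<open>d\<close> is supported at \<open>fst d - snd d\<close>, respectively at \<open>fst d - snd (s d)\<close>;
    its other two corners are the same two for the reversed edge\<close>
  define I1 where "I1 d = (of_bool (0 < (u \<bullet> ((fst d - snd d) \<times> (fst d - snd (s d))))
      * (u \<bullet> ((fst d - snd d) \<times> (fst (s d) - snd d)))) :: nat)" for d
  define I2 where "I2 d = (of_bool (0 < (u \<bullet> ((fst d - snd (s d)) \<times> (fst d - snd d)))
      * (u \<bullet> ((fst d - snd (s d)) \<times> (fst (s d) - snd (s d))))) :: nat)" for d
  define SN where "SN d = (of_bool (supports u (vertex_tile (fst d)) (fst d - snd d)) :: nat)" for d
  define SF where "SF d = (of_bool (supports u (face_tile (snd d)) (fst d - snd d)) :: nat)" for d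
  have corner: "SN (\<rho> d) + SF (\<rho> d) + I1 (\<rho> d) + I2 d = 2" if d: "d \<in> D" for d
    using corner_count[OF g s[OF \<rho>D[OF d]], of "snd d" "fst (s d)"] s[OF d]
    by (simp add: SN_def SF_def I1_def I2_def \<rho>_def)
  have "(\<Sum>d\<in>D. SN (\<rho> d) + SF (\<rho> d) + I1 (\<rho> d) + I2 d) = 2 * card D"
    using corner by simp
  then have total: "(\<Sum>d\<in>D. SN d) + (\<Sum>d\<in>D. SF d) + ((\<Sum>d\<in>D. I1 d) + (\<Sum>d\<in>D. I2 d)) = 2 * card D"
    by (simp add: sum.distrib sum.reindex_bij_betw[OF bij\<rho>, of SN] sum.reindex_bij_betw[OF bij\<rho>, of SF]
        sum.reindex_bij_betw[OF bij\<rho>, of I1])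
  have edges: "I1 d + I2 d + I1 (s d) + I2 (s d) = 2" if d: "d \<in> D" for d
  proof -
    let ?Q = "edge_tile (fst d) (snd d) (fst (s d)) (snd (s d))"
    have "card {p \<in> ?Q. supports u ?Q p} = 2"
    proof (rule card_supports)
      show "2 \<le> card ?Q"
        using edge_corners_distinct[OF s[OF d]] by (simp add: edge_tile_def)
      show "u \<bullet> (p \<times> q) \<noteq> 0" if "p \<in> ?Q" "q \<in> ?Q" "p \<noteq> q" for p q
        using edge_tile_generic[OF g s[OF d] that] .
      show "t *\<^sub>R u \<notin> convex hull ?Q" for t
        using edge_tile_no_pole[OF x0 g uN uF s[OF d]] .
    qed (simp add: edge_tile_def)
    then show ?thesis
      unfolding card_edge_tile_supports[OF s[OF d]] I1_def I2_def ss[OF d] by simp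
  qed
  have "(\<Sum>d\<in>D. I1 d + I2 d + I1 (s d) + I2 (s d)) = 2 * card D" using edges by simp
  then have half: "(\<Sum>d\<in>D. I1 d) + (\<Sum>d\<in>D. I2 d) = card D"
    by (simp add: sum.distrib sum.reindex_bij_betw[OF bijs, of I1] sum.reindex_bij_betw[OF bijs, of I2])
  have vertex: "(\<Sum>x\<in>T w. SN (w, x)) = (if w = x0 then 0 else 2)" if w: "w \<in> W" for w
  proof -
    let ?C = "vertex_tile w"
    have inj: "inj_on (\<lambda>x. w - x) (T w)" by (auto simp: inj_on_def)
    have "(\<Sum>x\<in>T w. SN (w, x)) = (\<Sum>p\<in>?C. of_bool (supports u ?C p))"
      unfolding vertex_tile_def by (subst sum.reindex[OF inj]) (simp add: SN_def vertex_tile_def o_def)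
    also have "\<dots> = card {p \<in> ?C. supports u ?C p}" by (simp add: vertex_tile_def Int_def)
    also have "\<dots> = (if w = x0 then 0 else 2)"
    proof -
      have two: "2 \<le> card ?C" using W_D(2)[OF w] card_image[OF inj] by (simp add: vertex_tile_def)
      have fin: "finite ?C" by (simp add: vertex_tile_def)
      note gen = vertex_tile_generic[OF g w]
      show ?thesis
      proof (cases "w = x0")
        case True
        have "{p \<in> ?C. supports u ?C p} = {}"
          by (rule no_supports[OF fin two gen, of 1]) (use uN True in auto)
        then show ?thesis using True by (simp only: card.empty simp_thms if_True)
      next
        case False
        then show ?thesis
          using card_supports[OF fin two gen] vertex_tile_no_pole[OF x0 g uN uF w] by simp
      qed
    qed
    finally show ?thesis .
  qed
  have face: "(\<Sum>w\<in>face_vertices x. SF (w, x)) = (if x = x0 then 0 else 2)" if x: "x \<in> V" for x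
  proof -
    let ?C = "face_tile x"
    have inj: "inj_on (\<lambda>w. w - x) (face_vertices x)" by (auto simp: inj_on_def)
    have "(\<Sum>w\<in>face_vertices x. SF (w, x)) = (\<Sum>p\<in>?C. of_bool (supports u ?C p))"
      unfolding face_tile_def by (subst sum.reindex[OF inj]) (simp add: SF_def face_tile_def o_def)
    also have "\<dots> = card {p \<in> ?C. supports u ?C p}" by (simp add: face_tile_def Int_def)
    also have "\<dots> = (if x = x0 then 0 else 2)"
    proof -
      have "2 \<le> card (face_vertices x)"
        using degree_ge_2[OF x] card_mono[OF finite_face_vertices T_subset_face_vertices[OF x]] by linarith
      then have two: "2 \<le> card ?C" using card_image[OF inj] by (simp add: face_tile_def)
      have fin: "finite ?C" by (simp add: face_tile_def)
      note gen = face_tile_generic[OF g x]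
      show ?thesis
      proof (cases "x = x0")
        case True
        have "{p \<in> ?C. supports u ?C p} = {}"
          by (rule no_supports[OF fin two gen, of "-1"]) (use uF True in auto)
        then show ?thesis using True by (simp only: card.empty simp_thms if_True)
      next
        case False
        then show ?thesis
          using card_supports[OF fin two gen] face_tile_no_pole[OF x0 g uN uF x] by simp
      qed
    qed
    finally show ?thesis .
  qed
  have punctured: "(\<Sum>w\<in>A. if w = x0 then 0 else 2 :: nat) + 2 = 2 * card A" if "finite A" "x0 \<in> A" for A
  proof -
    have "(\<Sum>w\<in>A. if w = x0 then 0 else 2 :: nat) = (\<Sum>w\<in>A - {x0}. 2)"
      using that by (subst sum.remove) auto
    then show ?thesis using that card_Suc_Diff1[OF that] by simp
  qed
  have "(\<Sum>d\<in>D. SN d) = (\<Sum>w\<in>W. \<Sum>x\<in>T w. SN (w, x))"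
    unfolding D_def using finite_W by (simp add: sum.Sigma)
  then have N: "(\<Sum>d\<in>D. SN d) + 2 = 2 * card W"
    using vertex punctured[OF finite_W] V_subset_W x0 by (simp add: subset_iff)
  have "(\<Sum>d\<in>D. SF d) = (\<Sum>w\<in>W. \<Sum>x\<in>T w. SF (w, x))"
    unfolding D_def using finite_W by (simp add: sum.Sigma)
  also have "\<dots> = (\<Sum>x\<in>V. \<Sum>w\<in>face_vertices x. SF (w, x))"
    unfolding touching_def face_vertices_def by (rule sum.swap_restrict[OF finite_W finite_V])
  finally have F: "(\<Sum>d\<in>D. SF d) + 2 = 2 * card V"
    using face punctured[OF finite_V x0] by simp
  show ?thesis using total half N F unfolding cardD[symmetric] by linarith
qed

end

section \<open>The number of unit distances\<close>

definition unit_pairs :: "(real^3) set \<Rightarrow> (real^3) set set" where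
  "unit_pairs V = {{x, y} | x y. x \<in> V \<and> y \<in> V \<and> dist x y = 1}"

lemma finite_unit_pairs: "finite V \<Longrightarrow> finite (unit_pairs V)"
  by (rule finite_subset[of _ "Pow V"]) (auto simp: unit_pairs_def)

lemma num_diameters_eq_unit_pairs:
  assumes "diameter V = 1"
  shows "num_diameters V = card (unit_pairs V)"
proof -
  have "diameter_pairs V = unit_pairs V"
    unfolding diameter_pairs_def unit_pairs_def assms by (intro Collect_cong) (metis dist_self zero_neq_one)
  then show ?thesis by (simp add: num_diameters_def)
qed

lemma sum_degrees:
  assumes "finite V"
  shows "(\<Sum>x\<in>V. card (touching V x)) = 2 * card (unit_pairs V)"
proof -
  have deg: "card (touching V x) = card {e \<in> unit_pairs V. x \<in> e}" if "x \<in> V" for x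
  proof -
    have "bij_betw (\<lambda>y. {x, y}) (touching V x) {e \<in> unit_pairs V. x \<in> e}"
      unfolding bij_betw_def
    proof
      show "inj_on (\<lambda>y. {x, y}) (touching V x)" by (auto simp: inj_on_def doubleton_eq_iff)
      show "(\<lambda>y. {x, y}) ` touching V x = {e \<in> unit_pairs V. x \<in> e}"
        using that by (auto simp: touching_def unit_pairs_def dist_commute)
    qed
    then show ?thesis by (rule bij_betw_same_card)
  qed
  have two: "card {x \<in> V. x \<in> e} = 2" if e: "e \<in> unit_pairs V" for e
  proof -
    obtain x y where "x \<in> V" "y \<in> V" "dist x y = 1" "e = {x, y}"
      using e unfolding unit_pairs_def by blast
    then have "{x \<in> V. x \<in> e} = {x, y}" "x \<noteq> y" by auto
    then show ?thesis by simp
  qed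
  have "(\<Sum>x\<in>V. card (touching V x)) = (\<Sum>x\<in>V. \<Sum>e\<in>{e \<in> unit_pairs V. x \<in> e}. 1)"
    using deg by simp
  also have "\<dots> = (\<Sum>e\<in>unit_pairs V. \<Sum>x\<in>{x \<in> V. x \<in> e}. 1)"
    by (rule sum.swap_restrict[OF assms finite_unit_pairs[OF assms]])
  also have "\<dots> = 2 * card (unit_pairs V)" using two by simp
  finally show ?thesis .
qed

lemma unit_pairs_remove:
  assumes "finite V" "v \<in> V"
  shows "card (unit_pairs V) \<le> card (unit_pairs (V - {v})) + card (touching V v)"
proof -
  have "unit_pairs V \<subseteq> unit_pairs (V - {v}) \<union> (\<lambda>y. {v, y}) ` touching V v"
    by (fastforce simp: unit_pairs_def touching_def dist_commute insert_commute)
  then have "card (unit_pairs V) \<le> card (unit_pairs (V - {v}) \<union> (\<lambda>y. {v, y}) ` touching V v)"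
    using assms by (intro card_mono finite_UnI finite_unit_pairs finite_imageI) (auto simp: touching_def)
  also have "\<dots> \<le> card (unit_pairs (V - {v})) + card ((\<lambda>y. {v, y}) ` touching V v)"
    by (rule card_Un_le)
  also have "\<dots> \<le> card (unit_pairs (V - {v})) + card (touching V v)"
    using assms by (intro add_left_mono card_image_le) (auto simp: touching_def)
  finally show ?thesis .
qed

context unit_configuration
begin

lemma sum_vertex_degrees: "(\<Sum>w\<in>W. card (T w)) = 2 * card (unit_pairs V) + (\<Sum>w\<in>W - V. card (T w))"
  using sum.subset_diff[OF V_subset_W finite_W, of "\<lambda>w. card (T w)"] sum_degrees[OF finite_V]
  by simp

lemma card_W: "card W = card V + card (W - V)"
  using card_Diff_subset[OF finite_V V_subset_W] card_mono[OF finite_W V_subset_W] by simp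

lemma three_le_extra_degree: "w \<in> W - V \<Longrightarrow> 3 \<le> card (T w)"
  by (auto simp: ball_set_vertices_def principal_vertices_def dangling_vertices_def touching_def)

text \<open>Summing the degrees over \<open>V\<close> gives twice the number of unit distances; every vertex of the ball set
  outside \<open>V\<close> has degree at least 3 and costs at least 1.\<close>

lemma excess_count:
  assumes "x0 \<in> V" "3 \<le> card (T x0)"
  shows "2 * card (unit_pairs V) + card (W - V) + 4 \<le> 4 * card V"
    and "W = V \<Longrightarrow> 2 * card (unit_pairs V) + 4 = 4 * card V"
proof -
  have id: "2 * card (unit_pairs V) + (\<Sum>w\<in>W - V. card (T w)) + 4 = 4 * card V + 2 * card (W - V)"
    using incidence_count[OF assms] sum_vertex_degrees card_W by linarith
  moreover have "(\<Sum>w\<in>W - V. 3) \<le> (\<Sum>w\<in>W - V. card (T w))"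
    using three_le_extra_degree by (intro sum_mono)
  ultimately show "2 * card (unit_pairs V) + card (W - V) + 4 \<le> 4 * card V"
    by simp
  show "2 * card (unit_pairs V) + 4 = 4 * card V" if "W = V" using id that by simp
qed

text \<open>If a point of \<open>V\<close> is only a dangling vertex, following its edge leads to a principal one.\<close>

lemma principal_vertex_exists:
  assumes "V \<noteq> {}"
  obtains z where "z \<in> W" "3 \<le> card (T z)"
proof (cases "\<exists>w\<in>W. 3 \<le> card (T w)")
  case False
  obtain w where w: "w \<in> V" using assms by blast
  then have wW: "w \<in> W" using V_subset_W by blast
  obtain x where x: "x \<in> T w" using another_element[OF finite_T degree_ge_2[OF w]] by blast
  obtain y where y: "y \<in> T w" "y \<noteq> x" using another_element[OF finite_T degree_ge_2[OF w]] by blast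
  have only: "v = x \<or> v = y" if "v \<in> T w" for v
  proof (rule ccontr)
    assume "\<not> ?thesis"
    then have "card {x, y, v} = 3" using y by auto
    moreover have "card {x, y, v} \<le> card (T w)" using x y that by (intro card_mono) auto
    ultimately show False using False wW by force
  qed
  show thesis
  proof (rule arc_to_principal_vertex[OF wW x y(1)])
    show "0 < (w - x) \<bullet> ((w - y) \<times> (w - v))" if "v \<in> T w" "v \<noteq> x" "v \<noteq> y" for v
      using only that by blast
  qed (use y(2) in blast, meson W_I that)
qed (use that in blast)

text \<open>The midpoint of the great circle arc between two neighbours of \<open>v\<close> lies on the unit sphere around \<open>v\<close> and
  strictly inside all other balls. Moving it slightly away from \<open>v\<close> leaves only the ball of \<open>v\<close>.\<close>

lemma all_essential:
  assumes v: "v \<in> V"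
  shows "essential V v"
proof -
  obtain y1 where y1: "y1 \<in> T v" using another_element[OF finite_T degree_ge_2[OF v]] by blast
  obtain y2 where y2: "y2 \<in> T v" "y2 \<noteq> y1" using another_element[OF finite_T degree_ge_2[OF v]] by blast
  define q1 q2 where "q1 = y1 - v" and "q2 = y2 - v"
  have n: "norm q1 = 1" "norm q2 = 1" 
    using T_D(3)[OF y1] T_D(3)[OF y2(1)] by (simp_all add: q1_def q2_def norm_minus_commute)
  have "y1 \<in> face_vertices v" "y2 \<in> face_vertices v" using T_subset_face_vertices[OF v] y1 y2 by auto
  then have nz: "q1 + q2 \<noteq> 0"
    using face_tile_cross[OF v, of y1 y2] y2 unfolding q1_def[symmetric] q2_def[symmetric]
    by (auto simp: add_eq_0_iff2)
  have lt2: "norm (q1 + q2) < 2"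
  proof -
    have "q1 \<bullet> q2 < 1" using unit_inner_less_1[OF n] y2 by (auto simp: q1_def q2_def)
    moreover have "q1 \<bullet> q1 = 1" "q2 \<bullet> q2 = 1" using n by (auto simp: norm_eq_1)
    ultimately have "(norm (q1 + q2))\<^sup>2 < 2\<^sup>2"
      by (simp add: power2_norm_eq_inner inner_add_left inner_add_right inner_commute)
    then show ?thesis by (rule power_less_imp_less_base) simp
  qed
  define p where "p = sgn (q1 + q2)"
  have np: "norm p = 1" using nz by (simp add: p_def norm_sgn)
  have inside: "dist (v + p) v' < 1" if v': "v' \<in> V - {v}" for v'
  proof -
    define d where "d = v' - v"
    have d0: "0 < d \<bullet> d" using v' by (simp add: d_def)
    have "d \<bullet> d \<le> 2 * (q1 \<bullet> d)" "d \<bullet> d \<le> 2 * (q2 \<bullet> d)"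
      using face_inequality[of y1 v v'] face_inequality[of y2 v v'] V_subset_B T_D y1 y2 v'
      unfolding q1_def q2_def d_def by (auto simp: dist_commute)
    then have "d \<bullet> d \<le> (q1 + q2) \<bullet> d" by (simp add: inner_add_left)
    also have "\<dots> = norm (q1 + q2) * (p \<bullet> d)" using nz by (simp add: p_def sgn_div_norm)
    finally have 1: "d \<bullet> d \<le> norm (q1 + q2) * (p \<bullet> d)" .
    then have "0 < norm (q1 + q2) * (p \<bullet> d)" using d0 by linarith
    then have "0 < p \<bullet> d" using nz by (simp add: zero_less_mult_iff)
    then have "norm (q1 + q2) * (p \<bullet> d) < 2 * (p \<bullet> d)" using lt2 by simp
    then have "d \<bullet> d < 2 * (p \<bullet> d)" using 1 by linarith
    then have "norm (p - d) \<le> 1 \<and> norm (p - d) \<noteq> 1"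
      using unit_chord_le[OF np, of d] by auto
    then show ?thesis by (simp add: dist_norm d_def algebra_simps)
  qed
  have "eventually (\<lambda>e. dist (v + (1 + e) *\<^sub>R p) v' < 1) (at_right 0)" if "v' \<in> V - {v}" for v'
  proof (rule order_tendstoD(2))
    show "((\<lambda>e. dist (v + (1 + e) *\<^sub>R p) v') \<longlongrightarrow> dist (v + (1 + 0) *\<^sub>R p) v') (at_right 0)"
      by (intro tendsto_intros)
    show "dist (v + (1 + 0) *\<^sub>R p) v' < 1" using inside[OF that] by simp
  qed
  then have "eventually (\<lambda>e. \<forall>v'\<in>V - {v}. dist (v + (1 + e) *\<^sub>R p) v' < 1) (at_right (0::real))"
    using finite_V by (simp add: eventually_ball_finite)
  moreover have "eventually (\<lambda>e::real. 0 < e) (at_right 0)" by (simp add: eventually_at_right_less)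
  ultimately have "eventually (\<lambda>e. (\<forall>v'\<in>V - {v}. dist (v + (1 + e) *\<^sub>R p) v' < 1) \<and> 0 < e) (at_right (0::real))"
    by (rule eventually_conj)
  then obtain e :: real where e: "\<forall>v'\<in>V - {v}. dist (v + (1 + e) *\<^sub>R p) v' < 1" "0 < e"
    using eventually_happens[of _ "at_right (0::real)"] by auto
  define z where "z = v + (1 + e) *\<^sub>R p"
  have "z \<in> ball_set (V - {v})" using e by (auto simp: ball_set_def z_def dist_commute less_imp_le)
  moreover have "dist v z = 1 + e" using np e by (simp add: z_def dist_norm)
  then have "z \<notin> ball_set V" using v e by (force simp: ball_set_def)
  moreover have "ball_set V \<subseteq> ball_set (V - {v})" by (auto simp: ball_set_def)
  ultimately show ?thesis using v by (auto simp: essential_def)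
qed

end

text \<open>The difference between a point of \<open>V\<close> and the centroid is an average of \<open>card V\<close> vectors of norm at
  most 1, one of which is zero.\<close>

lemma circumradius_less_1:
  fixes V :: "(real^3) set"
  assumes fin: "finite V" and d: "\<And>x y. x \<in> V \<Longrightarrow> y \<in> V \<Longrightarrow> dist x y \<le> 1"
  shows "circumradius V < 1"
proof (cases "V = {}")
  case True
  then have "circumradius V \<le> 0" using circumradius(3)[of V 0 0] by simp
  then show ?thesis by simp
next
  case False
  define n where "n = real (card V)"
  have n: "1 \<le> n" using False fin by (simp add: n_def Suc_leI card_gt_0_iff)
  define c where "c = (1 / n) *\<^sub>R (\<Sum>w\<in>V. w)"
  have "dist c v \<le> (n - 1) / n" if v: "v \<in> V" for v
  proof -
    have "n *\<^sub>R (v - c) = (\<Sum>w\<in>V. v - w)"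
      using n by (simp add: c_def sum_subtractf scaleR_diff_right n_def sum_constant_scaleR del: sum_constant)
    then have "n * norm (v - c) = norm (\<Sum>w\<in>V. v - w)" using n by (metis abs_of_nonneg norm_scaleR order_trans zero_le_one)
    also have "\<dots> \<le> (\<Sum>w\<in>V. norm (v - w))" by (rule norm_sum)
    also have "\<dots> = (\<Sum>w\<in>V - {v}. norm (v - w))" using fin v by (subst sum.remove) auto
    also have "\<dots> \<le> (\<Sum>w\<in>V - {v}. 1)" using d[OF v] by (intro sum_mono) (auto simp: dist_norm)
    also have "\<dots> = n - 1" using fin v n by (simp add: n_def of_nat_diff)
    finally show ?thesis using n by (simp add: dist_norm norm_minus_commute field_simps)
  qed
  then have "V \<subseteq> cball c ((n - 1) / n)" by auto
  then have "circumradius V \<le> (n - 1) / n"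
    using n by (intro circumradius(3) finite_imp_bounded[OF fin]) auto
  also have "\<dots> < 1" using n by simp
  finally show ?thesis .
qed

text \<open>Removing a point with at most two neighbours loses at most two pairs, and the bound drops by two. If
  there is no such point, \<open>excess_count\<close> applies.\<close>

lemma card_unit_pairs_le:
  fixes V :: "(real^3) set"
  assumes "finite V" "V \<noteq> {}" "\<And>x y. x \<in> V \<Longrightarrow> y \<in> V \<Longrightarrow> dist x y \<le> 1"
  shows "card (unit_pairs V) + 2 \<le> 2 * card V"
  using assms
proof (induction "card V" arbitrary: V rule: less_induct)
  case less
  show ?case
  proof (cases "\<exists>v\<in>V. card (touching V v) \<le> 2")
    case True
    then obtain v where v: "v \<in> V" "card (touching V v) \<le> 2" by blast
    show ?thesis
    proof (cases "V = {v}")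
      case True
      then have "unit_pairs V = {}" by (auto simp: unit_pairs_def)
      then show ?thesis using True by simp
    next
      case False
      have c: "Suc (card (V - {v})) = card V" by (rule card_Suc_Diff1[OF less.prems(1) v(1)])
      have "card (unit_pairs (V - {v})) + 2 \<le> 2 * card (V - {v})"
        using less.prems v False c by (intro less.hyps) auto
      then show ?thesis using unit_pairs_remove[OF less.prems(1) v(1)] v(2) c by linarith
    qed
  next
    case False
    then have deg: "3 \<le> card (touching V v)" if "v \<in> V" for v using that by force
    interpret unit_configuration V
      using less.prems deg by unfold_locales (auto intro: order_trans[of 2 3])
    obtain x0 where "x0 \<in> V" using less.prems by blast
    then show ?thesis using excess_count(1)[OF _ deg] by fastforce
  qed
qed

section \<open>Extremal configurations\<close>

text \<open>After rescaling to diameter 1 the diameters are the unit distances.\<close>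

lemma num_diameters_le_linear:
  fixes V :: "(real^3) set"
  assumes fin: "finite V" and n: "2 \<le> card V"
  shows "num_diameters V + 2 \<le> 2 * card V"
proof -
  have bd: "bounded V" using fin by (rule finite_imp_bounded)
  obtain a b where ab: "a \<in> V" "b \<in> V" "a \<noteq> b"
    using n by (metis card_le_Suc0_iff_eq fin not_less_eq_eq numeral_2_eq_2)
  have "0 < dist a b" using ab by simp
  also have "\<dots> \<le> diameter V" using diameter_bounded_bound[OF bd ab(1,2)] .
  finally have d: "0 < diameter V" .
  define f where "f x = (1 / diameter V) *\<^sub>R x" for x :: "real^3"
  have dist_f: "dist (f x) (f y) = dist x y / diameter V" for x y
  proof -
    have "dist (f x) (f y) = norm ((1 / diameter V) *\<^sub>R (x - y))"
      by (simp add: f_def dist_norm scaleR_diff_right)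
    then show ?thesis using d by (simp add: dist_norm)
  qed
  have inj: "inj f" using d by (auto simp: inj_on_def f_def)
  have "unit_pairs (f ` V) = (`) f ` diameter_pairs V"
  proof -
    have iff: "dist (f x) (f y) = 1 \<longleftrightarrow> dist x y = diameter V" for x y using d by (auto simp: dist_f)
    have ne: "dist x y = diameter V \<Longrightarrow> x \<noteq> y" for x y using d by auto
    show ?thesis
    proof (intro equalityI subsetI)
      fix e assume "e \<in> unit_pairs (f ` V)"
      then obtain x y where "x \<in> V" "y \<in> V" "dist (f x) (f y) = 1" "e = {f x, f y}"
        by (auto simp: unit_pairs_def)
      moreover have "dist x y = diameter V" "x \<noteq> y" using iff ne calculation by auto
      ultimately have "{x, y} \<in> diameter_pairs V" "e = f ` {x, y}"
        unfolding diameter_pairs_def by blast+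
      then show "e \<in> (`) f ` diameter_pairs V" by blast
    next
      fix e assume "e \<in> (`) f ` diameter_pairs V"
      then obtain x y where "x \<in> V" "y \<in> V" "dist x y = diameter V" "e = {f x, f y}"
        by (auto simp: diameter_pairs_def)
      then show "e \<in> unit_pairs (f ` V)" using iff by (auto simp: unit_pairs_def)
    qed
  qed
  moreover have "inj_on ((`) f) (diameter_pairs V)"
    using inj by (auto intro!: inj_onI simp: inj_image_eq_iff)
  ultimately have "card (unit_pairs (f ` V)) = num_diameters V"
    by (simp add: num_diameters_def card_image)
  moreover have "card (f ` V) = card V" using inj by (simp add: card_image inj_on_subset)
  moreover have "card (unit_pairs (f ` V)) + 2 \<le> 2 * card (f ` V)"
  proof (rule card_unit_pairs_le)
    fix x y assume "x \<in> f ` V" "y \<in> f ` V"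
    then show "dist x y \<le> 1"
      using diameter_bounded_bound[OF bd] d by (auto simp: dist_f)
  qed (use fin ab in auto)
  ultimately show ?thesis by simp
qed

text \<open>A regular tetrahedron with edge \<open>[a, b]\<close>, together with further points on the short arc between the
  other two vertices of the circle of points at distance 1 from \<open>a\<close> and \<open>b\<close>. Each new point
  adds two diameters.\<close>

lemma many_diameters_exist:
  assumes n: "4 \<le> n"
  obtains V :: "(real^3) set" where "finite V" "card V = n" "2 * n \<le> num_diameters V + 2"
proof -
  \<comment> \<open>the chord of this angle has length 1 on a circle of radius \<open>sqrt 3 / 2\<close>\<close>
  define \<theta> :: real where "\<theta> = arccos (1/3)"
  have \<theta>: "0 < \<theta>" "\<theta> < pi" "cos \<theta> = 1/3" 
    unfolding \<theta>_def using arccos_lt_bounded[of "1/3"] by auto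
  have "infinite {0<..<\<theta>}" using \<theta>(1) by (simp add: infinite_Ioo)
  then obtain S where S: "S \<subseteq> {0<..<\<theta>}" "finite S" "card S = n - 4"
    by (meson infinite_arbitrarily_large)
  define r where "r = sqrt 3 / 2"
  have r: "r * r = 3/4" by (simp add: r_def)
  define a b :: "real^3" where "a = vector [1/2, 0, 0]" and "b = vector [-1/2, 0, 0]"
  define z :: "real \<Rightarrow> real^3" where "z t = vector [0, r * cos t, r * sin t]" for t
  have ip: "(vector [x1, x2, x3] :: real^3) \<bullet> vector [y1, y2, y3] = x1 * y1 + x2 * y2 + x3 * y3" for x1 x2 x3 y1 y2 y3
    by (simp add: inner_vec_def sum_3)
  have df: "(vector [x1, x2, x3] :: real^3) - vector [y1, y2, y3] = vector [x1 - y1, x2 - y2, x3 - y3]" for x1 x2 x3 y1 y2 y3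
    by (simp add: vec_eq_iff forall_3)
  have sq: "dist x y = 1 \<longleftrightarrow> (x - y) \<bullet> (x - y) = 1" "dist x y \<le> 1 \<longleftrightarrow> (x - y) \<bullet> (x - y) \<le> 1" for x y :: "real^3"
    by (simp_all add: dist_norm norm_eq_1 norm_le_square)
  have ab: "dist a b = 1" by (simp add: sq a_def b_def df ip)
  have circ: "r * cos t * (r * cos t) + r * sin t * (r * sin t) = 3/4" for t
  proof -
    have "r * cos t * (r * cos t) + r * sin t * (r * sin t) = r * r * (cos t * cos t + sin t * sin t)"
      by (simp add: algebra_simps del: sin_cos_squared_add3)
    then show ?thesis by (simp add: r)
  qed
  have az: "dist a (z t) = 1" "dist b (z t) = 1" for t
    using circ[of t] by (simp_all add: sq a_def b_def z_def df ip)
  have zz: "(z s - z t) \<bullet> (z s - z t) = 3/2 * (1 - cos (s - t))" for s t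
  proof -
    have "(z s - z t) \<bullet> (z s - z t) = (r * cos s * (r * cos s) + r * sin s * (r * sin s))
      + (r * cos t * (r * cos t) + r * sin t * (r * sin t)) - 2 * (r * r) * (cos s * cos t + sin s * sin t)"
      unfolding z_def df ip by (simp add: algebra_simps)
    then show ?thesis unfolding circ r cos_diff[symmetric] by simp
  qed
  have zle: "dist (z s) (z t) \<le> 1" if "s \<in> {0..\<theta>}" "t \<in> {0..\<theta>}" for s t
  proof -
    have "cos \<theta> \<le> cos \<bar>s - t\<bar>" using that \<theta> by (intro cos_monotone_0_pi_le) auto
    then show ?thesis using \<theta>(3) by (simp add: sq zz)
  qed
  have z0: "dist (z 0) (z \<theta>) = 1" using \<theta>(3) by (simp add: sq zz)
  have z_inj: "s = t" if "z s = z t" "s \<in> {0..\<theta>}" "t \<in> {0..\<theta>}" for s t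
  proof (rule cos_inj_pi)
    have "r * cos s = r * cos t"
      using that(1) by (simp add: z_def vec_eq_iff forall_3)
    moreover have "r \<noteq> 0" using r by auto
    ultimately show "cos s = cos t" by simp
  qed (use that \<theta> in auto)
  define V where "V = insert a (insert b (insert (z 0) (insert (z \<theta>) (z ` S))))"
  have Sle: "s \<in> {0..\<theta>}" "s \<noteq> 0" "s \<noteq> \<theta>" if "s \<in> S" for s using that S by auto
  have ne: "a \<noteq> b" "a \<noteq> z t" "b \<noteq> z t" for t using ab az by (metis dist_self zero_neq_one)+
  have ne0: "z 0 \<noteq> z \<theta>" using z0 by auto
  have neS: "z 0 \<notin> z ` S" "z \<theta> \<notin> z ` S"
    using z_inj[of 0] z_inj[of \<theta>] Sle \<theta> by (auto; fastforce)+
  have abS: "a \<notin> z ` S" "b \<notin> z ` S" using ne by auto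
  have finV: "finite V" using S by (simp add: V_def)
  have injS: "inj_on z S" using z_inj Sle by (auto simp: inj_on_def)
  have cardV: "card V = n"
    using ne ne0 neS abS S n by (simp add: V_def card_image[OF injS])
  have le1: "dist x y \<le> 1" if "x \<in> V" "y \<in> V" for x y
    using that ab az zle Sle(1) \<theta>(1) unfolding V_def by (auto simp: dist_commute)
  have diam: "diameter V = 1"
  proof (rule order_antisym)
    show "diameter V \<le> 1" using le1 by (intro diameter_le) (auto simp: dist_norm V_def)
    show "1 \<le> diameter V"
      using diameter_bounded_bound[OF finite_imp_bounded[OF finV], of a b] ab by (simp add: V_def)
  qed
  have deg: "card A \<le> card (touching V x)" if "A \<subseteq> touching V x" for A x
    using that finV by (intro card_mono) (auto simp: touching_def)
  have da: "n - 1 \<le> card (touching V a)" and db: "n - 1 \<le> card (touching V b)"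
  proof -
    have "V - {a} \<subseteq> touching V a" "V - {b} \<subseteq> touching V b"
      using ab az by (auto simp: touching_def V_def dist_commute)
    moreover have "a \<in> V" "b \<in> V" by (simp_all add: V_def)
    then have "card (V - {a}) = n - 1" "card (V - {b}) = n - 1"
      using cardV by (simp_all add: card_Diff_singleton)
    ultimately show "n - 1 \<le> card (touching V a)" "n - 1 \<le> card (touching V b)"
      using deg by metis+
  qed
  have dz: "3 \<le> card (touching V (z 0))" "3 \<le> card (touching V (z \<theta>))"
    using deg[of "{a, b, z \<theta>}" "z 0"] deg[of "{a, b, z 0}" "z \<theta>"] ne z0 az
    by (auto simp: touching_def V_def dist_commute)
  have ds: "2 \<le> card (touching V (z s))" for s
    using deg[of "{a, b}" "z s"] ne az by (auto simp: touching_def V_def dist_commute)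
  have "(\<Sum>s\<in>S. 2) \<le> (\<Sum>s\<in>S. card (touching V (z s)))" using ds by (intro sum_mono)
  then have "2 * (n - 4) \<le> (\<Sum>x\<in>z ` S. card (touching V x))"
    using S by (simp add: sum.reindex[OF injS])
  moreover have "(\<Sum>x\<in>V. card (touching V x)) = card (touching V a) + card (touching V b)
      + card (touching V (z 0)) + card (touching V (z \<theta>)) + (\<Sum>x\<in>z ` S. card (touching V x))"
    using ne ne0 neS abS S by (subst V_def) simp
  ultimately have "4 * n \<le> 2 * card (unit_pairs V) + 4"
    using da db dz n unfolding sum_degrees[OF finV] by linarith
  then show thesis using that[of V] finV cardV num_diameters_eq_unit_pairs[OF diam] by simp
qed

lemma max_num_diameters_eq:
  assumes "4 \<le> n"
  shows "max_num_diameters n = 2 * n - 2"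
proof -
  obtain V :: "(real^3) set" where V: "finite V" "card V = n" "2 * n \<le> num_diameters V + 2"
    using many_diameters_exist[OF assms] by blast
  have le: "num_diameters U \<le> 2 * n - 2" if "finite U" "card U = n" for U
    using num_diameters_le_linear[OF that(1)] that(2) assms by simp
  show ?thesis unfolding max_num_diameters_def
  proof (rule Max_eqI[OF max_num_diameters_wf(1)])
    show "2 * n - 2 \<in> {num_diameters V |V. finite V \<and> card V = n}"
      using V le[OF V(1,2)] by (intro CollectI exI[of _ V]) auto
  qed (use le in auto)
qed

theorem theorem7p1:
  fixes V :: "(real^3) set" and n :: nat
  assumes "finite V" and "card V = n" and "n \<ge> 4" and "diameter V = 1"
  shows "(extremal_Vazsonyi V \<longleftrightarrow> num_diameters V = 2 * n - 2)
       \<and> (num_diameters V = 2 * n - 2 \<longleftrightarrow> tight V \<and> V = ball_set_vertices V)"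
proof
  show "extremal_Vazsonyi V \<longleftrightarrow> num_diameters V = 2 * n - 2"
    using assms by (simp add: extremal_Vazsonyi_def max_num_diameters_eq)
  have d: "dist x y \<le> 1" if "x \<in> V" "y \<in> V" for x y
    using diameter_bounded_bound[OF finite_imp_bounded[OF assms(1)] that] assms(4) by simp
  have num: "num_diameters V = card (unit_pairs V)"
    using assms(4) by (rule num_diameters_eq_unit_pairs)
  show "num_diameters V = 2 * n - 2 \<longleftrightarrow> tight V \<and> V = ball_set_vertices V"
  proof
    assume e: "num_diameters V = 2 * n - 2"
    have deg2: "2 \<le> card (touching V v)" if v: "v \<in> V" for v
    proof -
      have c: "card (V - {v}) = n - 1" using assms v by simp
      have "card (unit_pairs (V - {v})) + 2 \<le> 2 * card (V - {v})"
      proof (rule card_unit_pairs_le)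
        show "V - {v} \<noteq> {}"
        proof
          assume "V - {v} = {}"
          then have "card (V - {v}) = 0" by (simp only: card.empty)
          then show False using c assms(3) by linarith
        qed
      qed (use assms(1) d in auto)
      then show ?thesis
        using unit_pairs_remove[OF assms(1) v] e assms(3) unfolding num c by linarith
    qed
    then interpret unit_configuration V using assms(1) d by unfold_locales
    have "\<exists>x0\<in>V. 3 \<le> card (T x0)"
    proof (rule ccontr)
      assume "\<not> ?thesis"
      then have "(\<Sum>v\<in>V. card (T v)) \<le> (\<Sum>v\<in>V. 2)" by (intro sum_mono) force
      then show False using e assms(2,3) unfolding num sum_degrees[OF assms(1)] by simp
    qed
    then obtain x0 where "x0 \<in> V" "3 \<le> card (T x0)" by blast
    then have "card (W - V) = 0" using excess_count(1)[of x0] e assms(2,3) unfolding num by linarith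
    then have "W = V" using V_subset_W finite_W by auto
    moreover have "tight V"
      unfolding tight_def using assms(1) d all_essential circumradius_less_1 by blast
    ultimately show "tight V \<and> V = ball_set_vertices V" by simp
  next
    assume "tight V \<and> V = ball_set_vertices V"
    then have VW: "ball_set_vertices V = V" by simp
    have deg2: "2 \<le> card (touching V v)" if v: "v \<in> V" for v
    proof -
      have "v \<in> ball_set_vertices V" using v VW by simp
      then show ?thesis
        by (auto simp: ball_set_vertices_def principal_vertices_def dangling_vertices_def touching_def)
    qed
    then interpret unit_configuration V using assms(1) d by unfold_locales
    have "V \<noteq> {}" using assms by auto
    then obtain z where "z \<in> W" "3 \<le> card (T z)" using principal_vertex_exists by blast
    then show "num_diameters V = 2 * n - 2"
      using excess_count(2)[of z] VW assms(2) num by simp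
  qed
qed

end
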